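(* Let $\Omega\subset\mathbb{R}^N$ ($N\ge2$) be a bounded and regular domain, let $n\in\mathbb{N}$, and let $G:\overline\Omega\times\mathbb{R}^n\to\mathbb{R}$, $(x,u)\mapsto G(x,u)$, satisfy: 1. (a) $u\mapsto G(x,u)$ is of class $C^2(\mathbb{R}^n,\mathbb{R})$ for every $x\in\overline\Omega$; (b) $x\mapsto G(x,u)$ is continuous on $\overline\Omega$ for every $u\in\mathbb{R}^n$. 2. There exist continuous (real symmetric $n\times n$) matrix functions $A(\cdot)$, $B(\cdot)$ on $\overline\Omega$, with $B(x)$ diagonal with entries $b_{ii}(x)$, and numbers $p_i\in(N/2,\infty]$, $1\le i\le n$, such that $$A(x)\le G_{uu}(x,u)\le B(x)\ \text{ in }\overline\Omega\times\mathbb{R}^n,$$ $$\|b_{ii}^+\|_{p_i}<\beta_{p_i},\quad 1\le i\le n,$$ $$\int_\Omega\langle A(x)k,k\rangle\,dx>0\quad\forall\,k\in\mathbb{R}^n\setminus\{0\}.$$ Then the system $$\Delta u(x)+G_u(x,u(x))=0,\ x\in\Omega,\qquad \frac{\partial u(x)}{\partial n}=0,\ x\in\partial\Omega,$$ has a unique solution.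
   Context: "Regular domain" means a domain with sufficiently smooth boundary; $\frac{\partial}{\partial n}$ is the outer normal derivative on $\partial\Omega$. $G_u$ and $G_{uu}$ are the gradient and the Hessian matrix of $G$ with respect to $u\in\mathbb{R}^n$. For symmetric matrices, $C\le D$ means $D-C$ is positive semidefinite; $\langle\cdot,\cdot\rangle$ is the usual inner product of $\mathbb{R}^n$. The unknown is $u:\Omega\to\mathbb{R}^n$, $u\in(H^1(\Omega))^n$. For $N/2<p\le\infty$, $\beta_p=\inf_{a\in\Sigma}\|a^+\|_p$, where $a^+=\max(a,0)$, $\|\cdot\|_p$ is the $L^p(\Omega)$ norm, and $\Sigma$ is the set of scalar functions $a\in L^\infty(\Omega)\setminus\{0\}$ such that $\int_\Omega a(x)\,dx\ge0$ and the scalar linear Neumann problem $\Delta w+a(x)w=0$ in $\Omega$, $\frac{\partial w}{\partial n}=0$ on $\partial\Omega$, has nontrivial (weak, $H^1(\Omega)$) solutions. *)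

theory Defs
  imports "HOL-Analysis.Analysis" "HOL-Probability.Essential_Supremum"
begin

primrec class_C :: "nat \<Rightarrow> ('a::euclidean_space \<Rightarrow> real) \<Rightarrow> bool" where
  "class_C 0 f \<longleftrightarrow> continuous_on UNIV f"
| "class_C (Suc k) f \<longleftrightarrow>
     f differentiable_on UNIV \<and> (\<forall>b\<in>Basis. class_C k (\<lambda>x. frechet_derivative f (at x) b))"

definition grad :: "('a::euclidean_space \<Rightarrow> real) \<Rightarrow> 'a \<Rightarrow> 'a" where
  "grad f x = (\<Sum>b\<in>Basis. frechet_derivative f (at x) b *\<^sub>R b)"

definition hessian :: "(real^'n \<Rightarrow> real) \<Rightarrow> real^'n \<Rightarrow> real^'n^'n" where
  "hessian f x = jacobian (grad f) (at x)"

definition loewner_le :: "real^'n^'n \<Rightarrow> real^'n^'n \<Rightarrow> bool" where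
  "loewner_le C D \<longleftrightarrow>
     transpose C = C \<and> transpose D = D \<and> (\<forall>k. 0 \<le> ((D - C) *v k) \<bullet> k)"

text \<open>
  The boundary is of class C1: near each boundary point, in suitable Cartesian coordinates
  with vertical direction e, the domain is the part of a ball above the graph of a C1 function
  of the remaining coordinates. The point \<open>x - (x \<bullet> e) *\<^sub>R e\<close> lies in the hyperplane orthogonal to e,
  so only the values of \<open>\<gamma>\<close> on that hyperplane matter. This is the least smoothness for which the
  outer normal is defined everywhere on the boundary, and it covers every smoother class.
\<close>
definition C1_boundary :: "'a::euclidean_space set \<Rightarrow> bool" where
  "C1_boundary \<Omega> \<longleftrightarrow>
     (\<forall>z\<in>frontier \<Omega>. \<exists>r>0. \<exists>e \<gamma>. norm e = 1 \<and> class_C 1 \<gamma> \<and>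
        \<Omega> \<inter> ball z r = {x \<in> ball z r. \<gamma> (x - (x \<bullet> e) *\<^sub>R e) < x \<bullet> e})"

definition regular_domain :: "'a::euclidean_space set \<Rightarrow> bool" where
  "regular_domain \<Omega> \<longleftrightarrow> open \<Omega> \<and> connected \<Omega> \<and> \<Omega> \<noteq> {} \<and> C1_boundary \<Omega>"

text \<open>
  Functions are defined on the whole space, but only their values on \<open>\<Omega>\<close> are used; elements of
  Lebesgue and Sobolev spaces are functions, to be identified when equal almost everywhere.
\<close>

definition Lp_norm :: "'a::euclidean_space set \<Rightarrow> ennreal \<Rightarrow> ('a \<Rightarrow> real) \<Rightarrow> ennreal" where
  "Lp_norm \<Omega> p f =
     (if p = \<infinity> then esssup (lebesgue_on \<Omega>) (\<lambda>x. ennreal \<bar>f x\<bar>)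
      else let I = (\<integral>\<^sup>+ x. ennreal (\<bar>f x\<bar> powr enn2real p) \<partial>lebesgue_on \<Omega>)
           in if I = \<infinity> then \<infinity> else ennreal (enn2real I powr (1 / enn2real p)))"

definition in_Linf :: "'a::euclidean_space set \<Rightarrow> ('a \<Rightarrow> real) \<Rightarrow> bool" where
  "in_Linf \<Omega> f \<longleftrightarrow> f \<in> borel_measurable (lebesgue_on \<Omega>) \<and> Lp_norm \<Omega> \<infinity> f < \<infinity>"

definition in_L2 :: "'a::euclidean_space set \<Rightarrow> ('a \<Rightarrow> 'b::euclidean_space) \<Rightarrow> bool" where
  "in_L2 \<Omega> f \<longleftrightarrow>
     f \<in> borel_measurable (lebesgue_on \<Omega>) \<and> integrable (lebesgue_on \<Omega>) (\<lambda>x. (norm (f x))\<^sup>2)"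

definition test_function :: "'a::euclidean_space set \<Rightarrow> ('a \<Rightarrow> real) \<Rightarrow> bool" where
  "test_function \<Omega> \<phi> \<longleftrightarrow> (\<forall>k. class_C k \<phi>) \<and>
     compact (closure {x. \<phi> x \<noteq> 0}) \<and> closure {x. \<phi> x \<noteq> 0} \<subseteq> \<Omega>"

text \<open>f belongs to \<open>H\<^sup>1(\<Omega>)\<close> and g is its weak (distributional) gradient.\<close>
definition H1_gradient ::
    "'a::euclidean_space set \<Rightarrow> ('a \<Rightarrow> real) \<Rightarrow> ('a \<Rightarrow> 'a) \<Rightarrow> bool" where
  "H1_gradient \<Omega> f g \<longleftrightarrow> in_L2 \<Omega> f \<and> in_L2 \<Omega> g \<and>
     (\<forall>\<phi>. test_function \<Omega> \<phi> \<longrightarrow> (\<forall>b\<in>Basis.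
        (LINT x|lebesgue_on \<Omega>. f x * frechet_derivative \<phi> (at x) b) =
        - (LINT x|lebesgue_on \<Omega>. (g x \<bullet> b) * \<phi> x)))"

definition H1 :: "'a::euclidean_space set \<Rightarrow> ('a \<Rightarrow> real) set" where
  "H1 \<Omega> = {f. \<exists>g. H1_gradient \<Omega> f g}"

text \<open>
  w is a weak solution in \<open>H\<^sup>1(\<Omega>)\<close> of \<open>\<Delta>w + f = 0\<close> in \<open>\<Omega>\<close> with vanishing outer normal derivative.
  The boundary condition is the natural one, encoded by admitting every v in \<open>H\<^sup>1(\<Omega>)\<close>. The
  integrability clause excludes the convention that non-integrable functions have integral 0.
\<close>
definition weak_neumann :: "'a::euclidean_space set \<Rightarrow> ('a \<Rightarrow> real) \<Rightarrow> ('a \<Rightarrow> real) \<Rightarrow> bool" where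
  "weak_neumann \<Omega> w f \<longleftrightarrow> (\<exists>Dw. H1_gradient \<Omega> w Dw \<and>
     (\<forall>v Dv. H1_gradient \<Omega> v Dv \<longrightarrow>
        integrable (lebesgue_on \<Omega>) (\<lambda>x. f x * v x) \<and>
        (LINT x|lebesgue_on \<Omega>. Dw x \<bullet> Dv x) = (LINT x|lebesgue_on \<Omega>. f x * v x)))"

definition neumann_system_solution ::
    "'a::euclidean_space set \<Rightarrow> ('a \<Rightarrow> real^'n \<Rightarrow> real) \<Rightarrow> ('a \<Rightarrow> real^'n) \<Rightarrow> bool" where
  "neumann_system_solution \<Omega> G u \<longleftrightarrow>
     (\<forall>i. (\<lambda>x. u x $ i) \<in> H1 \<Omega> \<and>
          weak_neumann \<Omega> (\<lambda>x. u x $ i) (\<lambda>x. grad (G x) (u x) $ i))"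

definition Sigma_set :: "'a::euclidean_space set \<Rightarrow> ('a \<Rightarrow> real) set" where
  "Sigma_set \<Omega> = {a. in_Linf \<Omega> a \<and> \<not> (AE x in lebesgue_on \<Omega>. a x = 0) \<and>
     0 \<le> (LINT x|lebesgue_on \<Omega>. a x) \<and>
     (\<exists>w. w \<in> H1 \<Omega> \<and> \<not> (AE x in lebesgue_on \<Omega>. w x = 0) \<and>
          weak_neumann \<Omega> w (\<lambda>x. a x * w x))}"

definition beta :: "'a::euclidean_space set \<Rightarrow> ennreal \<Rightarrow> ennreal" where
  "beta \<Omega> p = (INF a\<in>Sigma_set \<Omega>. Lp_norm \<Omega> p (\<lambda>x. max (a x) 0))"

end

theory Submission
  imports Defs "HOL-Library.Function_Algebras" "HOL-Library.Diagonal_Subsequence"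
begin

text \<open>
  The functional of the system is concave along constant vectors, because of \<open>\<integral> \<langle>A k, k\<rangle> > 0\<close>, and
  convex along functions \<open>w\<close> whose \<open>i\<close>-th component is orthogonal to \<open>b\<^sub>i\<^sub>i\<^sup>+\<close>. For the latter, let
  \<open>\<mu>\<close> be the best constant in \<open>\<mu> \<integral> b\<^sub>i\<^sub>i\<^sup>+ w\<^sup>2 \<le> \<integral> |Dw|\<^sup>2\<close>; by Rellich compactness it is attained,
  so \<open>\<mu> b\<^sub>i\<^sub>i\<^sup>+ \<in> \<Sigma>\<close>, and the bound on the norm of \<open>b\<^sub>i\<^sub>i\<^sup>+\<close> forces \<open>\<mu> > 1\<close>. Reversing the
  sign of the derivative along the constants turns it into a Lipschitz and strongly monotone operator on
  \<open>H\<^sup>1\<close>, which has exactly one zero.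
\<close>

section \<open>Strongly monotone operators on semi-inner product spaces\<close>

text \<open>Three points carry the weight. First, the sign reversal produces no mixed terms: the
  Hessian is symmetric, so its form on \<open>w + k\<close> against \<open>w - k\<close> keeps only
  the pure terms, bounded through \<open>B\<close> for \<open>w\<close> and through \<open>A\<close>
  for the constant \<open>k\<close>. The gradient term sees only \<open>w\<close>, since constants
  have zero gradient. Second, compactness comes from an inequality that bounds the square norm of a
  function by a small multiple of that of its gradient plus finitely many squared integrals over
  Borel sets. In the interior these are integrals over small balls; near the boundary the function
  is compared with a translate pushed into the domain along the vertical direction of the graph.
  Only increments along segments inside the domain enter. Third, the minimiser behind the best
  constant is found under the constraint of being orthogonal to the weight, while membership in
  \<Sigma> asks for the equation against every test function. Constants make both sides of the
  equation 0, so the constraint leaves no multiplier. Functions equal almost everywhere are not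
  identified, hence seminorms throughout.\<close>

lemma quadratic_nonneg_imp:
  fixes a b c :: real
  assumes "\<And>t. 0 \<le> a + 2 * t * b + t\<^sup>2 * c"
  shows "b\<^sup>2 \<le> a * c"
proof (cases "c = 0")
  case True
  have "b = 0"
  proof (rule ccontr)
    assume "b \<noteq> 0"
    then have "2 * (- (a + 1) / (2 * b)) * b = - (a + 1)" by simp
    then show False using assms[of "- (a + 1) / (2 * b)"] True by simp
  qed
  then show ?thesis using True by simp
next
  case False
  have "0 \<le> a + 2 * t * b + t\<^sup>2 * c" for t by (rule assms)
  from this[of "1"] this[of "-1"] have ac: "0 \<le> a + c" by simp
  have a: "0 \<le> a" using assms[of 0] by simp
  have c: "c > 0"
  proof (rule ccontr)
    assume "\<not> c > 0"
    then have c: "c < 0" using False by simp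
    define t where "t = sqrt ((a + 1) / (- c))"
    have t2: "t\<^sup>2 = (a + 1) / (- c)" unfolding t_def using c a by (simp add: divide_nonneg_neg)
    have "0 \<le> a + 2 * t * b + t\<^sup>2 * c" "0 \<le> a + 2 * (- t) * b + (- t)\<^sup>2 * c"
      by (rule assms)+
    then have "0 \<le> a + t\<^sup>2 * c" by simp
    then show False unfolding t2 using c by (simp add: field_simps)
  qed
  have "0 \<le> a + 2 * (- b / c) * b + (- b / c)\<^sup>2 * c" by (rule assms)
  then have "0 \<le> (a + 2 * (- b / c) * b + (- b / c)\<^sup>2 * c) * c" using c by simp
  also have "\<dots> = a * c - b\<^sup>2" using c by (simp add: field_simps power2_eq_square)
  finally show ?thesis by simp
qed

text \<open>The form may be degenerate: functions that agree almost everywhere stay distinct, so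
  \<open>ip x x = 0\<close> does not force \<open>x = 0\<close>, and the limit in
  \<open>ip_complete\<close> need not be unique.\<close>

locale semi_hilbert =
  fixes V :: "'v::real_vector set" and ip :: "'v \<Rightarrow> 'v \<Rightarrow> real"
  assumes subspace: "subspace V"
    and ip_commute: "\<And>x y. x \<in> V \<Longrightarrow> y \<in> V \<Longrightarrow> ip x y = ip y x"
    and ip_add_left: "\<And>x y z. x \<in> V \<Longrightarrow> y \<in> V \<Longrightarrow> z \<in> V \<Longrightarrow> ip (x + y) z = ip x z + ip y z"
    and ip_scale_left: "\<And>c x y. x \<in> V \<Longrightarrow> y \<in> V \<Longrightarrow> ip (c *\<^sub>R x) y = c * ip x y"
    and ip_nonneg: "\<And>x. x \<in> V \<Longrightarrow> 0 \<le> ip x x"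
    and ip_complete: "\<And>X. (\<And>n::nat. X n \<in> V) \<Longrightarrow>
          (\<And>e. e > 0 \<Longrightarrow> \<exists>M. \<forall>m\<ge>M. \<forall>n\<ge>M. ip (X m - X n) (X m - X n) < e) \<Longrightarrow>
          \<exists>x\<in>V. (\<lambda>n. ip (X n - x) (X n - x)) \<longlonglongrightarrow> 0"
begin

lemma closed_add [intro]: "x \<in> V \<Longrightarrow> y \<in> V \<Longrightarrow> x + y \<in> V"
  and closed_scale [intro]: "x \<in> V \<Longrightarrow> c *\<^sub>R x \<in> V"
  and closed_diff [intro]: "x \<in> V \<Longrightarrow> y \<in> V \<Longrightarrow> x - y \<in> V"
  and closed_zero [intro]: "0 \<in> V"
  using subspace by (auto intro: subspace_add subspace_scale subspace_diff subspace_0)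

lemma ip_add_right: "x \<in> V \<Longrightarrow> y \<in> V \<Longrightarrow> z \<in> V \<Longrightarrow> ip z (x + y) = ip z x + ip z y"
  using ip_add_left ip_commute closed_add by metis

lemma ip_scale_right: "x \<in> V \<Longrightarrow> y \<in> V \<Longrightarrow> ip y (c *\<^sub>R x) = c * ip y x"
  using ip_scale_left ip_commute closed_scale by metis

lemma ip_diff_left: "x \<in> V \<Longrightarrow> y \<in> V \<Longrightarrow> z \<in> V \<Longrightarrow> ip (x - y) z = ip x z - ip y z"
  using ip_add_left[of x "(-1) *\<^sub>R y" z] ip_scale_left[of y z "-1"] closed_scale[of y "-1"] by simp

lemma ip_diff_right: "x \<in> V \<Longrightarrow> y \<in> V \<Longrightarrow> z \<in> V \<Longrightarrow> ip z (x - y) = ip z x - ip z y"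
  using ip_diff_left ip_commute closed_diff by metis

lemmas ip_simps = ip_add_left ip_add_right ip_diff_left ip_diff_right ip_scale_left ip_scale_right
  closed_add closed_scale closed_diff

lemma ip_add_scaled:
  assumes "x \<in> V" "y \<in> V"
  shows "ip (x + t *\<^sub>R y) (x + t *\<^sub>R y) = ip x x + 2 * t * ip x y + t\<^sup>2 * ip y y"
  using assms by (simp add: ip_simps ip_commute[of y x] power2_eq_square algebra_simps)

lemma ip_Cauchy_Schwarz:
  assumes "x \<in> V" "y \<in> V"
  shows "(ip x y)\<^sup>2 \<le> ip x x * ip y y"
proof (rule quadratic_nonneg_imp)
  fix t
  have "0 \<le> ip (x + t *\<^sub>R y) (x + t *\<^sub>R y)" using assms by (intro ip_nonneg) auto
  then show "0 \<le> ip x x + 2 * t * ip x y + t\<^sup>2 * ip y y" using ip_add_scaled[OF assms] by simp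
qed

definition nrm :: "'v \<Rightarrow> real" where "nrm x = sqrt (ip x x)"

lemma nrm_nonneg: "x \<in> V \<Longrightarrow> 0 \<le> nrm x"
  using ip_nonneg by (simp add: nrm_def)

lemma nrm_sq: "x \<in> V \<Longrightarrow> (nrm x)\<^sup>2 = ip x x"
  using ip_nonneg by (simp add: nrm_def)

lemma abs_ip_le: "x \<in> V \<Longrightarrow> y \<in> V \<Longrightarrow> \<bar>ip x y\<bar> \<le> nrm x * nrm y"
  using real_sqrt_le_mono[OF ip_Cauchy_Schwarz, of x y] by (simp add: nrm_def real_sqrt_mult)

lemma nrm_triangle:
  assumes "x \<in> V" "y \<in> V"
  shows "nrm (x + y) \<le> nrm x + nrm y"
proof (rule power2_le_imp_le)
  have "(nrm (x + y))\<^sup>2 = (nrm x)\<^sup>2 + 2 * ip x y + (nrm y)\<^sup>2"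
    using assms by (simp add: nrm_sq ip_simps ip_commute[of y x])
  also have "\<dots> \<le> (nrm x + nrm y)\<^sup>2"
    using abs_ip_le[OF assms] by (simp add: power2_sum)
  finally show "(nrm (x + y))\<^sup>2 \<le> (nrm x + nrm y)\<^sup>2" .
  show "0 \<le> nrm x + nrm y" using assms nrm_nonneg by simp
qed

lemma nrm_minus_commute: "x \<in> V \<Longrightarrow> y \<in> V \<Longrightarrow> nrm (x - y) = nrm (y - x)"
  by (simp add: nrm_def ip_simps ip_commute[of y x])

text \<open>The functional \<open>J v = ip v v - 2 * l v\<close> is minimised over \<open>V\<close>.
  The bound on \<open>l\<close> keeps \<open>J\<close> bounded below, the parallelogram identity
  makes minimising sequences Cauchy, and the first variation at a limit says that the limit
  represents \<open>l\<close>.\<close>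

lemma riesz:
  assumes add: "\<And>x y. x \<in> V \<Longrightarrow> y \<in> V \<Longrightarrow> l (x + y) = l x + l y"
    and scale: "\<And>c x. x \<in> V \<Longrightarrow> l (c *\<^sub>R x) = c * l x"
    and bound: "\<And>x. x \<in> V \<Longrightarrow> \<bar>l x\<bar> \<le> M * nrm x"
  shows "\<exists>u\<in>V. \<forall>v\<in>V. ip u v = l v"
proof -
  define J where "J v = ip v v - 2 * l v" for v
  have J_ge: "- (M\<^sup>2) \<le> J v" if v: "v \<in> V" for v
  proof -
    have "0 \<le> (nrm v - M)\<^sup>2" by simp
    then show ?thesis using bound[OF v] nrm_sq[OF v] by (simp add: J_def power2_diff algebra_simps)
  qed
  define I where "I = Inf (J ` V)"
  have bdd: "bdd_below (J ` V)" using J_ge by (auto intro!: bdd_belowI[of _ "- (M\<^sup>2)"])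
  have I_le: "I \<le> J v" if "v \<in> V" for v
    unfolding I_def using bdd that by (intro cINF_lower) auto
  have "\<exists>v\<in>V. J v < I + 1 / Suc n" for n
  proof -
    have "I < I + 1 / Suc n" by simp
    then show ?thesis unfolding I_def
      using cINF_less_iff[of V J "Inf (J ` V) + 1 / Suc n"] bdd closed_zero by blast
  qed
  then obtain X where X: "\<And>n. X n \<in> V" "\<And>n. J (X n) < I + 1 / Suc n" by metis
  have par: "ip (X m - X n) (X m - X n) < 2 / Suc m + 2 / Suc n" for m n
  proof -
    have "I \<le> J ((1/2) *\<^sub>R (X m + X n))" using X by (intro I_le) auto
    also have "\<dots> = J (X m) / 2 + J (X n) / 2 - ip (X m - X n) (X m - X n) / 4"
    proof -
      have "ip ((1/2) *\<^sub>R (X m + X n)) ((1/2) *\<^sub>R (X m + X n)) = ip (X m) (X m) / 4 + ip (X m) (X n) / 2 + ip (X n) (X n) / 4"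
        using X(1) by (simp add: ip_simps ip_commute[of "X n" "X m"] add_divide_distrib del: scaleR_add_right)
      moreover have "ip (X m - X n) (X m - X n) = ip (X m) (X m) - 2 * ip (X m) (X n) + ip (X n) (X n)"
        using X(1) by (simp add: ip_simps ip_commute[of "X n" "X m"])
      moreover have "l ((1/2) *\<^sub>R (X m + X n)) = l (X m) / 2 + l (X n) / 2"
        using X(1) by (simp add: add scale closed_add del: scaleR_add_right)
      ultimately show ?thesis unfolding J_def by argo
    qed
    finally show ?thesis using X(2)[of m] X(2)[of n] by simp
  qed
  have "\<exists>u\<in>V. (\<lambda>n. ip (X n - u) (X n - u)) \<longlonglongrightarrow> 0"
  proof (rule ip_complete[OF X(1)])
    fix e :: real assume "e > 0"
    then obtain K where K: "1 / Suc K < e / 4" using nat_approx_posE[of "e/4"] by auto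
    have "ip (X m - X n) (X m - X n) < e" if "K \<le> m" "K \<le> n" for m n
    proof -
      have "1 / Suc m \<le> 1 / Suc K" "1 / Suc n \<le> 1 / Suc K" using that by (auto simp: frac_le)
      then show ?thesis using par[of m n] K by simp
    qed
    then show "\<exists>M. \<forall>m\<ge>M. \<forall>n\<ge>M. ip (X m - X n) (X m - X n) < e" by blast
  qed
  then obtain u where u: "u \<in> V" "(\<lambda>n. ip (X n - u) (X n - u)) \<longlonglongrightarrow> 0" by blast
  have "ip u w = l w" if w: "w \<in> V" for w
  proof -
    have "(\<lambda>n. nrm (X n - u) * nrm w) \<longlonglongrightarrow> 0"
      using tendsto_mult_right[OF tendsto_real_sqrt[OF u(2)], of "nrm w"] by (simp add: nrm_def)
    then have lim: "(\<lambda>n. ip (X n - u) w) \<longlonglongrightarrow> 0"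
      by (rule Lim_null_comparison[rotated])
        (use abs_ip_le[OF closed_diff[OF X(1) u(1)] w] in \<open>auto intro!: always_eventually\<close>)
    \<comment> \<open>Minimality is used at \<open>X n\<close> with slack \<open>1 / Suc n\<close>
      and then passed to the limit through \<open>ip (X n - u) w\<close>; the value
      \<open>J u\<close> itself is never computed.\<close>
    have "0 \<le> 0 + 2 * t * (ip u w - l w) + t\<^sup>2 * ip w w" for t
    proof -
      have "0 \<le> 1 / Suc n + 2 * t * (ip u w - l w) + 2 * t * ip (X n - u) w + t\<^sup>2 * ip w w" for n
      proof -
        have "I \<le> J (X n + t *\<^sub>R w)" using X w by (intro I_le) auto
        also have "\<dots> = J (X n) + 2 * t * (ip (X n) w - l w) + t\<^sup>2 * ip w w"
          using X(1) w by (simp add: J_def ip_simps add scale ip_commute[of w "X n"] power2_eq_square algebra_simps)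
        finally show ?thesis
          using X(1) X(2)[of n] u(1) w by (simp add: ip_simps algebra_simps)
      qed
      moreover have "(\<lambda>n. 1 / Suc n + 2 * t * (ip u w - l w) + 2 * t * ip (X n - u) w + t\<^sup>2 * ip w w)
            \<longlonglongrightarrow> 0 + 2 * t * (ip u w - l w) + 2 * t * 0 + t\<^sup>2 * ip w w"
        by (intro tendsto_intros lim LIMSEQ_Suc[OF lim_1_over_n])
      ultimately show ?thesis by (auto intro: LIMSEQ_le_const)
    qed
    \<comment> \<open>With \<open>a = 0\<close> the discriminant bound reads
      \<open>b\<^sup>2 \<le> 0\<close>. The same device gives the Euler-Lagrange equation in the
      spectral gap.\<close>
    from quadratic_nonneg_imp[OF this] show ?thesis by simp
  qed
  then show ?thesis using u(1) by blast
qed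

text \<open>Zarantonello: for the Riesz representative \<open>S u\<close> of \<open>\<Phi> u\<close>, the map \<open>u - \<tau> S u\<close> is a
  contraction when \<open>\<tau> = c / L\<^sup>2\<close>.\<close>

lemma strongly_monotone_zero:
  assumes add: "\<And>u x y. u \<in> V \<Longrightarrow> x \<in> V \<Longrightarrow> y \<in> V \<Longrightarrow> \<Phi> u (x + y) = \<Phi> u x + \<Phi> u y"
    and scale: "\<And>u k x. u \<in> V \<Longrightarrow> x \<in> V \<Longrightarrow> \<Phi> u (k *\<^sub>R x) = k * \<Phi> u x"
    and bound: "\<And>u. u \<in> V \<Longrightarrow> \<exists>M. \<forall>x\<in>V. \<bar>\<Phi> u x\<bar> \<le> M * nrm x"
    and lip: "\<And>u v x. u \<in> V \<Longrightarrow> v \<in> V \<Longrightarrow> x \<in> V \<Longrightarrow> \<bar>\<Phi> u x - \<Phi> v x\<bar> \<le> L * nrm (u - v) * nrm x"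
    and mono: "\<And>u v. u \<in> V \<Longrightarrow> v \<in> V \<Longrightarrow> c * (nrm (u - v))\<^sup>2 \<le> \<Phi> u (u - v) - \<Phi> v (u - v)"
    and c: "c > 0"
  shows "\<exists>u\<in>V. \<forall>v\<in>V. \<Phi> u v = 0"
proof -
  have "\<exists>s\<in>V. \<forall>v\<in>V. ip s v = \<Phi> u v" if u: "u \<in> V" for u
  proof -
    from bound[OF u] obtain M where "\<forall>x\<in>V. \<bar>\<Phi> u x\<bar> \<le> M * nrm x" ..
    then show ?thesis by (intro riesz[where l = "\<Phi> u" and M = M]) (auto simp: add scale u)
  qed
  then obtain S where S: "\<And>u. u \<in> V \<Longrightarrow> S u \<in> V" "\<And>u v. u \<in> V \<Longrightarrow> v \<in> V \<Longrightarrow> ip (S u) v = \<Phi> u v"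
    by metis
  \<comment> \<open>\<open>L\<close> may be smaller than \<open>c\<close>; the maximum guarantees
    \<open>c\<^sup>2 / K\<^sup>2 \<le> 1\<close>, so that the contraction factor \<open>q\<close>
    lies between 0 and 1.\<close>
  define K where "K = max L c"
  have K: "K \<ge> L" "K \<ge> c" "K > 0" using c by (auto simp: K_def)
  have lipS: "nrm (S u - S v) \<le> K * nrm (u - v)" if uv: "u \<in> V" "v \<in> V" for u v
  proof (cases "nrm (S u - S v) = 0")
    case False
    let ?d = "S u - S v"
    have d: "?d \<in> V" using S uv by auto
    have "nrm ?d * nrm ?d = \<Phi> u ?d - \<Phi> v ?d"
      using S uv d by (simp add: nrm_sq[symmetric] power2_eq_square[symmetric] flip: S(2))
        (simp add: nrm_sq ip_diff_left S uv d)
    also have "\<dots> \<le> L * nrm (u - v) * nrm ?d" using lip[OF uv d] by simp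
    finally have "nrm ?d \<le> L * nrm (u - v)"
      using False nrm_nonneg[OF d] by (simp add: mult_le_cancel_right)
    also have "\<dots> \<le> K * nrm (u - v)" using K uv by (intro mult_right_mono nrm_nonneg) auto
    finally show ?thesis .
  qed (use K uv in \<open>auto intro!: mult_nonneg_nonneg nrm_nonneg\<close>)
  have monoS: "c * (nrm (u - v))\<^sup>2 \<le> ip (S u - S v) (u - v)" if uv: "u \<in> V" "v \<in> V" for u v
    using mono[OF uv] S uv by (simp add: ip_diff_left[of "S u" "S v" "u - v"] closed_diff)
  \<comment> \<open>The factor \<open>1 - 2 * \<tau> * c + \<tau>\<^sup>2 * K\<^sup>2\<close> is
    least at this \<open>\<tau>\<close>, with value \<open>q\<close>.\<close>
  define \<tau> where "\<tau> = c / K\<^sup>2"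
  define q where "q = 1 - c\<^sup>2 / K\<^sup>2"
  have \<tau>: "\<tau> > 0" using c K by (simp add: \<tau>_def)
  have "c\<^sup>2 \<le> K\<^sup>2" using K c by (intro power_mono) auto
  then have q: "0 \<le> q" "q < 1" using c K by (auto simp: q_def)
  define T where "T u = u - \<tau> *\<^sub>R S u" for u
  have TV: "T u \<in> V" if "u \<in> V" for u using that S by (auto simp: T_def)
  have contr: "ip (T u - T v) (T u - T v) \<le> q * ip (u - v) (u - v)" if uv: "u \<in> V" "v \<in> V" for u v
  proof -
    let ?d = "u - v" and ?s = "S u - S v"
    have ds: "?d \<in> V" "?s \<in> V" using S uv by auto
    have T_eq: "T u - T v = ?d + (- \<tau>) *\<^sub>R ?s" by (simp add: T_def algebra_simps)
    have "ip (T u - T v) (T u - T v) = ip ?d ?d - 2 * \<tau> * ip ?s ?d + \<tau>\<^sup>2 * ip ?s ?s"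
      unfolding T_eq ip_add_scaled[OF ds] ip_commute[OF ds] by simp
    also have "\<dots> \<le> ip ?d ?d - 2 * \<tau> * (c * ip ?d ?d) + \<tau>\<^sup>2 * (K\<^sup>2 * ip ?d ?d)"
    proof -
      have "(nrm ?s)\<^sup>2 \<le> (K * nrm ?d)\<^sup>2" using lipS[OF uv] nrm_nonneg[OF ds(2)] by (rule power_mono)
      then have "ip ?s ?s \<le> K\<^sup>2 * ip ?d ?d" using ds by (simp add: nrm_sq power_mult_distrib)
      then have "\<tau>\<^sup>2 * ip ?s ?s \<le> \<tau>\<^sup>2 * (K\<^sup>2 * ip ?d ?d)" by (intro mult_left_mono) auto
      moreover have "2 * \<tau> * (c * ip ?d ?d) \<le> 2 * \<tau> * ip ?s ?d"
        using monoS[OF uv] \<tau> ds by (intro mult_left_mono) (auto simp: nrm_sq)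
      ultimately show ?thesis by linarith
    qed
    also have "\<dots> = q * ip ?d ?d" using K by (simp add: \<tau>_def q_def field_simps power2_eq_square)
    finally show ?thesis .
  qed
  define X where "X n = (T ^^ n) 0" for n
  have XV: "X n \<in> V" for n by (induction n) (auto simp: X_def TV)
  have X_Suc: "X (Suc n) = T (X n)" for n by (simp add: X_def)
  define d0 where "d0 = ip (X 1 - X 0) (X 1 - X 0)"
  have step: "ip (X (Suc n) - X n) (X (Suc n) - X n) \<le> q ^ n * d0" for n
  proof (induction n)
    case (Suc n)
    have "ip (X (Suc (Suc n)) - X (Suc n)) (X (Suc (Suc n)) - X (Suc n)) \<le> q * ip (X (Suc n) - X n) (X (Suc n) - X n)"
      unfolding X_Suc[of "Suc n"] X_Suc[of n] using contr[OF TV[OF XV] XV] by (simp add: X_Suc)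
    also have "\<dots> \<le> q * (q ^ n * d0)" using Suc q by (intro mult_left_mono)
    finally show ?case by (simp add: mult.assoc)
  qed (simp add: d0_def)
  have nS: "ip (S (X n)) (S (X n)) \<le> q ^ n * (d0 / \<tau>\<^sup>2)" for n
  proof -
    have "X (Suc n) - X n = (- \<tau>) *\<^sub>R S (X n)" by (simp add: X_Suc T_def)
    then have "ip (X (Suc n) - X n) (X (Suc n) - X n) = \<tau>\<^sup>2 * ip (S (X n)) (S (X n))"
      by (simp only: ip_scale_left ip_scale_right S XV closed_scale) (simp add: power2_eq_square)
    then show ?thesis using step[of n] \<tau> by (simp add: field_simps)
  qed
  have q0: "(\<lambda>n. q ^ n * (d0 / \<tau>\<^sup>2)) \<longlonglongrightarrow> 0"
    using tendsto_mult_right[OF LIMSEQ_realpow_zero[OF q], of "d0 / \<tau>\<^sup>2"] by simp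
  have ipS0: "(\<lambda>n. ip (S (X n)) (S (X n))) \<longlonglongrightarrow> 0"
  proof (rule real_tendsto_sandwich[OF _ _ tendsto_const q0])
    show "\<forall>\<^sub>F n in sequentially. 0 \<le> ip (S (X n)) (S (X n))" using ip_nonneg[OF S(1)[OF XV]] by simp
    show "\<forall>\<^sub>F n in sequentially. ip (S (X n)) (S (X n)) \<le> q ^ n * (d0 / \<tau>\<^sup>2)" using nS by simp
  qed
  have nSlim: "(\<lambda>n. nrm (S (X n))) \<longlonglongrightarrow> 0"
    unfolding nrm_def using tendsto_real_sqrt[OF ipS0] by simp
  \<comment> \<open>Strong monotonicity bounds the distance of two points by that of their images
    under \<open>S\<close>. Increments of the iteration are \<open>- \<tau>\<close> times
    \<open>S (X n)\<close>, so these images tend to 0 and the sequence is Cauchy without summing its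
    increments.\<close>
  have low: "c * nrm (u - v) \<le> nrm (S u - S v)" if uv: "u \<in> V" "v \<in> V" for u v
  proof (cases "nrm (u - v) = 0")
    case False
    have "c * nrm (u - v) * nrm (u - v) \<le> nrm (S u - S v) * nrm (u - v)"
      using monoS[OF uv] abs_ip_le[of "S u - S v" "u - v"] S uv
      by (simp add: power2_eq_square closed_diff)
    then show ?thesis using False nrm_nonneg[of "u - v"] uv by (simp add: mult_le_cancel_right closed_diff)
  qed (use S uv in \<open>auto intro!: nrm_nonneg\<close>)
  have diffS: "nrm (S u - S v) \<le> nrm (S u) + nrm (S v)" if uv: "u \<in> V" "v \<in> V" for u v
  proof -
    have "nrm ((-1) *\<^sub>R S v) = nrm (S v)"
      unfolding nrm_def by (simp only: ip_scale_left ip_scale_right S uv closed_scale) simp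
    then show ?thesis using nrm_triangle[of "S u" "(-1) *\<^sub>R S v"] S uv closed_scale[of "S v" "-1"] by simp
  qed
  have "\<exists>u\<in>V. (\<lambda>n. ip (X n - u) (X n - u)) \<longlonglongrightarrow> 0"
  proof (rule ip_complete[OF XV])
    fix e :: real assume e: "e > 0"
    then have "0 < c * sqrt e / 2" using c by simp
    from LIMSEQ_D[OF nSlim this] obtain M where M: "\<And>n. n \<ge> M \<Longrightarrow> nrm (S (X n)) < c * sqrt e / 2"
      using nrm_nonneg S XV by (auto simp: abs_of_nonneg)
    have "ip (X m - X n) (X m - X n) < e" if "M \<le> m" "M \<le> n" for m n
    proof -
      have "c * nrm (X m - X n) < c * sqrt e"
        using low[OF XV XV, of m n] diffS[OF XV XV, of m n] M[OF that(1)] M[OF that(2)] by simp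
      then show ?thesis using c e by (simp add: nrm_def)
    qed
    then show "\<exists>M. \<forall>m\<ge>M. \<forall>n\<ge>M. ip (X m - X n) (X m - X n) < e" by blast
  qed
  then obtain u where u: "u \<in> V" "(\<lambda>n. ip (X n - u) (X n - u)) \<longlonglongrightarrow> 0" by blast
  have "\<Phi> u v = 0" if v: "v \<in> V" for v
  proof -
    have bnd: "\<bar>\<Phi> u v\<bar> \<le> (K * nrm (X n - u) + nrm (S (X n))) * nrm v" for n
    proof -
      have "\<Phi> u v = ip (S u - S (X n)) v + ip (S (X n)) v"
        using S u v XV by (simp add: ip_diff_left)
      also have "\<bar>\<dots>\<bar> \<le> nrm (S u - S (X n)) * nrm v + nrm (S (X n)) * nrm v"
        using abs_ip_le[of "S u - S (X n)" v] abs_ip_le[of "S (X n)" v] S u v XV closed_diff by fastforce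
      also have "nrm (S u - S (X n)) \<le> K * nrm (X n - u)"
        using lipS[OF u(1) XV, of n] nrm_minus_commute[OF u(1) XV, of n] by simp
      finally show ?thesis using nrm_nonneg[OF v] by (simp add: algebra_simps mult_right_mono)
    qed
    have "(\<lambda>n. nrm (X n - u)) \<longlonglongrightarrow> 0" unfolding nrm_def using tendsto_real_sqrt[OF u(2)] by simp
    then have "(\<lambda>n. (K * nrm (X n - u) + nrm (S (X n))) * nrm v) \<longlonglongrightarrow> (K * 0 + 0) * nrm v"
      by (intro tendsto_intros nSlim)
    from LIMSEQ_le_const[OF this] bnd have "\<bar>\<Phi> u v\<bar> \<le> (K * 0 + 0) * nrm v" by blast
    then show ?thesis by simp
  qed
  then show ?thesis using u(1) by blast
qed

end

text \<open>Pointwise scaling makes the tuples of function-gradient pairs used later a real vector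
  space, as \<open>semi_hilbert\<close> asks of its carrier type.\<close>

instantiation "fun" :: (type, real_vector) real_vector
begin
definition "scaleR_fun c f = (\<lambda>x. c *\<^sub>R f x)" for f :: "'a \<Rightarrow> 'b"
instance by standard (auto simp: scaleR_fun_def fun_eq_iff scaleR_add_right scaleR_add_left)
end

section \<open>Test functions\<close>

text \<open>\<open>psi 0\<close> is the classical smooth function that is flat at 0. The powers in
  the denominator are there because differentiating \<open>psi j\<close> gives a combination of
  \<open>psi (j + 1)\<close> and \<open>psi (j + 2)\<close>, so that the family is closed under
  derivatives.\<close>

definition psi :: "nat \<Rightarrow> real \<Rightarrow> real" where
  "psi j t = (if t > 0 then exp (- (1 / t)) / t ^ j else 0)"

text \<open>A single term of the exponential series at \<open>1 / t\<close> is kept. The index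
  \<open>Suc j\<close> instead of \<open>j\<close> leaves a spare factor \<open>t\<close>, which
  makes \<open>psi j\<close> tend to 0 at 0.\<close>

lemma psi_bound:
  assumes "t > 0"
  shows "psi j t \<le> fact (Suc j) * t"
proof -
  have "(1 / t) ^ Suc j / fact (Suc j) \<le> exp (1 / t)"
    using sum_le_suminf[OF summable_exp[of "1/t"], of "{Suc j}"] assms
    by (simp add: exp_def divide_inverse mult.commute)
  then have "1 \<le> exp (1 / t) * (fact (Suc j) * t ^ Suc j)"
    using assms by (simp add: power_divide pos_divide_le_eq mult.commute del: fact_Suc power_Suc)
  then have "1 / (exp (1 / t) * t ^ j) \<le> fact (Suc j) * t"
    using assms by (simp add: pos_divide_le_eq algebra_simps del: fact_Suc)
  then show ?thesis using assms by (simp add: psi_def exp_minus inverse_eq_divide)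
qed

lemma psi_tendsto_0: "(psi j \<longlongrightarrow> 0) (at 0)"
proof (rule Lim_null_comparison)
  show "\<forall>\<^sub>F t in at 0. norm (psi j t) \<le> fact (Suc j) * \<bar>t\<bar>"
  proof (intro always_eventually allI)
    fix t show "norm (psi j t) \<le> fact (Suc j) * \<bar>t\<bar>"
      using psi_bound[of t j] by (cases "t > 0") (auto simp: psi_def intro: mult_nonneg_nonpos)
  qed
  show "((\<lambda>t. fact (Suc j) * \<bar>t\<bar>) \<longlongrightarrow> 0) (at (0::real))"
    by (auto intro!: tendsto_eq_intros)
qed

lemma psi_has_derivative:
  "(psi j has_real_derivative psi (j + 2) t - real j * psi (j + 1) t) (at t)"
proof -
  consider "t > 0" | "t < 0" | "t = 0" by linarith
  then show ?thesis
  proof cases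
    case 1
    let ?E = "exp (- (1 / t))"
    have inv: "((\<lambda>t. - (1 / t)) has_real_derivative 1 / t\<^sup>2) (at t)"
      using 1 by (auto intro!: derivative_eq_intros simp: power2_eq_square)
    have pow: "((\<lambda>t. t ^ j) has_real_derivative real j * t ^ (j - 1)) (at t)"
      using DERIV_pow[of j t] by simp
    have "((\<lambda>t. exp (- (1 / t)) / t ^ j) has_real_derivative
        (?E * (1 / t\<^sup>2) * t ^ j - ?E * (real j * t ^ (j - 1))) / (t ^ j * t ^ j)) (at t)"
      using 1 by (intro DERIV_divide DERIV_fun_exp[OF inv] pow) simp
    moreover have "(?E * (1 / t\<^sup>2) * t ^ j - ?E * (real j * t ^ (j - 1))) / (t ^ j * t ^ j)
        = psi (j + 2) t - real j * psi (j + 1) t"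
      using 1 by (cases j) (simp_all add: psi_def field_simps power2_eq_square)
    ultimately have "((\<lambda>t. exp (- (1 / t)) / t ^ j) has_real_derivative psi (j + 2) t - real j * psi (j + 1) t) (at t)"
      by simp
    then show ?thesis
      by (rule has_field_derivative_transform_within_open[of _ _ _ "{0<..}"]) (use 1 in \<open>auto simp: psi_def\<close>)
  next
    case 2
    have "((\<lambda>t. 0) has_real_derivative psi (j + 2) t - real j * psi (j + 1) t) (at t)"
      using 2 by (simp add: psi_def)
    then show ?thesis
      by (rule has_field_derivative_transform_within_open[of _ _ _ "{..<0}"]) (use 2 in \<open>auto simp: psi_def\<close>)
  next
    case 3
    \<comment> \<open>The difference quotient of \<open>psi j\<close> at 0 is
      \<open>psi (j + 1)\<close>.\<close>
    have "(psi j has_real_derivative 0) (at 0)"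
      unfolding has_field_derivative_iff
    proof (rule Lim_transform_eventually[OF psi_tendsto_0[of "j+1"]])
      show "\<forall>\<^sub>F x in at 0. psi (j + 1) x = (psi j x - psi j 0) / (x - 0)"
        by (auto simp: psi_def intro!: always_eventually)
    qed
    then show ?thesis using 3 by (simp add: psi_def)
  qed
qed

text \<open>A syntactic class closed under directional derivatives: differentiability of every order
  then follows by one induction on the order.\<close>

inductive smooth :: "('a::euclidean_space \<Rightarrow> real) \<Rightarrow> bool" where
  const: "smooth (\<lambda>x. c)"
| inner: "smooth (\<lambda>x. x \<bullet> c)"
| add: "smooth f \<Longrightarrow> smooth g \<Longrightarrow> smooth (\<lambda>x. f x + g x)"
| mult: "smooth f \<Longrightarrow> smooth g \<Longrightarrow> smooth (\<lambda>x. f x * g x)"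
| exp: "smooth f \<Longrightarrow> smooth (\<lambda>x. exp (f x))"
| psi: "smooth f \<Longrightarrow> smooth (\<lambda>x. psi j (f x))"

lemma smooth_diff: "smooth f \<Longrightarrow> smooth g \<Longrightarrow> smooth (\<lambda>x. f x - g x)"
  using smooth.add[OF _ smooth.mult[OF smooth.const[of "-1"]], of f g] by simp

lemma smooth_prod: "finite S \<Longrightarrow> (\<And>i. i \<in> S \<Longrightarrow> smooth (f i)) \<Longrightarrow> smooth (\<lambda>x. \<Prod>i\<in>S. f i x)"
  by (induction S rule: finite_induct) (auto intro: smooth.intros)

lemma smooth_derivative:
  "smooth f \<Longrightarrow> \<exists>f'. (\<forall>x. (f has_derivative f' x) (at x)) \<and> (\<forall>v. smooth (\<lambda>x. f' x v))"
proof (induction rule: smooth.induct)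
  case (const c)
  show ?case by (intro exI[of _ "\<lambda>x v. 0"]) (auto intro: smooth.const)
next
  case (inner c)
  show ?case by (intro exI[of _ "\<lambda>x v. v \<bullet> c"]) (auto intro!: smooth.const derivative_eq_intros)
next
  case (add f g)
  then obtain f' g' where *: "\<And>x. (f has_derivative f' x) (at x)" "\<And>v. smooth (\<lambda>x. f' x v)"
    "\<And>x. (g has_derivative g' x) (at x)" "\<And>v. smooth (\<lambda>x. g' x v)" by blast
  show ?case by (intro exI[of _ "\<lambda>x v. f' x v + g' x v"]) (auto intro!: smooth.add * derivative_intros)
next
  case (mult f g)
  then obtain f' g' where *: "\<And>x. (f has_derivative f' x) (at x)" "\<And>v. smooth (\<lambda>x. f' x v)"
    "\<And>x. (g has_derivative g' x) (at x)" "\<And>v. smooth (\<lambda>x. g' x v)" by blast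
  show ?case
    by (intro exI[of _ "\<lambda>x v. f x * g' x v + f' x v * g x"])
      (auto intro!: smooth.add smooth.mult mult * derivative_intros)
next
  case (exp f)
  then obtain f' where *: "\<And>x. (f has_derivative f' x) (at x)" "\<And>v. smooth (\<lambda>x. f' x v)" by blast
  show ?case
    by (intro exI[of _ "\<lambda>x v. exp (f x) * f' x v"])
      (auto intro!: smooth.mult smooth.exp exp * derivative_eq_intros)
next
  case (psi f j)
  then obtain f' where *: "\<And>x. (f has_derivative f' x) (at x)" "\<And>v. smooth (\<lambda>x. f' x v)" by blast
  have "((\<lambda>x. psi j (f x)) has_derivative (\<lambda>v. (psi (j + 2) (f x) - real j * psi (j + 1) (f x)) * f' x v)) (at x)" for x
    using has_derivative_compose[OF *(1) psi_has_derivative[unfolded has_field_derivative_def]] .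
  then show ?case
    by (intro exI[of _ "\<lambda>x v. (psi (j + 2) (f x) - real j * psi (j + 1) (f x)) * f' x v"])
      (auto intro!: smooth.mult smooth_diff smooth.psi smooth.const psi *)
qed

lemma smooth_class_C: "smooth f \<Longrightarrow> class_C k f"
proof (induction k arbitrary: f)
  case 0
  then obtain f' where "\<And>x. (f has_derivative f' x) (at x)" using smooth_derivative[of f] by blast
  then have "isCont f x" for x by (rule has_derivative_continuous)
  then show ?case by (simp add: continuous_at_imp_continuous_on)
next
  case (Suc k)
  obtain f' where *: "\<And>x. (f has_derivative f' x) (at x)" "\<And>v. smooth (\<lambda>x. f' x v)"
    using smooth_derivative[OF Suc.prems] by blast
  have "frechet_derivative f (at x) = f' x" for x using frechet_derivative_at[OF *(1)] by simp
  then show ?case using * Suc.IH by (auto simp: differentiable_on_def differentiable_def)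
qed

section \<open>Derivatives and translates of functions of class \<open>C^k\<close>\<close>

lemma class_C_continuous: "class_C k f \<Longrightarrow> continuous_on UNIV f"
  by (cases k) (auto intro: differentiable_imp_continuous_on)

lemma class_C_has_derivative:
  "class_C (Suc k) f \<Longrightarrow> (f has_derivative frechet_derivative f (at x)) (at x)"
  by (auto simp: differentiable_on_def frechet_derivative_works)

lemma frechet_derivative_eq_sum:
  fixes f :: "'a::euclidean_space \<Rightarrow> real"
  assumes "(f has_derivative f') (at x)"
  shows "f' h = (\<Sum>b\<in>Basis. (h \<bullet> b) * f' b)"
proof -
  interpret linear f' using assms by (rule has_derivative_linear)
  have "f' h = f' (\<Sum>b\<in>Basis. (h \<bullet> b) *\<^sub>R b)" by (simp add: euclidean_representation)
  then show ?thesis by (simp add: sum scale)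
qed

lemma class_C_continuous_derivative:
  assumes "class_C (Suc k) f"
  shows "continuous_on UNIV (\<lambda>x. frechet_derivative f (at x) h)"
proof -
  have "continuous_on UNIV (\<lambda>x. frechet_derivative f (at x) b)" if "b \<in> Basis" for b
    using assms that by (auto intro: class_C_continuous)
  then have "continuous_on UNIV (\<lambda>x. \<Sum>b\<in>Basis. (h \<bullet> b) * frechet_derivative f (at x) b)"
    by (intro continuous_intros) auto
  then show ?thesis
    using frechet_derivative_eq_sum[OF class_C_has_derivative[OF assms], of _ h] by presburger
qed

lemma frechet_derivative_shift:
  fixes f :: "'a::euclidean_space \<Rightarrow> real"
  assumes "f differentiable_on UNIV"
  shows "frechet_derivative (\<lambda>x. f (x - v)) (at x) = frechet_derivative f (at (x - v))"
    and "(\<lambda>x. f (x - v)) differentiable at x"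
proof -
  have "(f has_derivative frechet_derivative f (at (x - v))) (at (x - v))"
    using assms by (auto simp: differentiable_on_def frechet_derivative_works)
  then have "((\<lambda>x. f (x - v)) has_derivative frechet_derivative f (at (x - v))) (at x)"
    by (rule has_derivative_compose[rotated]) (auto intro!: derivative_eq_intros)
  then show "frechet_derivative (\<lambda>x. f (x - v)) (at x) = frechet_derivative f (at (x - v))"
    "(\<lambda>x. f (x - v)) differentiable at x"
    by (auto simp: frechet_derivative_at[symmetric] differentiable_def)
qed

lemma class_C_shift: "class_C k f \<Longrightarrow> class_C k (\<lambda>x. f (x - v))"
proof (induction k arbitrary: f)
  case 0
  then show ?case
    by (auto intro!: continuous_on_compose2[of UNIV f UNIV "\<lambda>x. x - v"] continuous_intros)
next
  case (Suc k)
  then show ?case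
    by (auto simp: frechet_derivative_shift) (auto simp: differentiable_on_def intro: frechet_derivative_shift)
qed

section \<open>Cutoff functions of boxes\<close>

definition bump :: "'a::euclidean_space \<Rightarrow> 'a \<Rightarrow> 'a \<Rightarrow> real" where
  "bump a b x = (\<Prod>i\<in>Basis. psi 0 ((x - a) \<bullet> i) * psi 0 ((b - x) \<bullet> i))"

text \<open>\<open>bump\<close> is positive exactly inside the open box, so these smooth functions
  increase with \<open>m\<close> to the indicator of the box and stay between 0 and 1. Dominated
  convergence thus carries identities from test functions to indicators.\<close>

definition cutoff :: "'a::euclidean_space \<Rightarrow> 'a \<Rightarrow> nat \<Rightarrow> 'a \<Rightarrow> real" where
  "cutoff a b m x = 1 - exp (- real m * bump a b x)"

lemma smooth_cutoff: "smooth (cutoff a b m)"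
proof -
  have "smooth (bump a b)" unfolding bump_def inner_diff_left
    by (intro smooth_prod smooth.mult smooth.psi smooth_diff smooth.const smooth.inner) auto
  then show ?thesis unfolding cutoff_def
    by (intro smooth_diff smooth.const smooth.exp smooth.mult)
qed

lemma bump_nonneg: "0 \<le> bump a b x"
  by (auto simp: bump_def psi_def intro!: prod_nonneg)

lemma bump_pos_iff: "bump a b x \<noteq> 0 \<longleftrightarrow> x \<in> box a b"
  by (auto simp: bump_def psi_def mem_box inner_diff_left)

lemma cutoff_range: "0 \<le> cutoff a b m x" "cutoff a b m x \<le> 1"
  using bump_nonneg[of a b x] by (auto simp: cutoff_def)

lemma cutoff_eq_0: "x \<notin> box a b \<Longrightarrow> cutoff a b m x = 0"
  using bump_pos_iff[of a b x] by (simp add: cutoff_def)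

lemma cutoff_tendsto: "(\<lambda>m. cutoff a b m x) \<longlonglongrightarrow> indicator (box a b) x"
proof (cases "x \<in> box a b")
  case True
  then have pos: "bump a b x > 0" using bump_pos_iff[of a b x] bump_nonneg[of a b x] by simp
  have "(\<lambda>m. 1 - exp (- bump a b x) ^ m) \<longlonglongrightarrow> 1 - 0"
    using pos by (intro tendsto_intros LIMSEQ_realpow_zero) auto
  then show ?thesis using True by (simp add: cutoff_def exp_of_nat_mult[symmetric])
next
  case False
  then show ?thesis by (simp add: cutoff_eq_0)
qed

lemma test_function_cutoff:
  assumes "cbox a b \<subseteq> \<Omega>"
  shows "test_function \<Omega> (cutoff a b m)"
proof -
  have sub: "{x. cutoff a b m x \<noteq> 0} \<subseteq> cbox a b"
    using cutoff_eq_0 box_subset_cbox by blast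
  then have "closure {x. cutoff a b m x \<noteq> 0} \<subseteq> cbox a b" by (rule closure_minimal[OF _ closed_cbox])
  then show ?thesis using assms sub smooth_class_C[OF smooth_cutoff]
    by (auto simp: test_function_def intro: bounded_subset[OF bounded_cbox])
qed

lemma test_function_shift:
  assumes \<phi>: "test_function U \<phi>" and U: "\<And>x. x \<in> U \<Longrightarrow> v + x \<in> \<Omega>"
  shows "test_function \<Omega> (\<lambda>x. \<phi> (x - v))"
proof -
  let ?S = "{x. \<phi> x \<noteq> 0}"
  have eq: "{x. \<phi> (x - v) \<noteq> 0} = (+) v ` ?S"
    by (auto simp: image_iff) (metis add.commute diff_add_cancel)
  have "compact ((+) v ` closure ?S)" "(+) v ` closure ?S \<subseteq> \<Omega>"
    using \<phi> U by (auto simp: test_function_def simp del: compact_closure intro!: compact_translation)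
  then show ?thesis using \<phi> unfolding test_function_def eq closure_translation
    by (blast intro: class_C_shift)
qed

section \<open>Translation invariance of Lebesgue integrals\<close>

lemma borel_measurable_shift [measurable]:
  "f \<in> borel_measurable borel \<Longrightarrow> (\<lambda>x. f (x + c)) \<in> borel_measurable borel" for c :: "'a::euclidean_space"
  using measurable_compose[of "\<lambda>x. x + c" borel borel f borel] by simp

lemma lborel_distr_shift: "distr lborel borel (\<lambda>x. x + c) = lborel" for c :: "'a::euclidean_space"
  using lborel_distr_plus[of c] by (simp add: add.commute[of c] cong: distr_cong)

lemma nn_integral_lborel_shift:
  fixes f :: "'a::euclidean_space \<Rightarrow> ennreal"
  assumes [measurable]: "f \<in> borel_measurable borel"
  shows "(\<integral>\<^sup>+x. f (x + c) \<partial>lborel) = (\<integral>\<^sup>+x. f x \<partial>lborel)"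
proof -
  have "(\<integral>\<^sup>+x. f x \<partial>lborel) = (\<integral>\<^sup>+x. f x \<partial>distr lborel borel (\<lambda>x. x + c))"
    by (simp add: lborel_distr_shift)
  also have "\<dots> = (\<integral>\<^sup>+x. f (x + c) \<partial>lborel)" by (rule nn_integral_distr) auto
  finally show ?thesis by simp
qed

lemma integral_lborel_shift:
  fixes f :: "'a::euclidean_space \<Rightarrow> real"
  assumes [measurable]: "f \<in> borel_measurable borel"
  shows "(LINT x|lborel. f (x + c)) = (LINT x|lborel. f x)"
proof -
  have "(LINT x|lborel. f x) = (LINT x|distr lborel borel (\<lambda>x. x + c). f x)"
    by (simp add: lborel_distr_shift)
  also have "\<dots> = (LINT x|lborel. f (x + c))" by (rule integral_distr) auto
  finally show ?thesis by simp
qed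

lemma integrable_lborel_shift:
  fixes f :: "'a::euclidean_space \<Rightarrow> real"
  assumes f: "integrable lborel f"
  shows "integrable lborel (\<lambda>x. f (x + c))"
proof -
  have "integrable (distr lborel borel (\<lambda>x. x + c)) f" using f by (simp add: lborel_distr_shift)
  then show ?thesis by (rule integrable_distr[rotated]) auto
qed

text \<open>The positive and the negative part of \<open>F\<close> on the box are densities of two
  measures that agree on all open boxes. Open boxes generate the Borel sets and are stable under
  intersection, so the measures are equal.\<close>

lemma AE_zero_on_box:
  fixes F :: "'a::euclidean_space \<Rightarrow> real"
  assumes F: "integrable lborel F"
    and zero: "\<And>c d. cbox c d \<subseteq> cbox a b \<Longrightarrow> (LINT x|lborel. indicator (box c d) x * F x) = 0"
  shows "AE x in lborel. x \<in> box a b \<longrightarrow> F x = 0"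
proof -
  have [measurable]: "F \<in> borel_measurable borel" using F by auto
  define P where "P x = ennreal (indicator (box a b) x * F x)" for x
  define Q where "Q x = ennreal (indicator (box a b) x * - F x)" for x
  have [measurable]: "P \<in> borel_measurable borel" "Q \<in> borel_measurable borel" by (auto simp: P_def[abs_def] Q_def[abs_def])
  have intB: "integrable lborel (\<lambda>x. indicator A x * F x)" if "A \<in> sets borel" for A
    using integrable_mult_indicator[of A lborel F] F that by simp
  have eqbox: "emeasure (density lborel P) (box c d) = emeasure (density lborel Q) (box c d)" for c d
  proof -
    \<comment> \<open>An intersection of open boxes is an open box, but \<open>zero\<close> speaks
      of boxes whose closed version lies in \<open>cbox a b\<close>. For a nonempty intersection
      this holds by taking closures; for an empty one an empty closed box is supplied.\<close>
    obtain e f where ef: "box c d \<inter> box a b = box e f" "cbox e f \<subseteq> cbox a b"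
    proof (cases "box c d \<inter> box a b = {}")
      case True
      show ?thesis
      proof (rule that)
        obtain i :: 'a where "i \<in> Basis" using nonempty_Basis by blast
        then have "cbox One (0::'a) = {}" by (subst box_eq_empty(2)) (auto intro!: bexI[of _ i])
        then show "box c d \<inter> box a b = box One (0::'a)" "cbox One (0::'a) \<subseteq> cbox a b"
          using True box_subset_cbox[of One "0::'a"] by auto
      qed
    next
      case False
      obtain e f where ef: "box c d \<inter> box a b = box e f" unfolding box_Int_box by blast
      have "cbox e f = closure (box e f)" using False ef by (simp add: closure_box)
      also have "\<dots> \<subseteq> cbox a b"
        unfolding ef[symmetric] using box_subset_cbox[of a b] by (intro closure_minimal closed_cbox) blast
      finally show ?thesis using that ef by blast
    qed
    let ?B = "box e f"
    have PQ: "(\<integral>\<^sup>+x. indicator (box c d) x * P x \<partial>lborel) = (\<integral>\<^sup>+x. ennreal (indicator ?B x * F x) \<partial>lborel)"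
      "(\<integral>\<^sup>+x. indicator (box c d) x * Q x \<partial>lborel) = (\<integral>\<^sup>+x. ennreal (- (indicator ?B x * F x)) \<partial>lborel)"
      unfolding ef(1)[symmetric] by (auto intro!: nn_integral_cong simp: P_def Q_def indicator_def)
    have fin: "(\<integral>\<^sup>+x. ennreal (indicator ?B x * F x) \<partial>lborel) < \<infinity>" "(\<integral>\<^sup>+x. ennreal (- (indicator ?B x * F x)) \<partial>lborel) < \<infinity>"
      using intB[of ?B] by (auto simp: real_integrable_def less_top)
    have "enn2real (\<integral>\<^sup>+x. ennreal (indicator ?B x * F x) \<partial>lborel) - enn2real (\<integral>\<^sup>+x. ennreal (- (indicator ?B x * F x)) \<partial>lborel) = 0"
      using real_lebesgue_integral_def[OF intB[of ?B]] zero[OF ef(2)] by simp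
    then have "(\<integral>\<^sup>+x. ennreal (indicator ?B x * F x) \<partial>lborel) = (\<integral>\<^sup>+x. ennreal (- (indicator ?B x * F x)) \<partial>lborel)"
      using fin by (metis ennreal_enn2real eq_iff_diff_eq_0 infinity_ennreal_def)
    then show ?thesis using PQ by (simp add: emeasure_density mult.commute)
  qed
  have PQ0: "F x > 0 \<Longrightarrow> Q x = 0" "F x < 0 \<Longrightarrow> P x = 0" for x
    unfolding P_def Q_def by (cases "x \<in> box a b"; simp add: ennreal_neg)+
  have PQ: "density lborel P = density lborel Q"
  proof (rule measure_eqI_generator_eq)
    let ?E = "range (\<lambda>(a, b). box a b::'a set)"
    show "Int_stable ?E" by (auto simp: Int_stable_def box_Int_box)
    show "?E \<subseteq> Pow UNIV" "sets (density lborel P) = sigma_sets UNIV ?E" "sets (density lborel Q) = sigma_sets UNIV ?E"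
      by (simp_all add: borel_eq_box)
    let ?A = "\<lambda>n::nat. box (- (real n *\<^sub>R One)) (real n *\<^sub>R One) :: 'a set"
    show "range ?A \<subseteq> ?E" "(\<Union>i. ?A i) = UNIV"
      unfolding UN_box_eq_UNIV by auto
    show "emeasure (density lborel P) (?A i) \<noteq> \<infinity>" for i
    proof -
      have "emeasure (density lborel P) (?A i) \<le> (\<integral>\<^sup>+x. ennreal (norm (F x)) \<partial>lborel)"
        by (auto simp: emeasure_density P_def indicator_def intro!: nn_integral_mono ennreal_leI)
      also have "\<dots> < \<infinity>" using F by (simp add: integrable_iff_bounded)
      finally show ?thesis by simp
    qed
    show "emeasure (density lborel P) X = emeasure (density lborel Q) X" if "X \<in> ?E" for X
      using that eqbox by auto
  qed
  \<comment> \<open>Used for the sets where \<open>F\<close> is positive and where it is negative: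
    on each of them one density vanishes, so the other one does almost everywhere.\<close>
  have eqA: "(\<integral>\<^sup>+x. P x * indicator A x \<partial>lborel) = (\<integral>\<^sup>+x. Q x * indicator A x \<partial>lborel)" if [measurable]: "A \<in> sets borel" for A
    using arg_cong[OF PQ, of "\<lambda>M. emeasure M A"] by (simp add: emeasure_density)
  have "(\<integral>\<^sup>+x. P x * indicator {x. F x > 0} x \<partial>lborel) = (\<integral>\<^sup>+x. Q x * indicator {x. F x > 0} x \<partial>lborel)"
    by (rule eqA) measurable
  also have "\<dots> = (\<integral>\<^sup>+(x::'a). 0 \<partial>lborel)"
    by (intro nn_integral_cong) (use PQ0 in \<open>simp split: split_indicator\<close>)
  finally have 1: "AE x in lborel. P x * indicator {x. F x > 0} x = 0"
    by (subst nn_integral_0_iff_AE[symmetric]) simp_all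
  have "(\<integral>\<^sup>+x. Q x * indicator {x. F x < 0} x \<partial>lborel) = (\<integral>\<^sup>+x. P x * indicator {x. F x < 0} x \<partial>lborel)"
    by (rule eqA[symmetric]) measurable
  also have "\<dots> = (\<integral>\<^sup>+(x::'a). 0 \<partial>lborel)"
    by (intro nn_integral_cong) (use PQ0 in \<open>simp split: split_indicator\<close>)
  finally have 2: "AE x in lborel. Q x * indicator {x. F x < 0} x = 0"
    by (subst nn_integral_0_iff_AE[symmetric]) simp_all
  from 1 2 show ?thesis
    by eventually_elim (auto simp: P_def Q_def indicator_def ennreal_eq_0_iff split: if_splits)
qed

text \<open>The fundamental lemma of the calculus of variations, with indicators of boxes in the
  role of test functions. Countably many closed boxes cover \<open>U\<close>, and their faces are
  null sets.\<close>

lemma AE_zero_on_open: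
  fixes F :: "'a::euclidean_space \<Rightarrow> real"
  assumes F: "integrable lborel F" and U: "open U"
    and zero: "\<And>a b. cbox a b \<subseteq> U \<Longrightarrow> (LINT x|lborel. indicator (box a b) x * F x) = 0"
  shows "AE x in lborel. x \<in> U \<longrightarrow> F x = 0"
proof -
  obtain D where D: "countable D" "\<And>X. X \<in> D \<Longrightarrow> X \<subseteq> U" "\<And>X. X \<in> D \<Longrightarrow> \<exists>a b. X = cbox a b" "\<Union>D = U"
    using open_countable_Union_open_cbox[OF U] by (metis Pow_iff subsetD)
  have "AE x in lborel. x \<in> X \<longrightarrow> F x = 0" if "X \<in> D" for X
  proof -
    obtain a b where X: "X = cbox a b" using D(3)[OF \<open>X \<in> D\<close>] by blast
    have "emeasure lborel (cbox a b - box a b) = 0"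
      by (subst emeasure_Diff) (auto simp: emeasure_lborel_cbox_eq emeasure_lborel_box_eq box_subset_cbox)
    then have "AE x in lborel. x \<notin> cbox a b - box a b" by (intro AE_not_in) (auto simp: null_sets_def)
    moreover have "AE x in lborel. x \<in> box a b \<longrightarrow> F x = 0"
      using D(2)[OF that] X by (intro AE_zero_on_box F zero) auto
    ultimately show ?thesis unfolding X by eventually_elim auto
  qed
  then have "AE x in lborel. \<forall>X\<in>D. x \<in> X \<longrightarrow> F x = 0"
    using AE_ball_countable[OF D(1), of "\<lambda>x X. x \<in> X \<longrightarrow> F x = 0" lborel] by blast
  then show ?thesis by eventually_elim (use D(4) in auto)
qed

section \<open>Square integrable functions\<close>

lemma integrable_dominated:
  fixes f :: "'a \<Rightarrow> 'b::{banach, second_countable_topology}" and g :: "'a \<Rightarrow> real"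
  assumes "integrable M g" "f \<in> borel_measurable M" "\<And>x. x \<in> space M \<Longrightarrow> norm (f x) \<le> g x"
  shows "integrable M f"
  by (rule Bochner_Integration.integrable_bound[OF assms(1,2)])
    (use assms(3) in \<open>auto intro!: AE_I2 intro: order_trans[OF _ abs_ge_self]\<close>)

lemma in_L2_add:
  assumes "in_L2 \<Omega> f" "in_L2 \<Omega> g"
  shows "in_L2 \<Omega> (\<lambda>x. f x + g x)"
proof -
  have [measurable]: "f \<in> borel_measurable (lebesgue_on \<Omega>)" "g \<in> borel_measurable (lebesgue_on \<Omega>)"
    using assms by (auto simp: in_L2_def)
  have bnd: "integrable (lebesgue_on \<Omega>) (\<lambda>x. 2 * (norm (f x))\<^sup>2 + 2 * (norm (g x))\<^sup>2)"
    using assms unfolding in_L2_def by (intro Bochner_Integration.integrable_add integrable_mult_right) auto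
  have "integrable (lebesgue_on \<Omega>) (\<lambda>x. (norm (f x + g x))\<^sup>2)"
  proof (rule integrable_dominated[where g = "\<lambda>x. 2 * (norm (f x))\<^sup>2 + 2 * (norm (g x))\<^sup>2"])
    have "(norm (f x + g x))\<^sup>2 \<le> 2 * (norm (f x))\<^sup>2 + 2 * (norm (g x))\<^sup>2" for x
    proof -
      have "(norm (f x + g x))\<^sup>2 \<le> (norm (f x) + norm (g x))\<^sup>2" by (simp add: norm_triangle_ineq power_mono)
      moreover have "0 \<le> (norm (f x) - norm (g x))\<^sup>2" by simp
      ultimately show ?thesis unfolding power2_sum power2_diff by linarith
    qed
    then show "norm ((norm (f x + g x))\<^sup>2) \<le> 2 * (norm (f x))\<^sup>2 + 2 * (norm (g x))\<^sup>2" for x by simp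
  qed (intro bnd, measurable)
  then show ?thesis by (simp add: in_L2_def)
qed

lemma in_L2_scaleR: "in_L2 \<Omega> f \<Longrightarrow> in_L2 \<Omega> (\<lambda>x. c *\<^sub>R f x)"
  unfolding in_L2_def norm_scaleR power_mult_distrib
  by (intro conjI integrable_mult_right borel_measurable_scaleR borel_measurable_const) blast+

lemma in_L2_diff: "in_L2 \<Omega> f \<Longrightarrow> in_L2 \<Omega> g \<Longrightarrow> in_L2 \<Omega> (\<lambda>x. f x - g x)"
  using in_L2_add[of \<Omega> f "\<lambda>x. (-1) *\<^sub>R g x"] in_L2_scaleR[of \<Omega> g "-1"] by simp

lemma in_L2_inner_integrable:
  assumes "in_L2 \<Omega> f" "in_L2 \<Omega> g"
  shows "integrable (lebesgue_on \<Omega>) (\<lambda>x. f x \<bullet> g x)"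
proof -
  have [measurable]: "f \<in> borel_measurable (lebesgue_on \<Omega>)" "g \<in> borel_measurable (lebesgue_on \<Omega>)"
    using assms by (auto simp: in_L2_def)
  show ?thesis
  proof (rule integrable_dominated[where g = "\<lambda>x. (norm (f x))\<^sup>2 + (norm (g x))\<^sup>2"])
    have "\<bar>f x \<bullet> g x\<bar> \<le> (norm (f x))\<^sup>2 + (norm (g x))\<^sup>2" for x
    proof -
      have "0 \<le> (norm (f x) - norm (g x))\<^sup>2" by simp
      then have "2 * (norm (f x) * norm (g x)) \<le> (norm (f x))\<^sup>2 + (norm (g x))\<^sup>2" unfolding power2_diff by linarith
      moreover have "0 \<le> norm (f x) * norm (g x)" by simp
      ultimately show ?thesis using Cauchy_Schwarz_ineq2[of "f x" "g x"] by linarith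
    qed
    then show "norm (f x \<bullet> g x) \<le> (norm (f x))\<^sup>2 + (norm (g x))\<^sup>2" for x by simp
  qed (use assms in \<open>auto simp: in_L2_def\<close>)
qed

lemma in_L2_mult_integrable:
  fixes f g :: "'a::euclidean_space \<Rightarrow> real"
  shows "in_L2 \<Omega> f \<Longrightarrow> in_L2 \<Omega> g \<Longrightarrow> integrable (lebesgue_on \<Omega>) (\<lambda>x. f x * g x)"
  using in_L2_inner_integrable[of \<Omega> f g] by simp

lemma in_L2_component:
  assumes "in_L2 \<Omega> f"
  shows "in_L2 \<Omega> (\<lambda>x. f x \<bullet> b)"
proof -
  have [measurable]: "f \<in> borel_measurable (lebesgue_on \<Omega>)" using assms by (auto simp: in_L2_def)
  have bnd: "integrable (lebesgue_on \<Omega>) (\<lambda>x. (norm b)\<^sup>2 * (norm (f x))\<^sup>2)"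
    using assms unfolding in_L2_def by (intro Bochner_Integration.integrable_add integrable_mult_right) auto
  have "integrable (lebesgue_on \<Omega>) (\<lambda>x. (norm (f x \<bullet> b))\<^sup>2)"
  proof (rule integrable_dominated[where g = "\<lambda>x. (norm b)\<^sup>2 * (norm (f x))\<^sup>2"])
    have "(norm (f x \<bullet> b))\<^sup>2 \<le> (norm b)\<^sup>2 * (norm (f x))\<^sup>2" for x
      using power_mono[OF Cauchy_Schwarz_ineq2[of "f x" b], of 2] by (simp add: power_mult_distrib mult.commute)
    then show "norm ((norm (f x \<bullet> b))\<^sup>2) \<le> (norm b)\<^sup>2 * (norm (f x))\<^sup>2" for x by simp
  qed (intro bnd, measurable)
  then show ?thesis by (simp add: in_L2_def)
qed

lemma in_L2_bounded:
  fixes f :: "'a::euclidean_space \<Rightarrow> 'b::euclidean_space"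
  assumes "\<Omega> \<in> lmeasurable" "f \<in> borel_measurable (lebesgue_on \<Omega>)" "\<And>x. x \<in> \<Omega> \<Longrightarrow> norm (f x) \<le> C"
  shows "in_L2 \<Omega> f"
proof -
  interpret finite_measure "lebesgue_on \<Omega>" using assms(1) by (rule finite_measure_lebesgue_on)
  note [measurable] = assms(2)
  have "integrable (lebesgue_on \<Omega>) (\<lambda>x. (norm (f x))\<^sup>2)"
    by (rule integrable_const_bound[where B = "C\<^sup>2"])
      (use assms(3) in \<open>auto intro!: AE_I2 power_mono simp: space_lebesgue_on\<close>)
  then show ?thesis using assms by (simp add: in_L2_def)
qed

lemma in_L2_mult_bounded:
  fixes f :: "'a::euclidean_space \<Rightarrow> 'b::euclidean_space"
  assumes "in_L2 \<Omega> f" "q \<in> borel_measurable (lebesgue_on \<Omega>)" "\<And>x. x \<in> \<Omega> \<Longrightarrow> \<bar>q x\<bar> \<le> C"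
  shows "in_L2 \<Omega> (\<lambda>x. q x *\<^sub>R f x)"
proof -
  have [measurable]: "f \<in> borel_measurable (lebesgue_on \<Omega>)" using assms by (auto simp: in_L2_def)
  note [measurable] = assms(2)
  have bnd: "integrable (lebesgue_on \<Omega>) (\<lambda>x. C\<^sup>2 * (norm (f x))\<^sup>2)"
    using assms unfolding in_L2_def by (intro Bochner_Integration.integrable_add integrable_mult_right) auto
  have "integrable (lebesgue_on \<Omega>) (\<lambda>x. (norm (q x *\<^sub>R f x))\<^sup>2)"
  proof (rule integrable_dominated[where g = "\<lambda>x. C\<^sup>2 * (norm (f x))\<^sup>2"])
    have "\<bar>q x\<bar>\<^sup>2 \<le> C\<^sup>2" if "x \<in> \<Omega>" for x using assms(3)[OF that] by (intro power_mono) auto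
    then show "norm ((norm (q x *\<^sub>R f x))\<^sup>2) \<le> C\<^sup>2 * (norm (f x))\<^sup>2" if "x \<in> space (lebesgue_on \<Omega>)" for x
      using that by (auto simp: power_mult_distrib intro!: mult_right_mono)
  qed (intro bnd, measurable)
  then show ?thesis by (simp add: in_L2_def)
qed

lemma L2_Cauchy_Schwarz:
  assumes "in_L2 \<Omega> f" "in_L2 \<Omega> g"
  shows "(LINT x|lebesgue_on \<Omega>. f x \<bullet> g x)\<^sup>2
    \<le> (LINT x|lebesgue_on \<Omega>. (norm (f x))\<^sup>2) * (LINT x|lebesgue_on \<Omega>. (norm (g x))\<^sup>2)"
proof (rule quadratic_nonneg_imp)
  fix t
  have i: "integrable (lebesgue_on \<Omega>) (\<lambda>x. (norm (f x))\<^sup>2)" "integrable (lebesgue_on \<Omega>) (\<lambda>x. (norm (g x))\<^sup>2)"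
    "integrable (lebesgue_on \<Omega>) (\<lambda>x. f x \<bullet> g x)"
    using assms in_L2_inner_integrable by (auto simp: in_L2_def)
  have "0 \<le> (LINT x|lebesgue_on \<Omega>. (norm (f x + t *\<^sub>R g x))\<^sup>2)" by (intro integral_nonneg_AE) auto
  also have "\<dots> = (LINT x|lebesgue_on \<Omega>. (norm (f x))\<^sup>2 + (2 * t) * (f x \<bullet> g x) + t\<^sup>2 * (norm (g x))\<^sup>2)"
    by (intro Bochner_Integration.integral_cong refl,
        simp only: power2_norm_eq_inner inner_add_left inner_add_right inner_scaleR_left inner_scaleR_right)
      (simp add: inner_commute[of "g _" "f _"] power2_eq_square algebra_simps)
  also have "\<dots> = (LINT x|lebesgue_on \<Omega>. (norm (f x))\<^sup>2) + 2 * t * (LINT x|lebesgue_on \<Omega>. f x \<bullet> g x)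
     + t\<^sup>2 * (LINT x|lebesgue_on \<Omega>. (norm (g x))\<^sup>2)"
    using i by simp
  finally show "0 \<le> (LINT x|lebesgue_on \<Omega>. (norm (f x))\<^sup>2) + 2 * t * (LINT x|lebesgue_on \<Omega>. f x \<bullet> g x)
     + t\<^sup>2 * (LINT x|lebesgue_on \<Omega>. (norm (g x))\<^sup>2)" .
qed

lemma L2_inner_tendsto:
  assumes X: "\<And>n. in_L2 \<Omega> (X n)" and f: "in_L2 \<Omega> f" and g: "in_L2 \<Omega> g"
    and lim: "(\<lambda>n. LINT x|lebesgue_on \<Omega>. (norm (X n x - f x))\<^sup>2) \<longlonglongrightarrow> 0"
  shows "(\<lambda>n. LINT x|lebesgue_on \<Omega>. X n x \<bullet> g x) \<longlonglongrightarrow> (LINT x|lebesgue_on \<Omega>. f x \<bullet> g x)"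
proof -
  let ?G = "LINT x|lebesgue_on \<Omega>. (norm (g x))\<^sup>2"
  have "(\<lambda>n. LINT x|lebesgue_on \<Omega>. (X n x - f x) \<bullet> g x) \<longlonglongrightarrow> 0"
  proof (rule Lim_null_comparison)
    show "(\<lambda>n. sqrt ((LINT x|lebesgue_on \<Omega>. (norm (X n x - f x))\<^sup>2) * ?G)) \<longlonglongrightarrow> 0"
      using tendsto_real_sqrt[OF tendsto_mult_right[OF lim, of ?G]] by simp
    show "\<forall>\<^sub>F n in sequentially. norm (LINT x|lebesgue_on \<Omega>. (X n x - f x) \<bullet> g x)
        \<le> sqrt ((LINT x|lebesgue_on \<Omega>. (norm (X n x - f x))\<^sup>2) * ?G)"
      using real_sqrt_le_mono[OF L2_Cauchy_Schwarz[OF in_L2_diff[OF X f] g]] by simp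
  qed
  moreover have "(LINT x|lebesgue_on \<Omega>. (X n x - f x) \<bullet> g x)
      = (LINT x|lebesgue_on \<Omega>. X n x \<bullet> g x) - (LINT x|lebesgue_on \<Omega>. f x \<bullet> g x)" for n
    using in_L2_inner_integrable[OF X g, of n] in_L2_inner_integrable[OF f g] by (simp add: inner_diff_left)
  ultimately show ?thesis by (simp add: LIM_zero_iff)
qed

text \<open>Riesz-Fischer. A rapidly Cauchy subsequence converges almost everywhere, and Fatou's
  lemma carries the Cauchy bounds of the full sequence over to the pointwise limit.\<close>

lemma L2_complete:
  fixes X :: "nat \<Rightarrow> 'a::euclidean_space \<Rightarrow> 'b::euclidean_space"
  assumes X: "\<And>n. in_L2 \<Omega> (X n)"
    and cauchy: "\<And>e. e > 0 \<Longrightarrow> \<exists>M. \<forall>m\<ge>M. \<forall>n\<ge>M. (LINT x|lebesgue_on \<Omega>. (norm (X m x - X n x))\<^sup>2) < e"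
  shows "\<exists>f. in_L2 \<Omega> f \<and> (\<lambda>n. LINT x|lebesgue_on \<Omega>. (norm (X n x - f x))\<^sup>2) \<longlonglongrightarrow> 0"
proof -
  let ?M = "lebesgue_on \<Omega>"
  have [measurable]: "X n \<in> borel_measurable ?M" for n using X by (auto simp: in_L2_def)
  have int: "integrable ?M (\<lambda>x. (norm (X m x - X n x))\<^sup>2)" for m n
    using in_L2_diff[OF X X] by (auto simp: in_L2_def)
  have nn: "(\<integral>\<^sup>+x. ennreal ((norm (X m x - X n x))\<^sup>2) \<partial>?M) = ennreal (LINT x|?M. (norm (X m x - X n x))\<^sup>2)" for m n
    using int by (intro nn_integral_eq_integral) auto
  have "\<exists>K. \<forall>m\<ge>K. \<forall>n\<ge>K. (LINT x|?M. (norm (X m x - X n x))\<^sup>2) < (1/4) ^ k" for k :: nat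
    by (intro cauchy) simp
  then obtain K where K: "\<And>k m n. m \<ge> K k \<Longrightarrow> n \<ge> K k \<Longrightarrow> (LINT x|?M. (norm (X m x - X n x))\<^sup>2) < (1/4) ^ k"
    by metis
  \<comment> \<open>Summing the thresholds makes \<open>r\<close> monotone and keeps
    \<open>r k\<close> above \<open>K k\<close>; the extra \<open>k\<close> gives
    \<open>N \<le> r (k + N)\<close>, which the application of Fatou's lemma relies on.\<close>
  define r where "r k = k + (\<Sum>j\<le>k. K j)" for k
  have "K k \<le> (\<Sum>j\<le>k. K j)" for k by (intro member_le_sum) auto
  then have Kr: "K k \<le> r k" for k by (simp add: r_def trans_le_add2)
  moreover have "r k \<le> r (Suc k)" for k by (simp add: r_def)
  ultimately have r_ge: "K k \<le> r k" "K k \<le> r (Suc k)" for k using order_trans by blast+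
  \<comment> \<open>The integrals of \<open>d k\<close> decay like \<open>(1/4) ^ k\<close>, so the
    weight \<open>2 ^ k\<close> still leaves a convergent series. Its pointwise finiteness forces
    \<open>d k x \<le> (1/2) ^ k\<close> eventually, and the increments are dominated by a geometric
    series.\<close>
  define d where "d k x = (norm (X (r (Suc k)) x - X (r k) x))\<^sup>2" for k x
  have [measurable]: "d k \<in> borel_measurable ?M" for k by (simp add: d_def[abs_def])
  have "(\<integral>\<^sup>+x. (\<Sum>k. ennreal (2 ^ k * d k x)) \<partial>?M) = (\<Sum>k. \<integral>\<^sup>+x. ennreal (2 ^ k * d k x) \<partial>?M)"
    by (intro nn_integral_suminf) auto
  also have "\<dots> \<le> (\<Sum>k. ennreal ((1/2) ^ k))"
  proof (intro suminf_le allI)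
    fix k
    have "(\<integral>\<^sup>+x. ennreal (2 ^ k * d k x) \<partial>?M) = ennreal (2 ^ k) * (\<integral>\<^sup>+x. ennreal (d k x) \<partial>?M)"
      by (subst nn_integral_cmult[symmetric]) (auto simp: ennreal_mult d_def)
    also have "\<dots> \<le> ennreal (2 ^ k) * ennreal ((1/4) ^ k)"
      unfolding d_def nn using K[OF r_ge(2) r_ge(1), of k] by (intro mult_left_mono ennreal_leI) auto
    also have "\<dots> = ennreal ((1/2) ^ k)"
      by (simp add: ennreal_mult[symmetric] power_mult_distrib[symmetric])
    finally show "(\<integral>\<^sup>+x. ennreal (2 ^ k * d k x) \<partial>?M) \<le> ennreal ((1/2) ^ k)" .
  qed auto
  also have "\<dots> = ennreal (\<Sum>k. (1/2) ^ k)"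
    by (intro suminf_ennreal2) (auto intro: summable_geometric)
  finally have "(\<integral>\<^sup>+x. (\<Sum>k. ennreal (2 ^ k * d k x)) \<partial>?M) \<noteq> \<infinity>" by (auto simp: top_unique)
  then have "AE x in ?M. (\<Sum>k. ennreal (2 ^ k * d k x)) \<noteq> \<infinity>"
    by (intro nn_integral_noteq_infinite) auto
  then have conv: "AE x in ?M. convergent (\<lambda>k. X (r k) x)"
  proof eventually_elim
    case (elim x)
    then have "summable (\<lambda>k. 2 ^ k * d k x)"
      by (intro summable_suminf_not_top) (auto simp: d_def)
    then have "(\<lambda>k. 2 ^ k * d k x) \<longlonglongrightarrow> 0" by (rule summable_LIMSEQ_zero)
    then have ev: "\<forall>\<^sub>F k in sequentially. 2 ^ k * d k x < 1" by (rule order_tendstoD) simp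
    have "summable (\<lambda>k. X (r (Suc k)) x - X (r k) x)"
    proof (rule summable_comparison_test_ev)
      show "\<forall>\<^sub>F k in sequentially. norm (X (r (Suc k)) x - X (r k) x) \<le> (sqrt (1/2)) ^ k"
        using ev
      proof eventually_elim
        case (elim k)
        then have "d k x \<le> (1/2) ^ k" by (simp add: field_simps power_divide)
        then have "sqrt (d k x) \<le> sqrt ((1/2) ^ k)" by (rule real_sqrt_le_mono)
        then show ?case unfolding real_sqrt_power by (simp add: d_def)
      qed
      have "sqrt (1/2) < sqrt 1" by (rule real_sqrt_less_mono) simp
      then show "summable (\<lambda>k. (sqrt (1/2)) ^ k)" by (intro summable_geometric) simp
    qed
    then have "(\<lambda>n. \<Sum>k<n. X (r (Suc k)) x - X (r k) x) \<longlonglongrightarrow> (\<Sum>k. X (r (Suc k)) x - X (r k) x)"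
      by (rule summable_LIMSEQ)
    then have "(\<lambda>n. (X (r n) x - X (r 0) x) + X (r 0) x) \<longlonglongrightarrow> (\<Sum>k. X (r (Suc k)) x - X (r k) x) + X (r 0) x"
      by (intro tendsto_add tendsto_const) (simp add: sum_lessThan_telescope[of "\<lambda>k. X (r k) x"])
    then show ?case by (auto simp: convergent_def)
  qed
  define f where "f x = lim (\<lambda>k. X (r k) x)" for x
  have [measurable]: "f \<in> borel_measurable ?M" unfolding f_def[abs_def] by (rule borel_measurable_lim_metric) auto
  have fatou: "(\<integral>\<^sup>+x. ennreal ((norm (X n x - f x))\<^sup>2) \<partial>?M) \<le> ennreal e"
    if "e > 0" and n: "\<And>m. m \<ge> N \<Longrightarrow> (LINT x|?M. (norm (X n x - X m x))\<^sup>2) < e" for e n N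
  proof -
    have "(\<integral>\<^sup>+x. ennreal ((norm (X n x - f x))\<^sup>2) \<partial>?M)
       = (\<integral>\<^sup>+x. liminf (\<lambda>k. ennreal ((norm (X n x - X (r (k + N)) x))\<^sup>2)) \<partial>?M)"
    proof (rule nn_integral_cong_AE)
      show "AE x in ?M. ennreal ((norm (X n x - f x))\<^sup>2) = liminf (\<lambda>k. ennreal ((norm (X n x - X (r (k + N)) x))\<^sup>2))"
        using conv
      proof eventually_elim
        case (elim x)
        then have "(\<lambda>k. X (r k) x) \<longlonglongrightarrow> f x" by (simp add: f_def convergent_LIMSEQ_iff)
        then have "(\<lambda>k. X (r (k + N)) x) \<longlonglongrightarrow> f x" by (rule LIMSEQ_ignore_initial_segment)
        then have "(\<lambda>k. ennreal ((norm (X n x - X (r (k + N)) x))\<^sup>2)) \<longlonglongrightarrow> ennreal ((norm (X n x - f x))\<^sup>2)"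
          by (intro tendsto_ennrealI tendsto_intros)
        then show ?case by (rule lim_imp_Liminf[OF trivial_limit_sequentially, symmetric])
      qed
    qed
    also have "\<dots> \<le> liminf (\<lambda>k. \<integral>\<^sup>+x. ennreal ((norm (X n x - X (r (k + N)) x))\<^sup>2) \<partial>?M)"
      by (intro nn_integral_liminf) auto
    also have "\<dots> \<le> liminf (\<lambda>k. ennreal e)"
    proof (intro Liminf_mono)
      have "N \<le> r (k + N)" for k by (simp add: r_def)
      then show "\<forall>\<^sub>F k in sequentially. (\<integral>\<^sup>+x. ennreal ((norm (X n x - X (r (k + N)) x))\<^sup>2) \<partial>?M) \<le> ennreal e"
        unfolding nn using n[THEN less_imp_le] by (auto intro!: always_eventually ennreal_leI)
    qed
    finally show ?thesis by (simp add: Liminf_const)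
  qed
  have close: "\<exists>N. \<forall>n\<ge>N. (\<integral>\<^sup>+x. ennreal ((norm (X n x - f x))\<^sup>2) \<partial>?M) \<le> ennreal e" if e: "e > 0" for e
  proof -
    from cauchy[OF e] obtain N where "\<forall>m\<ge>N. \<forall>n\<ge>N. (LINT x|?M. (norm (X m x - X n x))\<^sup>2) < e" by blast
    then show ?thesis using fatou[OF e, of N] by blast
  qed
  have diff: "in_L2 \<Omega> (\<lambda>x. X n x - f x)" if "(\<integral>\<^sup>+x. ennreal ((norm (X n x - f x))\<^sup>2) \<partial>?M) \<le> ennreal e" for n e
    using that by (auto simp: in_L2_def integrable_iff_bounded top_unique less_top[symmetric])
  obtain N where "\<forall>n\<ge>N. (\<integral>\<^sup>+x. ennreal ((norm (X n x - f x))\<^sup>2) \<partial>?M) \<le> ennreal 1"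
    using close[of 1] by auto
  from in_L2_diff[OF X[of N] diff[OF this[rule_format, OF order_refl]]] have f: "in_L2 \<Omega> f" by simp
  have "(\<lambda>n. LINT x|?M. (norm (X n x - f x))\<^sup>2) \<longlonglongrightarrow> 0"
  proof (rule LIMSEQ_I)
    fix e :: real assume e: "e > 0"
    then obtain N where N: "\<forall>n\<ge>N. (\<integral>\<^sup>+x. ennreal ((norm (X n x - f x))\<^sup>2) \<partial>?M) \<le> ennreal (e / 2)"
      using close[of "e/2"] by auto
    have "norm ((LINT x|?M. (norm (X n x - f x))\<^sup>2) - 0) < e" if n: "n \<ge> N" for n
    proof -
      have "integrable ?M (\<lambda>x. (norm (X n x - f x))\<^sup>2)" using in_L2_diff[OF X f] by (simp add: in_L2_def)
      then have "ennreal (LINT x|?M. (norm (X n x - f x))\<^sup>2) \<le> ennreal (e / 2)"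
        using N n by (subst nn_integral_eq_integral[symmetric]) auto
      then have "(LINT x|?M. (norm (X n x - f x))\<^sup>2) \<le> e / 2" using e by simp
      moreover have "0 \<le> (LINT x|?M. (norm (X n x - f x))\<^sup>2)" by (intro integral_nonneg_AE) auto
      ultimately show ?thesis using e by simp
    qed
    then show "\<exists>N. \<forall>n\<ge>N. norm ((LINT x|?M. (norm (X n x - f x))\<^sup>2) - 0) < e" by blast
  qed
  then show ?thesis using f by blast
qed

section \<open>The Sobolev space\<close>

lemma borel_measurable_lebesgue_onI: "f \<in> borel_measurable borel \<Longrightarrow> f \<in> borel_measurable (lebesgue_on \<Omega>)"
  by (intro measurable_restrict_space1 measurable_completion) simp

lemma continuous_compact_support_bounded:
  fixes f :: "'a::euclidean_space \<Rightarrow> real"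
  assumes "continuous_on UNIV f" "compact K" "\<And>x. x \<notin> K \<Longrightarrow> f x = 0"
  shows "\<exists>C\<ge>0. \<forall>x. \<bar>f x\<bar> \<le> C"
proof -
  have "compact (f ` K)" using assms(1,2) by (intro compact_continuous_image) (auto intro: continuous_on_subset)
  then obtain C where C: "\<forall>x\<in>K. \<bar>f x\<bar> \<le> C" using compact_imp_bounded bounded_real by fastforce
  have "\<bar>f x\<bar> \<le> max C 0" for x using C assms(3) by (cases "x \<in> K") (auto simp: max_def)
  then show ?thesis by (intro exI[of _ "max C 0"]) auto
qed

lemma test_functionD:
  assumes "test_function \<Omega> \<phi>"
  shows "class_C k \<phi>" "continuous_on UNIV \<phi>" "(\<phi> has_derivative frechet_derivative \<phi> (at x)) (at x)"
    "continuous_on UNIV (\<lambda>x. frechet_derivative \<phi> (at x) h)"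
    "x \<notin> closure {x. \<phi> x \<noteq> 0} \<Longrightarrow> frechet_derivative \<phi> (at x) h = 0"
    "x \<notin> closure {x. \<phi> x \<noteq> 0} \<Longrightarrow> \<phi> x = 0"
    "compact (closure {x. \<phi> x \<noteq> 0})" "closure {x. \<phi> x \<noteq> 0} \<subseteq> \<Omega>"
proof -
  have C: "class_C k \<phi>" for k using assms by (simp add: test_function_def)
  show "class_C k \<phi>" "continuous_on UNIV \<phi>" by (rule C class_C_continuous[OF C[of 0]])+
  show "(\<phi> has_derivative frechet_derivative \<phi> (at x)) (at x)"
    "continuous_on UNIV (\<lambda>x. frechet_derivative \<phi> (at x) h)"
    by (rule class_C_has_derivative[OF C[of "Suc 0"]] class_C_continuous_derivative[OF C[of "Suc 0"]])+
  show z: "x \<notin> closure {x. \<phi> x \<noteq> 0} \<Longrightarrow> \<phi> x = 0" for x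
    using closure_subset[of "{x. \<phi> x \<noteq> 0}"] by auto
  show "frechet_derivative \<phi> (at x) h = 0" if x: "x \<notin> closure {x. \<phi> x \<noteq> 0}"
  proof -
    have "((\<lambda>x. 0) has_derivative (\<lambda>h. 0)) (at x)" by simp
    then have "(\<phi> has_derivative (\<lambda>h. 0)) (at x)"
    proof (rule has_derivative_transform_within_open)
      show "open (- closure {x. \<phi> x \<noteq> 0})" "x \<in> - closure {x. \<phi> x \<noteq> 0}" using x by (auto simp: open_Compl)
      show "0 = \<phi> y" if "y \<in> - closure {x. \<phi> x \<noteq> 0}" for y using z[of y] that by simp
    qed
    from frechet_derivative_at[OF this] show ?thesis by (simp add: fun_eq_iff)
  qed
  show "compact (closure {x. \<phi> x \<noteq> 0})" "closure {x. \<phi> x \<noteq> 0} \<subseteq> \<Omega>"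
    using assms by (auto simp: test_function_def simp del: compact_closure)
qed

lemma test_function_bounded:
  assumes "test_function \<Omega> \<phi>"
  shows "\<exists>C\<ge>0. \<forall>x. \<bar>\<phi> x\<bar> \<le> C" "\<exists>C\<ge>0. \<forall>x. \<bar>frechet_derivative \<phi> (at x) h\<bar> \<le> C"
  by (rule continuous_compact_support_bounded[OF test_functionD(2)[OF assms] test_functionD(7)[OF assms]]
        continuous_compact_support_bounded[OF test_functionD(4)[OF assms] test_functionD(7)[OF assms]]
        test_functionD(6)[OF assms] test_functionD(5)[OF assms] | assumption)+

lemma test_function_borel:
  assumes "test_function \<Omega> \<phi>"
  shows "\<phi> \<in> borel_measurable borel" "(\<lambda>x. frechet_derivative \<phi> (at x) h) \<in> borel_measurable borel"
  using test_functionD(2,4)[OF assms] by (auto intro: borel_measurable_continuous_onI)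

lemma test_function_in_L2:
  assumes "\<Omega> \<in> lmeasurable" "test_function \<Omega> \<phi>"
  shows "in_L2 \<Omega> \<phi>" "in_L2 \<Omega> (\<lambda>x. frechet_derivative \<phi> (at x) h)"
proof -
  obtain C where "\<forall>x. \<bar>\<phi> x\<bar> \<le> C" using test_function_bounded(1)[OF assms(2)] by blast
  then show "in_L2 \<Omega> \<phi>"
    by (intro in_L2_bounded[where C = C] assms borel_measurable_lebesgue_onI test_function_borel[OF assms(2)]) auto
  obtain C where "\<forall>x. \<bar>frechet_derivative \<phi> (at x) h\<bar> \<le> C" using test_function_bounded(2)[OF assms(2)] by blast
  then show "in_L2 \<Omega> (\<lambda>x. frechet_derivative \<phi> (at x) h)"
    by (intro in_L2_bounded[where C = C] assms borel_measurable_lebesgue_onI test_function_borel[OF assms(2)]) auto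
qed

section \<open>Weak gradients: linearity, change on null sets, limits\<close>

lemma H1_gradient_add:
  assumes \<Omega>: "\<Omega> \<in> lmeasurable" and f: "H1_gradient \<Omega> f g" and f': "H1_gradient \<Omega> f' g'"
  shows "H1_gradient \<Omega> (\<lambda>x. f x + f' x) (\<lambda>x. g x + g' x)"
  unfolding H1_gradient_def
proof (intro conjI allI impI ballI in_L2_add)
  show L: "in_L2 \<Omega> f" "in_L2 \<Omega> f'" "in_L2 \<Omega> g" "in_L2 \<Omega> g'" using f f' by (auto simp: H1_gradient_def)
  fix \<phi> and b :: 'a assume \<phi>: "test_function \<Omega> \<phi>" and b: "b \<in> Basis"
  note t = test_function_in_L2[OF \<Omega> \<phi>]
  note i = in_L2_mult_integrable[OF L(1) t(2), of b] in_L2_mult_integrable[OF L(2) t(2), of b]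
    in_L2_mult_integrable[OF in_L2_component[OF L(3), of b] t(1)] in_L2_mult_integrable[OF in_L2_component[OF L(4), of b] t(1)]
  show "(LINT x|lebesgue_on \<Omega>. (f x + f' x) * frechet_derivative \<phi> (at x) b) =
       - (LINT x|lebesgue_on \<Omega>. ((g x + g' x) \<bullet> b) * \<phi> x)"
    using f f' \<phi> b i by (simp add: H1_gradient_def distrib_right inner_add_left)
qed

lemma H1_gradient_scale:
  assumes f: "H1_gradient \<Omega> f g"
  shows "H1_gradient \<Omega> (\<lambda>x. c * f x) (\<lambda>x. c *\<^sub>R g x)"
  using f in_L2_scaleR[of \<Omega> f c] in_L2_scaleR[of \<Omega> g c] by (simp add: H1_gradient_def mult.assoc)

lemma H1_gradient_cong_AE:
  assumes f: "H1_gradient \<Omega> f g"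
    and m: "f' \<in> borel_measurable (lebesgue_on \<Omega>)" "g' \<in> borel_measurable (lebesgue_on \<Omega>)"
    and ae: "AE x in lebesgue_on \<Omega>. f' x = f x" "AE x in lebesgue_on \<Omega>. g' x = g x"
  shows "H1_gradient \<Omega> f' g'"
  unfolding H1_gradient_def in_L2_def
proof (intro conjI allI impI ballI m)
  have [measurable]: "f \<in> borel_measurable (lebesgue_on \<Omega>)" "g \<in> borel_measurable (lebesgue_on \<Omega>)"
    using f by (auto simp: H1_gradient_def in_L2_def)
  note [measurable] = m
  have i: "integrable (lebesgue_on \<Omega>) (\<lambda>x. (norm (f x))\<^sup>2)" "integrable (lebesgue_on \<Omega>) (\<lambda>x. (norm (g x))\<^sup>2)"
    using f by (auto simp: H1_gradient_def in_L2_def)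
  have "AE x in lebesgue_on \<Omega>. (norm (f x))\<^sup>2 = (norm (f' x))\<^sup>2" using ae(1) by eventually_elim simp
  then show "integrable (lebesgue_on \<Omega>) (\<lambda>x. (norm (f' x))\<^sup>2)"
    by (rule integrable_cong_AE_imp[OF i(1), rotated]) measurable
  have "AE x in lebesgue_on \<Omega>. (norm (g x))\<^sup>2 = (norm (g' x))\<^sup>2" using ae(2) by eventually_elim simp
  then show "integrable (lebesgue_on \<Omega>) (\<lambda>x. (norm (g' x))\<^sup>2)"
    by (rule integrable_cong_AE_imp[OF i(2), rotated]) measurable
  fix \<phi> and b :: 'a assume \<phi>: "test_function \<Omega> \<phi>" and b: "b \<in> Basis"
  have [measurable]: "\<phi> \<in> borel_measurable (lebesgue_on \<Omega>)" "(\<lambda>x. frechet_derivative \<phi> (at x) b) \<in> borel_measurable (lebesgue_on \<Omega>)"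
    using test_function_borel[OF \<phi>] by (auto intro: borel_measurable_lebesgue_onI)
  have "(LINT x|lebesgue_on \<Omega>. f' x * frechet_derivative \<phi> (at x) b) = (LINT x|lebesgue_on \<Omega>. f x * frechet_derivative \<phi> (at x) b)"
    by (rule integral_cong_AE) (use ae in auto)
  moreover have "(LINT x|lebesgue_on \<Omega>. (g' x \<bullet> b) * \<phi> x) = (LINT x|lebesgue_on \<Omega>. (g x \<bullet> b) * \<phi> x)"
    by (rule integral_cong_AE) (use ae in auto)
  ultimately show "(LINT x|lebesgue_on \<Omega>. f' x * frechet_derivative \<phi> (at x) b) = - (LINT x|lebesgue_on \<Omega>. (g' x \<bullet> b) * \<phi> x)"
    using f \<phi> b by (simp add: H1_gradient_def)
qed

lemma H1_gradient_limit:
  assumes \<Omega>: "\<Omega> \<in> lmeasurable" and X: "\<And>n. H1_gradient \<Omega> (f n) (g n)"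
    and L2: "in_L2 \<Omega> f'" "in_L2 \<Omega> g'"
    and lim: "(\<lambda>n. LINT x|lebesgue_on \<Omega>. (norm (f n x - f' x))\<^sup>2) \<longlonglongrightarrow> 0"
      "(\<lambda>n. LINT x|lebesgue_on \<Omega>. (norm (g n x - g' x))\<^sup>2) \<longlonglongrightarrow> 0"
  shows "H1_gradient \<Omega> f' g'"
  unfolding H1_gradient_def
proof (intro conjI allI impI ballI L2)
  fix \<phi> and b :: 'a assume \<phi>: "test_function \<Omega> \<phi>" and b: "b \<in> Basis"
  note t = test_function_in_L2[OF \<Omega> \<phi>]
  have L: "in_L2 \<Omega> (f n)" "in_L2 \<Omega> (g n)" for n using X by (auto simp: H1_gradient_def)
  have "(\<lambda>n. LINT x|lebesgue_on \<Omega>. f n x \<bullet> frechet_derivative \<phi> (at x) b) \<longlonglongrightarrow> (LINT x|lebesgue_on \<Omega>. f' x \<bullet> frechet_derivative \<phi> (at x) b)"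
    by (rule L2_inner_tendsto[OF L(1) L2(1) t(2) lim(1)])
  moreover have "(\<lambda>n. LINT x|lebesgue_on \<Omega>. g n x \<bullet> (\<phi> x *\<^sub>R b)) \<longlonglongrightarrow> (LINT x|lebesgue_on \<Omega>. g' x \<bullet> (\<phi> x *\<^sub>R b))"
  proof (rule L2_inner_tendsto[OF L(2) L2(2) _ lim(2)])
    obtain C where C: "\<forall>x. \<bar>\<phi> x\<bar> \<le> C" using test_function_bounded(1)[OF \<phi>] by blast
    show "in_L2 \<Omega> (\<lambda>x. \<phi> x *\<^sub>R b)"
    proof (rule in_L2_bounded[OF \<Omega>])
      have "\<phi> \<in> borel_measurable (lebesgue_on \<Omega>)"
        by (rule borel_measurable_lebesgue_onI[OF test_function_borel(1)[OF \<phi>]])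
      then show "(\<lambda>x. \<phi> x *\<^sub>R b) \<in> borel_measurable (lebesgue_on \<Omega>)" by measurable
      show "norm (\<phi> x *\<^sub>R b) \<le> C" for x using C b by simp
    qed
  qed
  moreover have "(LINT x|lebesgue_on \<Omega>. f n x \<bullet> frechet_derivative \<phi> (at x) b) = - (LINT x|lebesgue_on \<Omega>. g n x \<bullet> (\<phi> x *\<^sub>R b))" for n
    using X[of n] \<phi> b by (simp add: H1_gradient_def mult.commute)
  ultimately have "(\<lambda>n. - (LINT x|lebesgue_on \<Omega>. g n x \<bullet> (\<phi> x *\<^sub>R b))) \<longlonglongrightarrow> (LINT x|lebesgue_on \<Omega>. f' x \<bullet> frechet_derivative \<phi> (at x) b)"
    "(\<lambda>n. - (LINT x|lebesgue_on \<Omega>. g n x \<bullet> (\<phi> x *\<^sub>R b))) \<longlonglongrightarrow> - (LINT x|lebesgue_on \<Omega>. g' x \<bullet> (\<phi> x *\<^sub>R b))"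
    by (simp_all only: tendsto_minus)
  then have "(LINT x|lebesgue_on \<Omega>. f' x \<bullet> frechet_derivative \<phi> (at x) b) = - (LINT x|lebesgue_on \<Omega>. g' x \<bullet> (\<phi> x *\<^sub>R b))"
    by (rule LIMSEQ_unique)
  then show "(LINT x|lebesgue_on \<Omega>. f' x * frechet_derivative \<phi> (at x) b) = - (LINT x|lebesgue_on \<Omega>. (g' x \<bullet> b) * \<phi> x)"
    by (simp add: mult.commute)
qed

section \<open>Borel representatives and integrals over the whole space\<close>

lemma integral_lebesgue_on_borel:
  fixes F :: "'a::euclidean_space \<Rightarrow> real"
  assumes "\<Omega> \<in> sets lebesgue" "F \<in> borel_measurable borel" "\<And>x. x \<notin> \<Omega> \<Longrightarrow> F x = 0"
  shows "(LINT x|lebesgue_on \<Omega>. F x) = (LINT x|lborel. F x)"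
    and "integrable (lebesgue_on \<Omega>) F \<longleftrightarrow> integrable lborel F"
proof -
  have eq: "(\<lambda>x. indicator \<Omega> x *\<^sub>R F x) = F" using assms(3) by (auto simp: indicator_def fun_eq_iff)
  have \<Omega>: "\<Omega> \<inter> space lebesgue \<in> sets lebesgue" and F: "F \<in> borel_measurable lborel"
    using assms by simp_all
  show "(LINT x|lebesgue_on \<Omega>. F x) = (LINT x|lborel. F x)"
    unfolding integral_restrict_space[OF \<Omega>] eq by (rule integral_completion[OF F])
  show "integrable (lebesgue_on \<Omega>) F \<longleftrightarrow> integrable lborel F"
    unfolding integrable_restrict_space[OF \<Omega>] eq by (rule integrable_completion[OF F])
qed

lemma borel_representative_real:
  fixes f :: "'a::euclidean_space \<Rightarrow> real"
  assumes "f \<in> borel_measurable (lebesgue_on \<Omega>)" "open \<Omega>"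
  shows "\<exists>f0\<in>borel_measurable borel. (\<forall>x. x \<notin> \<Omega> \<longrightarrow> f0 x = 0) \<and> (AE x in lebesgue_on \<Omega>. f0 x = f x)"
proof -
  have \<Omega>: "\<Omega> \<inter> space lebesgue \<in> sets lebesgue" using assms(2) by auto
  have "(\<lambda>x. indicator \<Omega> x *\<^sub>R f x) \<in> borel_measurable lebesgue"
    using assms(1) by (subst borel_measurable_restrict_space_iff[OF \<Omega>, symmetric])
  from completion_ex_borel_measurable_real[OF this]
  obtain f1 where f1: "f1 \<in> borel_measurable lborel" "AE x in lborel. indicator \<Omega> x *\<^sub>R f x = f1 x" by blast
  show ?thesis
  proof (intro bexI conjI allI impI)
    show "(\<lambda>x. indicator \<Omega> x * f1 x) \<in> borel_measurable borel"
      using f1(1) assms(2) by (intro borel_measurable_times borel_measurable_indicator) auto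
    have "AE x in lebesgue. x \<in> \<Omega> \<longrightarrow> indicator \<Omega> x * f1 x = f x"
      using AE_completion[OF f1(2)] by eventually_elim auto
    then show "AE x in lebesgue_on \<Omega>. indicator \<Omega> x * f1 x = f x"
      by (subst AE_restrict_space_iff[OF \<Omega>])
  qed auto
qed

lemma borel_representative:
  fixes f :: "'a::euclidean_space \<Rightarrow> 'b::euclidean_space"
  assumes f: "f \<in> borel_measurable (lebesgue_on \<Omega>)" and \<Omega>: "open \<Omega>"
  shows "\<exists>f0\<in>borel_measurable borel. (\<forall>x. x \<notin> \<Omega> \<longrightarrow> f0 x = 0) \<and> (AE x in lebesgue_on \<Omega>. f0 x = f x)"
proof -
  have "\<exists>f0\<in>borel_measurable borel. (\<forall>x. x \<notin> \<Omega> \<longrightarrow> f0 x = 0) \<and> (AE x in lebesgue_on \<Omega>. f0 x = f x \<bullet> b)" for b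
    using f \<Omega> by (intro borel_representative_real) auto
  then obtain F where F: "\<And>b. F b \<in> borel_measurable borel" "\<And>b x. x \<notin> \<Omega> \<Longrightarrow> F b x = 0"
    "\<And>b. AE x in lebesgue_on \<Omega>. F b x = f x \<bullet> b" by metis
  show ?thesis
  proof (intro bexI conjI allI impI)
    have "AE x in lebesgue_on \<Omega>. \<forall>b\<in>Basis. F b x = f x \<bullet> b" using F(3) by (simp add: AE_ball_countable countable_finite)
    then show "AE x in lebesgue_on \<Omega>. (\<Sum>b\<in>Basis. F b x *\<^sub>R b) = f x"
      by eventually_elim (simp add: euclidean_representation)
    show "(\<lambda>x. \<Sum>b\<in>Basis. F b x *\<^sub>R b) \<in> borel_measurable borel" using F(1) by measurable
  qed (simp add: F(2))
qed

text \<open>Translations and exchange of integrals are carried out with the Borel sets of the whole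
  space; this supplies representatives to which they apply.\<close>

lemma H1_borel_representative:
  assumes f: "H1_gradient \<Omega> f g" and \<Omega>: "open \<Omega>"
  obtains f0 g0 where "f0 \<in> borel_measurable borel" "g0 \<in> borel_measurable borel"
    "\<And>x. x \<notin> \<Omega> \<Longrightarrow> f0 x = 0" "\<And>x. x \<notin> \<Omega> \<Longrightarrow> g0 x = 0"
    "AE x in lebesgue_on \<Omega>. f0 x = f x" "AE x in lebesgue_on \<Omega>. g0 x = g x" "H1_gradient \<Omega> f0 g0"
proof -
  have m: "f \<in> borel_measurable (lebesgue_on \<Omega>)" "g \<in> borel_measurable (lebesgue_on \<Omega>)"
    using f by (auto simp: H1_gradient_def in_L2_def)
  obtain f0 where f0: "f0 \<in> borel_measurable borel" "\<forall>x. x \<notin> \<Omega> \<longrightarrow> f0 x = 0" "AE x in lebesgue_on \<Omega>. f0 x = f x"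
    using borel_representative[OF m(1) \<Omega>] by blast
  obtain g0 where g0: "g0 \<in> borel_measurable borel" "\<forall>x. x \<notin> \<Omega> \<longrightarrow> g0 x = 0" "AE x in lebesgue_on \<Omega>. g0 x = g x"
    using borel_representative[OF m(2) \<Omega>] by blast
  have "H1_gradient \<Omega> f0 g0"
    by (rule H1_gradient_cong_AE[OF f _ _ f0(3) g0(3)]) (auto intro: borel_measurable_lebesgue_onI f0 g0)
  then show ?thesis using that f0 g0 by blast
qed

text \<open>The bound \<open>C\<close>, uniform over the unit interval, gives integrability on the
  product. The variable \<open>s\<close> will be the parameter along a segment of
  translations.\<close>

lemma Fubini_unit_interval:
  fixes u :: "'a::euclidean_space \<Rightarrow> real \<Rightarrow> real"
  assumes [measurable]: "case_prod u \<in> borel_measurable (borel \<Otimes>\<^sub>M borel)"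
    and int: "\<And>s. s \<in> {0..1} \<Longrightarrow> integrable lborel (\<lambda>x. u x s)"
    and bound: "\<And>s. s \<in> {0..1} \<Longrightarrow> (LINT x|lborel. \<bar>u x s\<bar>) \<le> C"
  shows "(LINT x|lborel. LINT s|lborel. u x s * indicator {0..1} s) = (LINT s|lborel. (LINT x|lborel. u x s) * indicator {0..1} s)"
    and "integrable lborel (\<lambda>x. LINT s|lborel. u x s * indicator {0..1} s)"
proof -
  define w where "w s x = u x s * indicator {0..1} s" for s x
  have mw [measurable]: "case_prod w \<in> borel_measurable (lborel \<Otimes>\<^sub>M lborel)"
    unfolding w_def[abs_def] by measurable
  have iw: "integrable lborel (w s)" for s
    using int[of s] by (cases "s \<in> {0..1::real}") (auto simp: w_def[abs_def])
  have "integrable (lborel \<Otimes>\<^sub>M lborel) (case_prod w)"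
  proof (rule lborel_pair.Fubini_integrable)
    show "integrable lborel (\<lambda>s. LINT x|lborel. norm (case_prod w (s, x)))"
    proof (rule integrable_dominated[where g = "\<lambda>s. \<bar>C\<bar> * indicator {0..1} s"])
      show "norm (LINT x|lborel. norm (case_prod w (s, x))) \<le> \<bar>C\<bar> * indicator {0..1} s" for s
      proof (cases "s \<in> {0..1::real}")
        case True
        have "0 \<le> (LINT x|lborel. \<bar>u x s\<bar>)" by (intro integral_nonneg_AE) auto
        then show ?thesis using bound[OF True] True by (simp add: w_def)
      qed (simp add: w_def)
    qed auto
    show "AE s in lborel. integrable lborel (\<lambda>x. case_prod w (s, x))" using iw by simp
  qed simp
  note W = lborel_pair.Fubini_integral[OF this] lborel_pair.integrable_snd[OF this]
  show "integrable lborel (\<lambda>x. LINT s|lborel. u x s * indicator {0..1} s)" using W(2) by (simp add: w_def)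
  show "(LINT x|lborel. LINT s|lborel. u x s * indicator {0..1} s) = (LINT s|lborel. (LINT x|lborel. u x s) * indicator {0..1} s)"
    using W(1) by (simp add: w_def)
qed

lemma increment_eq_integral:
  assumes "test_function \<Omega> \<phi>"
  shows "(LINT s|lborel. frechet_derivative \<phi> (at (y + s *\<^sub>R h)) h * indicator {0..1} s) = \<phi> (y + h) - \<phi> y"
proof -
  have "DERIV (\<lambda>s. \<phi> (y + s *\<^sub>R h)) s :> frechet_derivative \<phi> (at (y + s *\<^sub>R h)) h" for s
  proof -
    have "((\<lambda>s. y + s *\<^sub>R h) has_derivative (\<lambda>t. t *\<^sub>R h)) (at s)" by (auto intro!: derivative_eq_intros)
    from has_derivative_compose[OF this test_functionD(3)[OF assms]]
    have "((\<lambda>s. \<phi> (y + s *\<^sub>R h)) has_derivative (\<lambda>t. frechet_derivative \<phi> (at (y + s *\<^sub>R h)) (t *\<^sub>R h))) (at s)" .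
    then show ?thesis unfolding has_field_derivative_def
      using linear_scale[OF has_derivative_linear[OF test_functionD(3)[OF assms]]] by (simp add: mult.commute[of _ "frechet_derivative _ _ _"] fun_eq_iff)
  qed
  moreover have "isCont (\<lambda>s. frechet_derivative \<phi> (at (y + s *\<^sub>R h)) h) s" for s
    using continuous_on_compose2[OF test_functionD(4)[OF assms, of h], of UNIV "\<lambda>s. y + s *\<^sub>R h"]
    by (auto simp: continuous_on_eq_continuous_at intro!: continuous_intros)
  ultimately show ?thesis
    using integral_FTC_Icc_real[of 0 1 "\<lambda>s. \<phi> (y + s *\<^sub>R h)" "\<lambda>s. frechet_derivative \<phi> (at (y + s *\<^sub>R h)) h"] by simp
qed

lemma integrable_compact_support:
  fixes f :: "'a::euclidean_space \<Rightarrow> real"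
  assumes "continuous_on UNIV f" "compact K" "\<And>x. x \<notin> K \<Longrightarrow> f x = 0"
  shows "integrable lborel f"
proof -
  have "integrable lborel (\<lambda>x. indicator K x *\<^sub>R f x)"
    using borel_integrable_compact[OF assms(2) continuous_on_subset[OF assms(1)]] by simp
  moreover have "(\<lambda>x. indicator K x *\<^sub>R f x) = f" using assms(3) by (auto simp: fun_eq_iff indicator_def)
  ultimately show ?thesis by simp
qed

lemma integrable_test_function:
  assumes "test_function \<Omega> \<phi>"
  shows "integrable lborel \<phi>" "integrable lborel (\<lambda>x. frechet_derivative \<phi> (at x) h)"
  by (rule integrable_compact_support[OF test_functionD(2)[OF assms] test_functionD(7)[OF assms]]
        integrable_compact_support[OF test_functionD(4)[OF assms] test_functionD(7)[OF assms]]
        test_functionD(6)[OF assms] test_functionD(5)[OF assms] | assumption)+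

lemma derivative_shift_measurable:
  assumes "test_function \<Omega> \<phi>"
  shows "(\<lambda>(x, s). frechet_derivative \<phi> (at (x + s *\<^sub>R h)) k) \<in> borel_measurable (borel \<Otimes>\<^sub>M (borel :: real measure))"
  using measurable_compose[of "\<lambda>(x, s). x + s *\<^sub>R h" "borel \<Otimes>\<^sub>M (borel :: real measure)" borel "\<lambda>x. frechet_derivative \<phi> (at x) k" borel]
    test_function_borel(2)[OF assms, of k] by (simp add: case_prod_beta')

text \<open>The integral is unchanged if the integrand is averaged over the translates by
  \<open>s *\<^sub>R h\<close> for \<open>s\<close> in the unit interval. By the fundamental theorem
  of calculus the averaged integrand is \<open>\<phi> (x + h) - \<phi> x\<close>, whose integral is
  0. This is what makes 0 a weak gradient of a constant.\<close>

lemma integral_test_function_derivative: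
  assumes \<phi>: "test_function \<Omega> \<phi>"
  shows "(LINT x|lborel. frechet_derivative \<phi> (at x) h) = 0"
proof -
  let ?D = "\<lambda>x. frechet_derivative \<phi> (at x) h"
  have [measurable]: "?D \<in> borel_measurable borel" by (rule test_function_borel[OF \<phi>])
  have "(LINT x|lborel. ?D x) = (LINT s|lborel. (LINT x|lborel. ?D (x + s *\<^sub>R h)) * indicator {0..1::real} s)"
    by (subst integral_lborel_shift) simp_all
  also have "\<dots> = (LINT x|lborel. LINT s|lborel. ?D (x + s *\<^sub>R h) * indicator {0..1} s)"
  proof (rule Fubini_unit_interval(1)[symmetric, where C = "LINT x|lborel. \<bar>?D x\<bar>"])
    show "integrable lborel (\<lambda>x. ?D (x + s *\<^sub>R h))" for s
      by (rule integrable_lborel_shift[OF integrable_test_function(2)[OF \<phi>]])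
    show "(LINT x|lborel. \<bar>?D (x + s *\<^sub>R h)\<bar>) \<le> (LINT x|lborel. \<bar>?D x\<bar>)" for s
      using integral_lborel_shift[of "\<lambda>x. \<bar>?D x\<bar>" "s *\<^sub>R h"] by simp
  qed (rule derivative_shift_measurable[OF \<phi>])
  also have "\<dots> = (LINT x|lborel. \<phi> (x + h) - \<phi> x)" by (simp add: increment_eq_integral[OF \<phi>])
  also have "\<dots> = 0"
    using integrable_test_function(1)[OF \<phi>] integrable_lborel_shift[OF integrable_test_function(1)[OF \<phi>], of h]
      test_function_borel[OF \<phi>] by (simp add: integral_lborel_shift)
  finally show ?thesis .
qed

lemma H1_gradient_const:
  assumes "\<Omega> \<in> lmeasurable"
  shows "H1_gradient \<Omega> (\<lambda>x. c) (\<lambda>x. 0)"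
  unfolding H1_gradient_def
proof (intro conjI allI impI ballI)
  show "in_L2 \<Omega> (\<lambda>x. c)" by (rule in_L2_bounded[OF assms, of _ "norm c"]) auto
  show "in_L2 \<Omega> (\<lambda>x. 0::'a)" by (rule in_L2_bounded[OF assms, of _ 0]) auto
  fix \<phi> and b :: 'a assume \<phi>: "test_function \<Omega> \<phi>"
  have "(LINT x|lebesgue_on \<Omega>. frechet_derivative \<phi> (at x) b) = (LINT x|lborel. frechet_derivative \<phi> (at x) b)"
    using assms test_functionD(5,8)[OF \<phi>] by (intro integral_lebesgue_on_borel test_function_borel[OF \<phi>]) auto
  then show "(LINT x|lebesgue_on \<Omega>. c * frechet_derivative \<phi> (at x) b) = - (LINT x|lebesgue_on \<Omega>. (0 \<bullet> b) * \<phi> x)"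
    by (simp add: integral_test_function_derivative[OF \<phi>])
qed

section \<open>Increments along segments\<close>

text \<open>The complement is the sum of the closed set \<open>- \<Omega>\<close> and a compact
  segment, hence closed.\<close>

lemma open_segments_inside:
  fixes \<Omega> :: "'a::euclidean_space set"
  assumes "open \<Omega>"
  shows "open {x. \<forall>s\<in>{0..1}. x + s *\<^sub>R h \<in> \<Omega>}"
proof -
  let ?T = "(\<lambda>s. - (s *\<^sub>R h)) ` {0..1::real}"
  have "compact ?T" by (intro compact_continuous_image continuous_intros) auto
  then have "closed (\<Union>x\<in>- \<Omega>. \<Union>y\<in>?T. {x + y})" using assms by (intro closed_compact_sums) (auto simp: closed_Compl)
  moreover have "(\<Union>x\<in>- \<Omega>. \<Union>y\<in>?T. {x + y}) = - {x. \<forall>s\<in>{0..1}. x + s *\<^sub>R h \<in> \<Omega>}" (is "?L = ?R")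
  proof (intro equalityI subsetI)
    fix z assume "z \<in> ?R"
    then obtain s where "s \<in> {0..1}" "z + s *\<^sub>R h \<notin> \<Omega>" by auto
    then show "z \<in> ?L" by (auto intro!: bexI[of _ "z + s *\<^sub>R h"] bexI[of _ s])
  next
    fix z assume "z \<in> ?L"
    then obtain x s where "x \<notin> \<Omega>" "s \<in> {0..1}" "z = x - s *\<^sub>R h" by auto
    then have "z + s *\<^sub>R h \<notin> \<Omega>" by simp
    with \<open>s \<in> {0..1}\<close> show "z \<in> ?R" by blast
  qed
  ultimately have "closed (- {x. \<forall>s\<in>{0..1}. x + s *\<^sub>R h \<in> \<Omega>})" by (simp only:)
  then show ?thesis by (simp only: closed_def double_complement)
qed

text \<open>Cauchy-Schwarz against the indicator of \<open>B\<close>, with extended values so that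
  it can be applied before square integrability is known. If the square is not integrable, either
  the right side is infinite or \<open>B\<close> is a null set and the left side is 0.\<close>

lemma square_integral_le:
  fixes w :: "'b \<Rightarrow> real"
  assumes [measurable]: "w \<in> borel_measurable M" "B \<in> sets M" and fin: "emeasure M B < \<infinity>"
  shows "ennreal ((LINT s|M. w s * indicator B s)\<^sup>2)
    \<le> ennreal (measure M B) * (\<integral>\<^sup>+s. ennreal ((w s)\<^sup>2) * indicator B s \<partial>M)"
proof (cases "integrable M (\<lambda>s. (w s)\<^sup>2 * indicator B s)")
  case i2: True
  have eq: "ennreal ((w s)\<^sup>2) * indicator B s = ennreal ((w s)\<^sup>2 * indicator B s)" for s
    by (auto simp: indicator_def)
  have i0: "integrable M (indicator B :: 'b \<Rightarrow> real)" using fin by simp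
  have i1: "integrable M (\<lambda>s. w s * indicator B s)"
  proof (rule integrable_dominated[where g = "\<lambda>s. (w s)\<^sup>2 * indicator B s + indicator B s"])
    show "integrable M (\<lambda>s. (w s)\<^sup>2 * indicator B s + indicator B s)"
      by (rule Bochner_Integration.integrable_add[OF i2 i0])
    show "norm (w s * indicator B s) \<le> (w s)\<^sup>2 * indicator B s + indicator B s" for s
    proof -
      have "0 \<le> (\<bar>w s\<bar> - 1)\<^sup>2" by simp
      then have "2 * \<bar>w s\<bar> \<le> (w s)\<^sup>2 + 1" by (simp add: power2_diff)
      then have "\<bar>w s\<bar> \<le> (w s)\<^sup>2 + 1" using abs_ge_zero[of "w s"] by linarith
      then show ?thesis by (auto simp: indicator_def)
    qed
  qed measurable
  have "(LINT s|M. w s * indicator B s)\<^sup>2 \<le> (LINT s|M. (w s)\<^sup>2 * indicator B s) * measure M B"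
  proof (rule quadratic_nonneg_imp)
    fix t
    have "0 \<le> (LINT s|M. (w s + t)\<^sup>2 * indicator B s)" by (intro integral_nonneg_AE) auto
    also have "\<dots> = (LINT s|M. (w s)\<^sup>2 * indicator B s + (2 * t) * (w s * indicator B s) + t\<^sup>2 * indicator B s)"
      by (intro Bochner_Integration.integral_cong) (auto simp: power2_sum algebra_simps)
    also have "\<dots> = (LINT s|M. (w s)\<^sup>2 * indicator B s) + 2 * t * (LINT s|M. w s * indicator B s) + t\<^sup>2 * measure M B"
      using i2 i0 i1 by simp
    finally show "0 \<le> (LINT s|M. (w s)\<^sup>2 * indicator B s) + 2 * t * (LINT s|M. w s * indicator B s) + t\<^sup>2 * measure M B" .
  qed
  then have "ennreal ((LINT s|M. w s * indicator B s)\<^sup>2) \<le> ennreal (measure M B * (LINT s|M. (w s)\<^sup>2 * indicator B s))"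
    by (simp add: ennreal_leI mult.commute)
  also have "\<dots> = ennreal (measure M B) * ennreal (LINT s|M. (w s)\<^sup>2 * indicator B s)"
    by (intro ennreal_mult integral_nonneg_AE) auto
  also have "ennreal (LINT s|M. (w s)\<^sup>2 * indicator B s) = (\<integral>\<^sup>+s. ennreal ((w s)\<^sup>2) * indicator B s \<partial>M)"
    unfolding eq by (intro nn_integral_eq_integral[symmetric] i2) auto
  finally show ?thesis .
next
  case False
  have eq: "ennreal ((w s)\<^sup>2) * indicator B s = ennreal ((w s)\<^sup>2 * indicator B s)" for s
    by (auto simp: indicator_def)
  have inf: "(\<integral>\<^sup>+s. ennreal ((w s)\<^sup>2) * indicator B s \<partial>M) = \<infinity>"
  proof (rule ccontr)
    assume "(\<integral>\<^sup>+s. ennreal ((w s)\<^sup>2) * indicator B s \<partial>M) \<noteq> \<infinity>"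
    then have "integrable M (\<lambda>s. (w s)\<^sup>2 * indicator B s)"
      unfolding eq by (intro integrableI_nonneg) (auto simp: less_top)
    with False show False by simp
  qed
  show ?thesis
  proof (cases "measure M B = 0")
    case True
    then have "B \<in> null_sets M" using fin assms(2) by (auto simp: null_sets_def measure_def enn2real_eq_0_iff)
    then have "AE s in M. w s * indicator B s = 0"
      by (rule AE_mp[OF AE_not_in]) (auto intro!: AE_I2)
    then have "(LINT s|M. w s * indicator B s) = (LINT s|M. 0)" by (intro integral_cong_AE) auto
    then show ?thesis by simp
  next
    case False
    then have "ennreal (measure M B) * \<infinity> = \<infinity>"
      by (simp add: ennreal_mult_top ennreal_eq_0_iff measure_le_0_iff)
    then show ?thesis unfolding inf by simp
  qed
qed

text \<open>The zero extension of \<open>f\<close> has in general no weak gradient across the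
  boundary. Increments are therefore expressed through \<open>g\<close> only along segments inside
  the domain, while \<open>f\<close> and \<open>g\<close> live on the whole space so that they can
  be translated.\<close>

locale H1_borel =
  fixes \<Omega> :: "'a::euclidean_space set" and f :: "'a \<Rightarrow> real" and g :: "'a \<Rightarrow> 'a"
  assumes open_dom: "open \<Omega>" and bounded_dom: "bounded \<Omega>"
    and gradient: "H1_gradient \<Omega> f g"
    and f_borel [measurable]: "f \<in> borel_measurable borel" and g_borel [measurable]: "g \<in> borel_measurable borel"
    and f_outside: "\<And>x. x \<notin> \<Omega> \<Longrightarrow> f x = 0" and g_outside: "\<And>x. x \<notin> \<Omega> \<Longrightarrow> g x = 0"
begin

lemma lmeasurable_dom: "\<Omega> \<in> lmeasurable"
  by (rule lmeasurable_open[OF bounded_dom open_dom])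

lemma dom_sets: "\<Omega> \<in> sets lebesgue"
  using lmeasurable_dom by blast

lemma in_L2: "in_L2 \<Omega> f" "in_L2 \<Omega> g"
  using gradient by (auto simp: H1_gradient_def)

lemma integrable_f: "integrable lborel f"
proof -
  have "in_L2 \<Omega> (\<lambda>x. 1::real)" by (rule in_L2_bounded[OF lmeasurable_dom, of _ 1]) auto
  from in_L2_mult_integrable[OF in_L2(1) this] have "integrable (lebesgue_on \<Omega>) f" by simp
  then show ?thesis using integral_lebesgue_on_borel(2)[OF dom_sets f_borel f_outside] by simp
qed

lemma integrable_g: "integrable lborel (\<lambda>x. g x \<bullet> k)"
proof -
  have "in_L2 \<Omega> (\<lambda>x. k)" by (rule in_L2_bounded[OF lmeasurable_dom, of _ "norm k"]) auto
  from in_L2_inner_integrable[OF in_L2(2) this] have "integrable (lebesgue_on \<Omega>) (\<lambda>x. g x \<bullet> k)" .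
  then show ?thesis using integral_lebesgue_on_borel(2)[OF dom_sets, of "\<lambda>x. g x \<bullet> k"] g_outside by simp
qed

lemma integrable_bounded_mult:
  fixes u v :: "'a \<Rightarrow> real"
  assumes u: "integrable lborel u" and v: "v \<in> borel_measurable borel" "\<And>x. \<bar>v x\<bar> \<le> C"
  shows "integrable lborel (\<lambda>x. u x * v x)"
proof (rule integrable_dominated[where g = "\<lambda>x. C * \<bar>u x\<bar>"])
  show "integrable lborel (\<lambda>x. C * \<bar>u x\<bar>)" using u by (intro integrable_mult_right integrable_abs)
  show "norm (u x * v x) \<le> C * \<bar>u x\<bar>" for x
    using mult_right_mono[OF v(2)[of x], of "\<bar>u x\<bar>"] by (simp add: abs_mult mult.commute)
  show "(\<lambda>x. u x * v x) \<in> borel_measurable lborel" using u v(1) by (intro borel_measurable_times) auto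
qed

lemma weak_direction:
  assumes \<psi>: "test_function \<Omega> \<psi>"
  shows "(LINT x|lborel. f x * frechet_derivative \<psi> (at x) k) = - (LINT x|lborel. (g x \<bullet> k) * \<psi> x)"
proof -
  note [measurable] = test_function_borel[OF \<psi>]
  have basis: "(LINT x|lborel. f x * frechet_derivative \<psi> (at x) b) = - (LINT x|lborel. (g x \<bullet> b) * \<psi> x)" if "b \<in> Basis" for b
  proof -
    have "(LINT x|lebesgue_on \<Omega>. f x * frechet_derivative \<psi> (at x) b) = (LINT x|lborel. f x * frechet_derivative \<psi> (at x) b)"
      by (rule integral_lebesgue_on_borel(1)[OF dom_sets]) (simp_all add: f_outside)
    moreover have "(LINT x|lebesgue_on \<Omega>. (g x \<bullet> b) * \<psi> x) = (LINT x|lborel. (g x \<bullet> b) * \<psi> x)"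
      by (rule integral_lebesgue_on_borel(1)[OF dom_sets]) (simp_all add: g_outside)
    ultimately show ?thesis using gradient \<psi> that by (simp add: H1_gradient_def)
  qed
  obtain C where C: "\<And>x. \<bar>\<psi> x\<bar> \<le> C" using test_function_bounded(1)[OF \<psi>] by blast
  have if': "integrable lborel (\<lambda>x. f x * frechet_derivative \<psi> (at x) b)" for b
  proof -
    obtain C where "\<And>x. \<bar>frechet_derivative \<psi> (at x) b\<bar> \<le> C" using test_function_bounded(2)[OF \<psi>] by blast
    then show ?thesis by (rule integrable_bounded_mult[OF integrable_f test_function_borel(2)[OF \<psi>]])
  qed
  have ig': "integrable lborel (\<lambda>x. (g x \<bullet> b) * \<psi> x)" for b
    by (rule integrable_bounded_mult[OF integrable_g test_function_borel(1)[OF \<psi>] C])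
  have "f x * frechet_derivative \<psi> (at x) k = (\<Sum>b\<in>Basis. (k \<bullet> b) * (f x * frechet_derivative \<psi> (at x) b))" for x
    by (subst frechet_derivative_eq_sum[OF test_functionD(3)[OF \<psi>]]) (simp add: sum_distrib_left mult.left_commute)
  then have "(LINT x|lborel. f x * frechet_derivative \<psi> (at x) k) = (\<Sum>b\<in>Basis. (k \<bullet> b) * (LINT x|lborel. f x * frechet_derivative \<psi> (at x) b))"
    using if' by simp
  also have "\<dots> = (\<Sum>b\<in>Basis. (k \<bullet> b) * - (LINT x|lborel. (g x \<bullet> b) * \<psi> x))"
    using basis by (intro sum.cong) auto
  also have "\<dots> = - (LINT x|lborel. (\<Sum>b\<in>Basis. (k \<bullet> b) * ((g x \<bullet> b) * \<psi> x)))"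
    using ig' by (simp add: sum_negf)
  also have "(\<lambda>x. \<Sum>b\<in>Basis. (k \<bullet> b) * ((g x \<bullet> b) * \<psi> x)) = (\<lambda>x. (g x \<bullet> k) * \<psi> x)"
    by (intro ext, subst euclidean_inner[of "g _" k]) (simp add: sum_distrib_left sum_distrib_right ac_simps)
  finally show ?thesis .
qed

lemma g_shift_measurable [measurable]:
  "(\<lambda>(x, s). g (x + s *\<^sub>R h) \<bullet> k) \<in> borel_measurable (borel \<Otimes>\<^sub>M (borel :: real measure))"
  using measurable_compose[of "\<lambda>(x, s). x + s *\<^sub>R h" "borel \<Otimes>\<^sub>M (borel :: real measure)" borel "\<lambda>x. g x \<bullet> k" borel]
  by (simp add: case_prod_beta')

text \<open>The increment is moved onto the test function, where the fundamental theorem of calculus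
  applies. For each \<open>s\<close> the translate of \<open>\<phi>\<close> by
  \<open>s *\<^sub>R h\<close> is a test function in \<open>\<Omega>\<close>, so the definition of
  the weak gradient moves the derivative back to \<open>f\<close>.\<close>

lemma increment_test:
  assumes \<phi>: "test_function U \<phi>" and U: "\<And>x s. x \<in> U \<Longrightarrow> s \<in> {0..1} \<Longrightarrow> x + s *\<^sub>R h \<in> \<Omega>"
  shows "(LINT x|lborel. f x * (\<phi> (x - h) - \<phi> x)) = (LINT x|lborel. \<phi> x * (LINT s|lborel. (g (x + s *\<^sub>R h) \<bullet> h) * indicator {0..1} s))"
proof -
  let ?D = "\<lambda>x s. frechet_derivative \<phi> (at (x + s *\<^sub>R (- h))) (- h)"
  note [measurable] = test_function_borel[OF \<phi>] derivative_shift_measurable[OF \<phi>, of "- h" "- h"]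
  obtain C where C: "C \<ge> 0" "\<And>x. \<bar>frechet_derivative \<phi> (at x) (- h)\<bar> \<le> C" using test_function_bounded(2)[OF \<phi>] by blast
  obtain C' where C': "C' \<ge> 0" "\<And>x. \<bar>\<phi> x\<bar> \<le> C'" using test_function_bounded(1)[OF \<phi>] by blast
  have fD: "integrable lborel (\<lambda>x. f x * ?D x s)" for s
  proof (rule integrable_bounded_mult[OF integrable_f])
    show "(\<lambda>x. ?D x s) \<in> borel_measurable borel"
      by (rule borel_measurable_shift[OF test_function_borel(2)[OF \<phi>]])
  qed (rule C)
  have "(LINT x|lborel. f x * (\<phi> (x - h) - \<phi> x)) = (LINT x|lborel. LINT s|lborel. (f x * ?D x s) * indicator {0..1} s)"
    using increment_eq_integral[OF \<phi>, of _ "- h"] by (simp add: mult.assoc)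
  also have "\<dots> = (LINT s|lborel. (LINT x|lborel. f x * ?D x s) * indicator {0..1} s)"
  proof (rule Fubini_unit_interval(1)[where C = "LINT x|lborel. C * \<bar>f x\<bar>"])
    show "(\<lambda>(x, s). f x * ?D x s) \<in> borel_measurable (borel \<Otimes>\<^sub>M borel)" by measurable
    show "integrable lborel (\<lambda>x. f x * ?D x s)" for s by (rule fD)
    show "(LINT x|lborel. \<bar>f x * ?D x s\<bar>) \<le> (LINT x|lborel. C * \<bar>f x\<bar>)" for s
    proof (rule integral_mono)
      show "integrable lborel (\<lambda>x. \<bar>f x * ?D x s\<bar>)" by (rule integrable_abs[OF fD])
      show "integrable lborel (\<lambda>x. C * \<bar>f x\<bar>)" by (intro integrable_mult_right integrable_abs integrable_f)
      show "\<bar>f x * ?D x s\<bar> \<le> C * \<bar>f x\<bar>" for x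
        using mult_right_mono[OF C(2), of "\<bar>f x\<bar>"] by (simp add: abs_mult mult.commute)
    qed
  qed
  also have "\<dots> = (LINT s|lborel. (LINT x|lborel. \<phi> x * (g (x + s *\<^sub>R h) \<bullet> h)) * indicator {0..1} s)"
  proof (intro Bochner_Integration.integral_cong refl)
    fix s :: real
    have "(LINT x|lborel. f x * ?D x s) = (LINT x|lborel. \<phi> x * (g (x + s *\<^sub>R h) \<bullet> h))" if s: "s \<in> {0..1}"
    proof -
      have test: "test_function \<Omega> (\<lambda>x. \<phi> (x - s *\<^sub>R h))"
        by (rule test_function_shift[OF \<phi>]) (use U[OF _ s] in \<open>simp add: add.commute\<close>)
      have "?D x s = frechet_derivative (\<lambda>x. \<phi> (x - s *\<^sub>R h)) (at x) (- h)" for x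
        using frechet_derivative_shift(1)[of \<phi> "s *\<^sub>R h" x] test_functionD(1)[OF \<phi>, of "Suc 0"] by simp
      then have "(LINT x|lborel. f x * ?D x s) = - (LINT x|lborel. (g x \<bullet> (- h)) * \<phi> (x - s *\<^sub>R h))"
        using weak_direction[OF test, of "- h"] by simp
      also have "\<dots> = (LINT x|lborel. \<phi> (x - s *\<^sub>R h) * (g x \<bullet> h))" by (simp add: mult.commute)
      also have "\<dots> = (LINT x|lborel. \<phi> (x + s *\<^sub>R h - s *\<^sub>R h) * (g (x + s *\<^sub>R h) \<bullet> h))"
        by (rule integral_lborel_shift[symmetric]) measurable
      finally show ?thesis by simp
    qed
    then show "(LINT x|lborel. f x * ?D x s) * indicator {0..1} s = (LINT x|lborel. \<phi> x * (g (x + s *\<^sub>R h) \<bullet> h)) * indicator {0..1} s"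
      by (auto simp: indicator_def)
  qed
  also have "\<dots> = (LINT x|lborel. LINT s|lborel. (\<phi> x * (g (x + s *\<^sub>R h) \<bullet> h)) * indicator {0..1} s)"
  proof (rule Fubini_unit_interval(1)[symmetric, where C = "LINT x|lborel. C' * \<bar>g x \<bullet> h\<bar>"])
    show "(\<lambda>(x, s). \<phi> x * (g (x + s *\<^sub>R h) \<bullet> h)) \<in> borel_measurable (borel \<Otimes>\<^sub>M borel)" by measurable
    have gs: "integrable lborel (\<lambda>x. g (x + s *\<^sub>R h) \<bullet> h)" for s
      by (rule integrable_lborel_shift[OF integrable_g])
    show i: "integrable lborel (\<lambda>x. \<phi> x * (g (x + s *\<^sub>R h) \<bullet> h))" for s
      using integrable_bounded_mult[OF gs test_function_borel(1)[OF \<phi>] C'(2)] by (simp add: mult.commute)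
    show "(LINT x|lborel. \<bar>\<phi> x * (g (x + s *\<^sub>R h) \<bullet> h)\<bar>) \<le> (LINT x|lborel. C' * \<bar>g x \<bullet> h\<bar>)" for s
    proof -
      have "(LINT x|lborel. \<bar>\<phi> x * (g (x + s *\<^sub>R h) \<bullet> h)\<bar>) \<le> (LINT x|lborel. C' * \<bar>g (x + s *\<^sub>R h) \<bullet> h\<bar>)"
      proof (rule integral_mono)
        show "integrable lborel (\<lambda>x. \<bar>\<phi> x * (g (x + s *\<^sub>R h) \<bullet> h)\<bar>)" by (rule integrable_abs[OF i])
        show "integrable lborel (\<lambda>x. C' * \<bar>g (x + s *\<^sub>R h) \<bullet> h\<bar>)" by (intro integrable_mult_right integrable_abs gs)
        show "\<bar>\<phi> x * (g (x + s *\<^sub>R h) \<bullet> h)\<bar> \<le> C' * \<bar>g (x + s *\<^sub>R h) \<bullet> h\<bar>" for x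
          using mult_right_mono[OF C'(2), of "\<bar>g (x + s *\<^sub>R h) \<bullet> h\<bar>"] by (simp add: abs_mult)
      qed
      also have "\<dots> = (LINT x|lborel. C' * \<bar>g x \<bullet> h\<bar>)" by (rule integral_lborel_shift) measurable
      finally show ?thesis .
    qed
  qed
  finally show ?thesis by (simp add: mult.assoc)
qed

text \<open>The fundamental theorem of calculus along a fixed displacement. By
  \<open>increment_test\<close> the difference of the two sides integrates to 0 against every cutoff
  of a box of admissible points; dominated convergence replaces the cutoffs by indicators, and
  \<open>AE_zero_on_open\<close> concludes.\<close>

lemma increment_AE:
  "AE x in lborel. (\<forall>s\<in>{0..1}. x + s *\<^sub>R h \<in> \<Omega>) \<longrightarrow>
     f (x + h) - f x = (LINT s|lborel. (g (x + s *\<^sub>R h) \<bullet> h) * indicator {0..1} s)"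
proof -
  define U where "U = {x. \<forall>s\<in>{0..1}. x + s *\<^sub>R h \<in> \<Omega>}"
  define P where "P x = (LINT s|lborel. (g (x + s *\<^sub>R h) \<bullet> h) * indicator {0..1} s)" for x
  define F where "F x = f (x + h) - f x - P x" for x
  have iP: "integrable lborel P" unfolding P_def
  proof (rule Fubini_unit_interval(2)[where C = "LINT x|lborel. \<bar>g x \<bullet> h\<bar>"])
    show "integrable lborel (\<lambda>x. g (x + s *\<^sub>R h) \<bullet> h)" for s
      by (rule integrable_lborel_shift[OF integrable_g])
    show "(LINT x|lborel. \<bar>g (x + s *\<^sub>R h) \<bullet> h\<bar>) \<le> (LINT x|lborel. \<bar>g x \<bullet> h\<bar>)" for s
      using integral_lborel_shift[of "\<lambda>x. \<bar>g x \<bullet> h\<bar>" "s *\<^sub>R h"] by simp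
  qed (rule g_shift_measurable)
  have [measurable]: "P \<in> borel_measurable borel" using iP by auto
  have ifh: "integrable lborel (\<lambda>x. f (x + h))" by (rule integrable_lborel_shift[OF integrable_f])
  have iF: "integrable lborel F" unfolding F_def
    by (intro Bochner_Integration.integrable_diff ifh integrable_f iP)
  have [measurable]: "F \<in> borel_measurable borel" using iF by auto
  have "AE x in lborel. x \<in> U \<longrightarrow> F x = 0"
  proof (rule AE_zero_on_open[OF iF])
    show "open U" unfolding U_def by (rule open_segments_inside[OF open_dom])
    fix a b assume ab: "cbox a b \<subseteq> U"
    have zero: "(LINT x|lborel. cutoff a b m x * F x) = 0" for m
    proof -
      have \<phi>: "test_function U (cutoff a b m)" by (rule test_function_cutoff[OF ab])
      note [measurable] = test_function_borel(1)[OF \<phi>]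
      have C: "\<bar>cutoff a b m x\<bar> \<le> 1" "\<bar>cutoff a b m (x - h)\<bar> \<le> 1" for x
        by (simp_all add: cutoff_range abs_of_nonneg)
      have i: "integrable lborel (\<lambda>x. f (x + h) * cutoff a b m x)" "integrable lborel (\<lambda>x. f x * cutoff a b m x)"
        "integrable lborel (\<lambda>x. P x * cutoff a b m x)" "integrable lborel (\<lambda>x. f x * cutoff a b m (x - h))"
        by (rule integrable_bounded_mult[where C = 1]; (rule ifh integrable_f iP C | measurable))+
      have "(LINT x|lborel. f (x + h) * cutoff a b m x) = (LINT x|lborel. f (x + h) * cutoff a b m (x + h - h))" by simp
      also have "\<dots> = (LINT x|lborel. f x * cutoff a b m (x - h))" by (rule integral_lborel_shift) measurable
      finally have "(LINT x|lborel. f (x + h) * cutoff a b m x) - (LINT x|lborel. f x * cutoff a b m x)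
          = (LINT x|lborel. f x * (cutoff a b m (x - h) - cutoff a b m x))"
        using i by (simp add: right_diff_distrib)
      also have "\<dots> = (LINT x|lborel. P x * cutoff a b m x)"
        using increment_test[OF \<phi>, of h] by (simp add: U_def P_def mult.commute)
      finally show ?thesis using i by (simp add: F_def algebra_simps)
    qed
    have "(\<lambda>m. LINT x|lborel. cutoff a b m x * F x) \<longlonglongrightarrow> (LINT x|lborel. indicator (box a b) x * F x)"
    proof (rule integral_dominated_convergence[where w = "\<lambda>x. \<bar>F x\<bar>"])
      show "integrable lborel (\<lambda>x. \<bar>F x\<bar>)" using iF by (rule integrable_abs)
      show "AE x in lborel. (\<lambda>m. cutoff a b m x * F x) \<longlonglongrightarrow> indicator (box a b) x * F x"
        by (intro AE_I2 tendsto_mult cutoff_tendsto tendsto_const)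
      show "AE x in lborel. norm (cutoff a b m x * F x) \<le> \<bar>F x\<bar>" for m
        using cutoff_range[of a b m] by (intro AE_I2) (simp add: abs_mult mult_left_le_one_le)
      have "cutoff a b m \<in> borel_measurable borel" for m
        by (rule borel_measurable_continuous_onI[OF class_C_continuous[OF smooth_class_C[OF smooth_cutoff]]])
      then show "(\<lambda>x. cutoff a b m x * F x) \<in> borel_measurable lborel" for m by measurable
    qed measurable
    then show "(LINT x|lborel. indicator (box a b) x * F x) = 0" unfolding zero by (simp add: LIMSEQ_const_iff)
  qed
  then show ?thesis unfolding U_def F_def P_def by eventually_elim auto
qed

text \<open>Cauchy-Schwarz on the unit interval bounds the squared increment by an integral along
  the segment. After exchanging the integrals, translation invariance makes the contribution of
  every \<open>s\<close> the same.\<close>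

lemma translation_bound:
  assumes K: "\<And>x s. x \<in> K \<Longrightarrow> s \<in> {0..1} \<Longrightarrow> x + s *\<^sub>R h \<in> \<Omega>"
  shows "(\<integral>\<^sup>+x. indicator K x * ennreal ((f (x + h) - f x)\<^sup>2) \<partial>lborel)
    \<le> ennreal ((norm h)\<^sup>2) * (\<integral>\<^sup>+x. ennreal ((norm (g x))\<^sup>2) \<partial>lborel)"
proof -
  have "(\<integral>\<^sup>+x. indicator K x * ennreal ((f (x + h) - f x)\<^sup>2) \<partial>lborel)
     \<le> (\<integral>\<^sup>+x. (\<integral>\<^sup>+s. ennreal ((g (x + s *\<^sub>R h) \<bullet> h)\<^sup>2) * indicator {0..1} s \<partial>lborel) \<partial>lborel)"
  proof (rule nn_integral_mono_AE)
    show "AE x in lborel. indicator K x * ennreal ((f (x + h) - f x)\<^sup>2)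
        \<le> (\<integral>\<^sup>+s. ennreal ((g (x + s *\<^sub>R h) \<bullet> h)\<^sup>2) * indicator {0..1} s \<partial>lborel)"
      using increment_AE[of h]
    proof eventually_elim
      case (elim x)
      show ?case
      proof (cases "x \<in> K")
        case True
        then have "f (x + h) - f x = (LINT s|lborel. (g (x + s *\<^sub>R h) \<bullet> h) * indicator {0..1} s)"
          using elim K by blast
        moreover have "(\<lambda>s. g (x + s *\<^sub>R h) \<bullet> h) \<in> borel_measurable borel" by measurable
        ultimately show ?thesis
          using square_integral_le[of "\<lambda>s. g (x + s *\<^sub>R h) \<bullet> h" lborel "{0..1}"] True by simp
      qed simp
    qed
  qed
  also have "\<dots> = (\<integral>\<^sup>+s. (\<integral>\<^sup>+x. ennreal ((g (x + s *\<^sub>R h) \<bullet> h)\<^sup>2) * indicator {0..1} s \<partial>lborel) \<partial>lborel)"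
    by (rule lborel_pair.Fubini') measurable
  also have "\<dots> \<le> (\<integral>\<^sup>+s. ennreal ((norm h)\<^sup>2) * (\<integral>\<^sup>+x. ennreal ((norm (g x))\<^sup>2) \<partial>lborel) * indicator {0..1::real} s \<partial>lborel)"
  proof (rule nn_integral_mono)
    fix s :: real
    have "(\<integral>\<^sup>+x. ennreal ((g (x + s *\<^sub>R h) \<bullet> h)\<^sup>2) * indicator {0..1} s \<partial>lborel)
       = (\<integral>\<^sup>+x. ennreal ((g (x + s *\<^sub>R h) \<bullet> h)\<^sup>2) \<partial>lborel) * indicator {0..1} s"
      by (rule nn_integral_multc) measurable
    also have "(\<integral>\<^sup>+x. ennreal ((g (x + s *\<^sub>R h) \<bullet> h)\<^sup>2) \<partial>lborel) = (\<integral>\<^sup>+x. ennreal ((g x \<bullet> h)\<^sup>2) \<partial>lborel)"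
      by (rule nn_integral_lborel_shift) measurable
    also have "\<dots> \<le> (\<integral>\<^sup>+x. ennreal ((norm h)\<^sup>2) * ennreal ((norm (g x))\<^sup>2) \<partial>lborel)"
    proof (rule nn_integral_mono)
      fix x
      have "(g x \<bullet> h)\<^sup>2 \<le> (norm h)\<^sup>2 * (norm (g x))\<^sup>2"
        using power_mono[OF Cauchy_Schwarz_ineq2[of "g x" h], of 2] by (simp add: power_mult_distrib mult.commute)
      then show "ennreal ((g x \<bullet> h)\<^sup>2) \<le> ennreal ((norm h)\<^sup>2) * ennreal ((norm (g x))\<^sup>2)"
        by (simp add: ennreal_leI flip: ennreal_mult)
    qed
    also have "\<dots> = ennreal ((norm h)\<^sup>2) * (\<integral>\<^sup>+x. ennreal ((norm (g x))\<^sup>2) \<partial>lborel)"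
      by (rule nn_integral_cmult) measurable
    finally show "(\<integral>\<^sup>+x. ennreal ((g (x + s *\<^sub>R h) \<bullet> h)\<^sup>2) * indicator {0..1} s \<partial>lborel)
       \<le> ennreal ((norm h)\<^sup>2) * (\<integral>\<^sup>+x. ennreal ((norm (g x))\<^sup>2) \<partial>lborel) * indicator {0..1} s"
      by (simp add: mult_right_mono)
  qed
  also have "\<dots> = ennreal ((norm h)\<^sup>2) * (\<integral>\<^sup>+x. ennreal ((norm (g x))\<^sup>2) \<partial>lborel)"
    by (subst nn_integral_cmult) simp_all
  finally show ?thesis .
qed

end

section \<open>Local Poincare inequality and functions with zero gradient\<close>

lemma ennreal_square_add_le: "ennreal ((a + b)\<^sup>2) \<le> 2 * ennreal (a\<^sup>2) + 2 * ennreal (b\<^sup>2)"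
proof -
  have "0 \<le> (a - b)\<^sup>2" by simp
  then have "(a + b)\<^sup>2 \<le> 2 * a\<^sup>2 + 2 * b\<^sup>2" unfolding power2_sum power2_diff by linarith
  then have "ennreal ((a + b)\<^sup>2) \<le> ennreal (2 * a\<^sup>2 + 2 * b\<^sup>2)" by (rule ennreal_leI)
  also have "\<dots> = 2 * ennreal (a\<^sup>2) + 2 * ennreal (b\<^sup>2)" by (simp add: ennreal_plus ennreal_mult)
  finally show ?thesis .
qed

context H1_borel
begin

text \<open>Cauchy-Schwarz for the average over the ball. Two points of a ball of radius
  \<open>d\<close> differ by some \<open>v\<close> shorter than \<open>2 * d\<close>; integrating
  over all such \<open>v\<close> makes the domain of integration independent of \<open>x\<close>,
  ready for an exchange of integrals.\<close>

lemma mean_deviation: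
  assumes x: "x \<in> ball p d" and d: "d > 0"
  defines "\<beta> \<equiv> measure lborel (ball p d)"
  shows "ennreal ((f x - (LINT y|lborel. f y * indicator (ball p d) y) / \<beta>)\<^sup>2)
    \<le> ennreal (1 / \<beta>) * (\<integral>\<^sup>+v. ennreal ((f (x + v) - f x)\<^sup>2) * indicator (ball 0 (2 * d)) v \<partial>lborel)"
proof -
  let ?B = "ball p d"
  have \<beta>: "\<beta> > 0" unfolding \<beta>_def using content_ball_pos[OF d] by simp
  have fin: "emeasure lborel ?B < \<infinity>" using emeasure_lborel_ball_finite[of p d] by simp
  have iB: "integrable lborel (\<lambda>y. f y * indicator ?B y)"
    using integrable_mult_indicator[of ?B lborel f] integrable_f by (simp add: mult.commute)
  have iI: "integrable lborel (indicator ?B :: 'a \<Rightarrow> real)" using fin by simp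
  define J where "J = (LINT y|lborel. f y * indicator ?B y)"
  have "(LINT y|lborel. (f y - f x) * indicator ?B y) = (LINT y|lborel. f y * indicator ?B y - f x * indicator ?B y)"
    by (simp add: left_diff_distrib)
  also have "\<dots> = J - f x * \<beta>"
    using iB iI by (simp add: \<beta>_def J_def)
  finally have eqJ: "(LINT y|lborel. (f y - f x) * indicator ?B y) = J - f x * \<beta>" .
  have "f x - J / \<beta> = - (1 / \<beta>) * (J - f x * \<beta>)" using \<beta> by (simp add: field_simps)
  then have "(f x - J / \<beta>)\<^sup>2 = (1 / \<beta>\<^sup>2) * (J - f x * \<beta>)\<^sup>2"
    by (simp only: power_mult_distrib) (simp add: power_divide)
  then have sq: "(f x - (LINT y|lborel. f y * indicator ?B y) / \<beta>)\<^sup>2 = (1 / \<beta>\<^sup>2) * (LINT y|lborel. (f y - f x) * indicator ?B y)\<^sup>2"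
    unfolding eqJ J_def .
  have "ennreal ((f x - (LINT y|lborel. f y * indicator ?B y) / \<beta>)\<^sup>2)
      = ennreal (1 / \<beta>\<^sup>2) * ennreal ((LINT y|lborel. (f y - f x) * indicator ?B y)\<^sup>2)"
    unfolding sq by (rule ennreal_mult) simp_all
  also have "\<dots> \<le> ennreal (1 / \<beta>\<^sup>2) * (ennreal \<beta> * (\<integral>\<^sup>+y. ennreal ((f y - f x)\<^sup>2) * indicator ?B y \<partial>lborel))"
    unfolding \<beta>_def by (intro mult_left_mono square_integral_le fin) auto
  also have "\<dots> = ennreal (1 / \<beta>) * (\<integral>\<^sup>+y. ennreal ((f y - f x)\<^sup>2) * indicator ?B y \<partial>lborel)"
  proof -
    have "ennreal (1 / \<beta>\<^sup>2) * ennreal \<beta> = ennreal (1 / \<beta>)"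
      using \<beta> by (subst ennreal_mult[symmetric]) (auto simp: power2_eq_square)
    then show ?thesis by (simp only: mult.assoc[symmetric])
  qed
  also have "(\<integral>\<^sup>+y. ennreal ((f y - f x)\<^sup>2) * indicator ?B y \<partial>lborel)
      = (\<integral>\<^sup>+v. ennreal ((f (v + x) - f x)\<^sup>2) * indicator ?B (v + x) \<partial>lborel)"
  proof (rule nn_integral_lborel_shift[symmetric])
    have [measurable]: "?B \<in> sets borel" by simp
    show "(\<lambda>y. ennreal ((f y - f x)\<^sup>2) * indicator ?B y) \<in> borel_measurable borel" by measurable
  qed
  also have "\<dots> \<le> (\<integral>\<^sup>+v. ennreal ((f (x + v) - f x)\<^sup>2) * indicator (ball 0 (2 * d)) v \<partial>lborel)"
  proof (rule nn_integral_mono)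
    fix v
    have "v \<in> ball 0 (2 * d)" if "v + x \<in> ?B"
    proof -
      have "norm v \<le> dist p (v + x) + dist p x"
        using dist_triangle2[of "v + x" x p] by (simp add: dist_norm norm_minus_commute)
      then show ?thesis using that x by simp
    qed
    then show "ennreal ((f (v + x) - f x)\<^sup>2) * indicator ?B (v + x) \<le> ennreal ((f (x + v) - f x)\<^sup>2) * indicator (ball 0 (2 * d)) v"
      by (auto simp: add.commute indicator_def)
  qed
  finally show ?thesis by (simp add: mult_left_mono)
qed

lemma f_shift_measurable [measurable]: "(\<lambda>(x, v). f (x + v)) \<in> borel_measurable (borel \<Otimes>\<^sub>M borel)"
  using measurable_compose[of "\<lambda>(x, v). x + v" "borel \<Otimes>\<^sub>M borel" borel f borel] by (simp add: case_prod_beta')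

lemma deviation_measurable [measurable]:
  "(\<lambda>x. \<integral>\<^sup>+v. ennreal ((f (x + v) - f x)\<^sup>2) * indicator (ball 0 \<delta>) v \<partial>lborel) \<in> borel_measurable borel"
proof -
  define q :: "'a \<Rightarrow> ennreal" where "q = indicator (ball 0 \<delta>)"
  have [measurable]: "q \<in> borel_measurable borel" unfolding q_def by (rule borel_measurable_indicator) simp
  have "(\<lambda>(x, v). ennreal ((f (x + v) - f x)\<^sup>2) * q v) \<in> borel_measurable (borel \<Otimes>\<^sub>M lborel)"
    by measurable
  then show ?thesis unfolding q_def by (rule lborel.borel_measurable_nn_integral)
qed

text \<open>After exchanging the integrals, \<open>translation_bound\<close> applies for each fixed
  \<open>v\<close>, as the balls of radius \<open>\<delta>\<close> keep the segments from
  \<open>x\<close> to \<open>x + v\<close> in the domain. The factor is the squared length of the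
  shifts times the volume that they fill.\<close>

lemma mean_deviation_integral:
  assumes [measurable]: "K \<in> sets borel" and K: "\<And>x. x \<in> K \<Longrightarrow> ball x \<delta> \<subseteq> \<Omega>" and \<delta>: "\<delta> > 0"
  shows "(\<integral>\<^sup>+x. indicator K x * (\<integral>\<^sup>+v. ennreal ((f (x + v) - f x)\<^sup>2) * indicator (ball 0 \<delta>) v \<partial>lborel) \<partial>lborel)
    \<le> ennreal (\<delta>\<^sup>2 * measure lborel (ball (0::'a) \<delta>)) * (\<integral>\<^sup>+x. ennreal ((norm (g x))\<^sup>2) \<partial>lborel)"
proof -
  let ?G = "\<integral>\<^sup>+x. ennreal ((norm (g x))\<^sup>2) \<partial>lborel"
  define q :: "'a \<Rightarrow> ennreal" where "q = indicator (ball 0 \<delta>)"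
  have [measurable]: "q \<in> borel_measurable borel" unfolding q_def by (rule borel_measurable_indicator) simp
  have "(\<integral>\<^sup>+x. indicator K x * (\<integral>\<^sup>+v. ennreal ((f (x + v) - f x)\<^sup>2) * indicator (ball 0 \<delta>) v \<partial>lborel) \<partial>lborel)
      = (\<integral>\<^sup>+x. (\<integral>\<^sup>+v. indicator K x * (ennreal ((f (x + v) - f x)\<^sup>2) * indicator (ball 0 \<delta>) v) \<partial>lborel) \<partial>lborel)"
    unfolding q_def[symmetric] by (intro nn_integral_cong nn_integral_cmult[symmetric]) measurable
  also have "\<dots> = (\<integral>\<^sup>+v. (\<integral>\<^sup>+x. indicator K x * (ennreal ((f (x + v) - f x)\<^sup>2) * indicator (ball 0 \<delta>) v) \<partial>lborel) \<partial>lborel)"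
    unfolding q_def[symmetric] by (rule lborel_pair.Fubini'[symmetric]) measurable
  also have "\<dots> \<le> (\<integral>\<^sup>+v. ennreal (\<delta>\<^sup>2) * ?G * indicator (ball (0::'a) \<delta>) v \<partial>lborel)"
  proof (rule nn_integral_mono)
    fix v :: 'a
    show "(\<integral>\<^sup>+x. indicator K x * (ennreal ((f (x + v) - f x)\<^sup>2) * indicator (ball 0 \<delta>) v) \<partial>lborel)
        \<le> ennreal (\<delta>\<^sup>2) * ?G * indicator (ball (0::'a) \<delta>) v"
    proof (cases "v \<in> ball 0 \<delta>")
      case True
      have "(\<integral>\<^sup>+x. indicator K x * ennreal ((f (x + v) - f x)\<^sup>2) \<partial>lborel) \<le> ennreal ((norm v)\<^sup>2) * ?G"
      proof (rule translation_bound)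
        fix x s assume "x \<in> K" and s: "s \<in> {0..1::real}"
        have "norm (s *\<^sub>R v) \<le> norm v" using s by (simp add: mult_left_le_one_le)
        then have "x + s *\<^sub>R v \<in> ball x \<delta>" using True by (simp add: dist_norm)
        then show "x + s *\<^sub>R v \<in> \<Omega>" using K[OF \<open>x \<in> K\<close>] by blast
      qed
      also have "\<dots> \<le> ennreal (\<delta>\<^sup>2) * ?G"
        using True by (intro mult_right_mono ennreal_leI power_mono) auto
      finally show ?thesis using True by simp
    qed simp
  qed
  also have "\<dots> = ennreal (\<delta>\<^sup>2) * ?G * emeasure lborel (ball (0::'a) \<delta>)"
    by (rule nn_integral_cmult_indicator) simp
  also have "emeasure lborel (ball (0::'a) \<delta>) = ennreal (measure lborel (ball (0::'a) \<delta>))"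
    using emeasure_lborel_ball_finite[of "0::'a" \<delta>] by (intro emeasure_eq_ennreal_measure) auto
  finally show ?thesis
    unfolding ennreal_mult[OF zero_le_power2 measure_nonneg] by (simp only: mult.assoc mult.commute mult.left_commute)
qed

text \<open>With zero gradient the deviations vanish almost everywhere, so \<open>f\<close> equals
  its average. Radius \<open>3 * d\<close> leaves room for shifts shorter than \<open>2 * d\<close>
  from points of the ball of radius \<open>d\<close>.\<close>

lemma locally_constant:
  assumes zero: "(\<integral>\<^sup>+x. ennreal ((norm (g x))\<^sup>2) \<partial>lborel) = 0" and d: "d > 0" and sub: "ball p (3 * d) \<subseteq> \<Omega>"
  shows "\<exists>c. AE x in lborel. x \<in> ball p d \<longrightarrow> f x = c"
proof -
  let ?I = "\<lambda>x. \<integral>\<^sup>+v. ennreal ((f (x + v) - f x)\<^sup>2) * indicator (ball 0 (2 * d)) v \<partial>lborel"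
  have "ball x (2 * d) \<subseteq> \<Omega>" if "x \<in> ball p d" for x
  proof -
    have "y \<in> ball p (3 * d)" if "y \<in> ball x (2 * d)" for y
      using that \<open>x \<in> ball p d\<close> dist_triangle[of p y x] by simp
    then show ?thesis using sub by blast
  qed
  with mean_deviation_integral[where K = "ball p d" and \<delta> = "2 * d"] d zero
  have z: "(\<integral>\<^sup>+x. indicator (ball p d) x * ?I x \<partial>lborel) = 0" by simp
  have m: "(\<lambda>x. indicator (ball p d) x * ?I x) \<in> borel_measurable lborel"
    unfolding measurable_lborel2
    by (intro borel_measurable_times_ennreal borel_measurable_indicator deviation_measurable) simp
  note ae = nn_integral_0_iff_AE[OF m, THEN iffD1, OF z]
  define c where "c = (LINT y|lborel. f y * indicator (ball p d) y) / measure lborel (ball p d)"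
  from ae have ae_c: "AE x in lborel. x \<in> ball p d \<longrightarrow> f x = c"
  proof eventually_elim
    case (elim x)
    show ?case
    proof
      assume x: "x \<in> ball p d"
      then have "?I x = 0" using elim by simp
      then have "ennreal ((f x - c)\<^sup>2) = 0"
        using mean_deviation[OF x d] by (simp add: c_def)
      then have "(f x - c)\<^sup>2 \<le> 0" by (simp only: ennreal_eq_0_iff)
      then show "f x = c" by simp
    qed
  qed
  show ?thesis by (intro exI[of _ c] ae_c)
qed

text \<open>\<open>L a c\<close> says that \<open>f\<close> equals \<open>c\<close> almost
  everywhere near \<open>a\<close>. Such a \<open>c\<close> is unique because balls have positive
  measure, so sharing it is an equivalence relation; each point shares it with a neighbourhood, and
  a connected set has a single class. Lindelof's theorem leaves countably many exceptional null
  sets.\<close>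

lemma constant_if_gradient_zero:
  assumes zero: "(\<integral>\<^sup>+x. ennreal ((norm (g x))\<^sup>2) \<partial>lborel) = 0" and conn: "connected \<Omega>" and ne: "\<Omega> \<noteq> {}"
  shows "\<exists>c. AE x in lborel. x \<in> \<Omega> \<longrightarrow> f x = c"
proof -
  define C where "C a d c \<longleftrightarrow> (AE x in lborel. x \<in> ball a d \<longrightarrow> f x = c)" for a d c
  define L where "L a c \<longleftrightarrow> (\<exists>d>0. C a d c)" for a c
  have unique: "c = c'" if L: "L a c" "L a c'" for a c c'
  proof (rule ccontr)
    assume neq: "c \<noteq> c'"
    obtain d d' where d: "d > 0" "C a d c" and d': "d' > 0" "C a d' c'" using L unfolding L_def by blast
    define N where "N = ball a (min d d')"
    have "N \<in> sets lborel" by (simp add: N_def)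
    moreover have "AE x in lborel. x \<notin> N" using d(2) d'(2) unfolding C_def N_def
      by eventually_elim (use neq in auto)
    ultimately have "emeasure lborel (ball a (min d d')) = 0"
      using AE_iff_measurable[of N lborel "\<lambda>x. x \<notin> N"] by (simp add: N_def[symmetric])
    moreover have "measure lborel (ball a (min d d')) > 0" using content_ball_pos[of "min d d'" a] d d' by simp
    ultimately show False by (simp add: measure_def)
  qed
  have ex: "\<exists>d>0. \<exists>c. \<forall>b\<in>ball a d. L b c" if a: "a \<in> \<Omega>" for a
  proof -
    obtain e where e: "e > 0" "ball a e \<subseteq> \<Omega>" using open_dom a by (meson open_contains_ball)
    then have "\<exists>c. C a (e / 3) c" unfolding C_def by (intro locally_constant[OF zero]) simp_all
    then obtain c where c: "C a (e / 3) c" by blast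
    have "L b c" if b: "b \<in> ball a (e / 3)" for b
      unfolding L_def
    proof (intro exI conjI)
      show "e / 3 - dist a b > 0" using b by simp
      have sub: "x \<in> ball a (e / 3)" if "x \<in> ball b (e / 3 - dist a b)" for x
        using that dist_triangle[of a x b] by simp
      show "C b (e / 3 - dist a b) c"
        using c unfolding C_def by (rule eventually_mono) (use sub in blast)
    qed
    then show ?thesis using e(1) by (intro exI[of _ "e / 3"] exI[of _ c] conjI ballI) simp_all
  qed
  obtain a where a: "a \<in> \<Omega>" using ne by blast
  obtain c where c: "L a c" using ex[OF a] by (metis centre_in_ball)
  have "\<exists>c. L a c \<and> L b c" if "b \<in> \<Omega>" for b
  proof (rule connected_equivalence_relation[OF conn a that])
    show "\<exists>c. L y c \<and> L x c" if "\<exists>c. L x c \<and> L y c" for x y using that by blast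
    show "\<exists>c. L x c \<and> L z c" if "\<exists>c. L x c \<and> L y c" "\<exists>c. L y c \<and> L z c" for x y z
      using that unique by blast
    fix x assume x: "x \<in> \<Omega>"
    from ex[OF x] obtain d c where d: "d > 0" "\<forall>b\<in>ball x d. L b c" by blast
    show "\<exists>T. openin (top_of_set \<Omega>) T \<and> x \<in> T \<and> (\<forall>y\<in>T. \<exists>c. L x c \<and> L y c)"
    proof (intro exI[of _ "\<Omega> \<inter> ball x d"] conjI ballI)
      show "openin (top_of_set \<Omega>) (\<Omega> \<inter> ball x d)" by (rule openin_open_Int) simp
      show "x \<in> \<Omega> \<inter> ball x d" using x d by simp
      have "x \<in> ball x d" using d by simp
      then show "\<exists>c. L x c \<and> L y c" if "y \<in> \<Omega> \<inter> ball x d" for y using d that by blast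
    qed
  qed
  then have all: "L b c" if "b \<in> \<Omega>" for b using that c unique by blast
  define D where "D = {ball b d | b d. b \<in> \<Omega> \<and> d > 0 \<and> C b d c}"
  have "open S" if "S \<in> D" for S using that unfolding D_def by blast
  then obtain D' where D': "D' \<subseteq> D" "countable D'" "\<Union>D' = \<Union>D" by (rule Lindelof)
  have "AE x in lborel. x \<in> S \<longrightarrow> f x = c" if "S \<in> D'" for S
  proof -
    obtain b d where "S = ball b d" "C b d c" using \<open>S \<in> D'\<close> D'(1) unfolding D_def by blast
    then show ?thesis by (simp only: C_def)
  qed
  then have "AE x in lborel. \<forall>S\<in>D'. x \<in> S \<longrightarrow> f x = c"
    by (subst AE_ball_countable[OF D'(2)]) (intro ballI)
  moreover have "\<Omega> \<subseteq> \<Union>D'"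
  proof
    fix b assume b: "b \<in> \<Omega>"
    then obtain d where d: "d > 0" "C b d c" using all[OF b] unfolding L_def by blast
    then have "ball b d \<in> D" using b unfolding D_def by blast
    moreover have "b \<in> ball b d" using d by simp
    ultimately show "b \<in> \<Union>D'" unfolding D'(3) by blast
  qed
  ultimately have ae: "AE x in lborel. x \<in> \<Omega> \<longrightarrow> f x = c"
    by (elim eventually_mono) blast
  show ?thesis by (intro exI[of _ c] ae)
qed

end

section \<open>Control by finitely many averages\<close>

text \<open>An inequality of Ehrling type. Integrals over the finitely many sets in \<open>Q\<close>
  are bounded linear functionals, which converge along subsequences of bounded sequences; the
  arbitrarily small \<open>e\<close> takes care of the gradient term. This is the quantitative
  content of Rellich compactness.\<close>

definition controlled_by :: "'a::euclidean_space set \<Rightarrow> 'a set \<Rightarrow> real \<Rightarrow> 'a set set \<Rightarrow> real \<Rightarrow> bool" where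
  "controlled_by \<Omega> S e Q C \<longleftrightarrow> finite Q \<and> Q \<subseteq> sets borel \<and> 0 \<le> C \<and> (\<forall>f g. H1_borel \<Omega> f g \<longrightarrow>
     (\<integral>\<^sup>+x. indicator S x * ennreal ((f x)\<^sup>2) \<partial>lborel)
       \<le> ennreal e * (\<integral>\<^sup>+x. ennreal ((norm (g x))\<^sup>2) \<partial>lborel)
         + ennreal C * (\<Sum>B\<in>Q. ennreal ((LINT y|lborel. f y * indicator B y)\<^sup>2)))"

lemma controlled_byD:
  assumes "controlled_by \<Omega> S e Q C"
  shows "finite Q" "Q \<subseteq> sets borel" "0 \<le> C"
    "\<And>f g. H1_borel \<Omega> f g \<Longrightarrow> (\<integral>\<^sup>+x. indicator S x * ennreal ((f x)\<^sup>2) \<partial>lborel)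
       \<le> ennreal e * (\<integral>\<^sup>+x. ennreal ((norm (g x))\<^sup>2) \<partial>lborel)
         + ennreal C * (\<Sum>B\<in>Q. ennreal ((LINT y|lborel. f y * indicator B y)\<^sup>2))"
  using assms unfolding controlled_by_def by simp_all

definition controlled :: "'a::euclidean_space set \<Rightarrow> 'a set \<Rightarrow> bool" where
  "controlled \<Omega> S \<longleftrightarrow> (\<forall>e>0. \<exists>Q C. controlled_by \<Omega> S e Q C)"

lemma controlledI: "(\<And>e. e > 0 \<Longrightarrow> \<exists>Q C. controlled_by \<Omega> S e Q C) \<Longrightarrow> controlled \<Omega> S"
  by (simp add: controlled_def)

lemma controlledE:
  assumes "controlled \<Omega> S" "e > 0"
  obtains Q C where "controlled_by \<Omega> S e Q C"
  using assms unfolding controlled_def by blast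

lemma controlled_empty: "controlled \<Omega> {}"
  by (rule controlledI, intro exI[of _ "{}"] exI[of _ 0]) (simp add: controlled_by_def)

lemma controlled_subset:
  assumes "controlled \<Omega> T" "S \<subseteq> T"
  shows "controlled \<Omega> S"
proof (rule controlledI)
  fix e :: real assume "e > 0"
  from controlledE[OF assms(1) this] obtain Q C where Q: "controlled_by \<Omega> T e Q C" .
  have "(\<integral>\<^sup>+x. indicator S x * ennreal ((f x)\<^sup>2) \<partial>lborel) \<le> (\<integral>\<^sup>+x. indicator T x * ennreal ((f x)\<^sup>2) \<partial>lborel)" for f :: "'a \<Rightarrow> real"
    using assms(2) by (intro nn_integral_mono) (auto simp: indicator_def)
  from order_trans[OF this controlled_byD(4)[OF Q]] have "controlled_by \<Omega> S e Q C"
    using controlled_byD(1-3)[OF Q] by (simp add: controlled_by_def)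
  then show "\<exists>Q C. controlled_by \<Omega> S e Q C" by blast
qed

lemma controlled_Un:
  assumes S: "controlled \<Omega> S" and T: "controlled \<Omega> T" and [measurable]: "S \<in> sets borel" "T \<in> sets borel"
  shows "controlled \<Omega> (S \<union> T)"
proof (rule controlledI)
  fix e :: real assume e: "e > 0"
  let ?F = "\<lambda>f B. ennreal ((LINT y|lborel. f y * indicator B y)\<^sup>2)"
  let ?G = "\<lambda>g. \<integral>\<^sup>+x. ennreal ((norm (g x))\<^sup>2) \<partial>lborel"
  obtain Q C where "controlled_by \<Omega> S (e / 2) Q C" using controlledE[OF S, of "e / 2"] e by auto
  note Q = controlled_byD[OF this]
  obtain Q' C' where "controlled_by \<Omega> T (e / 2) Q' C'" using controlledE[OF T, of "e / 2"] e by auto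
  note Q' = controlled_byD[OF this]
  show "\<exists>Q C. controlled_by \<Omega> (S \<union> T) e Q C"
    unfolding controlled_by_def
  proof (intro exI[of _ "Q \<union> Q'"] exI[of _ "C + C'"] conjI allI impI)
    show "finite (Q \<union> Q')" "Q \<union> Q' \<subseteq> sets borel" "0 \<le> C + C'" using Q Q' by auto
    fix f :: "'a \<Rightarrow> real" and g :: "'a \<Rightarrow> 'a" assume H: "H1_borel \<Omega> f g"
    then have [measurable]: "f \<in> borel_measurable borel" by (simp add: H1_borel_def)
    have "(\<integral>\<^sup>+x. indicator (S \<union> T) x * ennreal ((f x)\<^sup>2) \<partial>lborel)
        \<le> (\<integral>\<^sup>+x. indicator S x * ennreal ((f x)\<^sup>2) + indicator T x * ennreal ((f x)\<^sup>2) \<partial>lborel)"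
      by (intro nn_integral_mono) (auto simp: indicator_def)
    also have "\<dots> = (\<integral>\<^sup>+x. indicator S x * ennreal ((f x)\<^sup>2) \<partial>lborel) + (\<integral>\<^sup>+x. indicator T x * ennreal ((f x)\<^sup>2) \<partial>lborel)"
      by (rule nn_integral_add) measurable
    also have "\<dots> \<le> (ennreal (e / 2) * ?G g + ennreal C * (\<Sum>B\<in>Q. ?F f B)) + (ennreal (e / 2) * ?G g + ennreal C' * (\<Sum>B\<in>Q'. ?F f B))"
      by (intro add_mono Q(4) Q'(4) H)
    also have "\<dots> \<le> (ennreal (e / 2) * ?G g + ennreal C * (\<Sum>B\<in>Q \<union> Q'. ?F f B)) + (ennreal (e / 2) * ?G g + ennreal C' * (\<Sum>B\<in>Q \<union> Q'. ?F f B))"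
      using Q Q' by (intro add_mono mult_left_mono sum_mono2 order_refl) auto
    also have "\<dots> = (ennreal (e / 2) + ennreal (e / 2)) * ?G g + (ennreal C + ennreal C') * (\<Sum>B\<in>Q \<union> Q'. ?F f B)"
      by (simp only: distrib_right add.assoc add.commute add.left_commute)
    also have "ennreal (e / 2) + ennreal (e / 2) = ennreal e" using e by (simp flip: ennreal_plus)
    also have "ennreal C + ennreal C' = ennreal (C + C')" using Q(3) Q'(3) by simp
    finally show "(\<integral>\<^sup>+x. indicator (S \<union> T) x * ennreal ((f x)\<^sup>2) \<partial>lborel) \<le> ennreal e * ?G g + ennreal (C + C') * (\<Sum>B\<in>Q \<union> Q'. ?F f B)" .
  qed
qed

lemma controlled_Union:
  assumes "finite D" "\<And>S. S \<in> D \<Longrightarrow> controlled \<Omega> S \<and> S \<in> sets borel"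
  shows "controlled \<Omega> (\<Union>D) \<and> \<Union>D \<in> sets borel"
  using assms by (induction D rule: finite_induct) (auto intro: controlled_empty controlled_Un)

text \<open>Finitely many balls of radius \<open>d\<close> cover \<open>K\<close>. On each of them
  \<open>f\<close> is its average plus a deviation whose squared integral is of order
  \<open>d\<^sup>2\<close> times that of the gradient, so a small \<open>d\<close> gives a small
  factor.\<close>

lemma controlled_compact:
  fixes \<Omega> :: "'a::euclidean_space set"
  assumes \<Omega>: "open \<Omega>" and K: "compact K" "K \<subseteq> \<Omega>"
  shows "controlled \<Omega> K"
proof (rule controlledI)
  fix e :: real assume e: "e > 0"
  let ?F = "\<lambda>f B. ennreal ((LINT y|lborel. f y * indicator B y)\<^sup>2)"
  let ?G = "\<lambda>g. \<integral>\<^sup>+x. ennreal ((norm (g x))\<^sup>2) \<partial>lborel"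
  let ?N = "2 ^ DIM('a) :: real"
  obtain \<epsilon> where \<epsilon>: "\<epsilon> > 0" "(\<Union>x\<in>K. ball x \<epsilon>) \<subseteq> \<Omega>"
    using compact_subset_open_imp_ball_epsilon_subset[OF K(1) \<Omega> K(2)] by blast
  \<comment> \<open>Doubling the radius multiplies the volume by \<open>?N\<close>, whence the final
    factor \<open>2 * ?N * (2 * d)\<^sup>2\<close>. The bound 1 allows
    \<open>d\<^sup>2 \<le> d\<close>, and half of \<open>\<epsilon>\<close> keeps balls of radius
    \<open>2 * d\<close> around points of \<open>K\<close> inside the domain.\<close>
  define d where "d = min (\<epsilon> / 2) (min 1 (e / (8 * ?N)))"
  have d: "d > 0" "2 * d \<le> \<epsilon>" "d \<le> 1" "d \<le> e / (8 * ?N)" using \<epsilon> e by (auto simp: d_def)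
  have small: "2 * ?N * (2 * d)\<^sup>2 \<le> e"
  proof -
    have "d * d \<le> d * 1" using d by (intro mult_left_mono) auto
    also have "d * 1 \<le> e / (8 * ?N)" using d by simp
    finally have "d\<^sup>2 \<le> e / (8 * ?N)" by (simp only: power2_eq_square)
    then show ?thesis by (simp add: field_simps)
  qed
  define \<beta> where "\<beta> = measure lborel (ball (0::'a) d)"
  have \<beta>: "\<beta> > 0" unfolding \<beta>_def using content_ball_pos[OF d(1), of "0::'a"] by simp
  have \<beta>_ball: "measure lborel (ball p d) = \<beta>" for p :: 'a
    using content_ball_conv_unit_ball[of d p] content_ball_conv_unit_ball[of d "0::'a"] d by (simp add: \<beta>_def)
  have \<beta>2: "measure lborel (ball (0::'a) (2 * d)) = ?N * \<beta>"
    using content_ball_conv_unit_ball[of "2 * d" "0::'a"] content_ball_conv_unit_ball[of d "0::'a"] d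
    by (simp add: \<beta>_def power_mult_distrib)
  obtain P where P: "finite P" "P \<subseteq> K" "K \<subseteq> (\<Union>p\<in>P. ball p d)"
  proof -
    have "K \<subseteq> (\<Union>p\<in>K. ball p d)" using d by auto
    with K(1) show ?thesis using that by (meson compactE_image open_ball)
  qed
  show "\<exists>Q C. controlled_by \<Omega> K e Q C"
    unfolding controlled_by_def
  proof (intro exI[of _ "(\<lambda>p. ball p d) ` P"] exI[of _ "2 / \<beta>"] conjI allI impI)
    show "finite ((\<lambda>p. ball p d) ` P)" "(\<lambda>p. ball p d) ` P \<subseteq> sets borel" "0 \<le> 2 / \<beta>" using P \<beta> by auto
    fix f g assume H: "H1_borel \<Omega> f g"
    interpret H1_borel \<Omega> f g by (rule H)
    define I where "I x = (\<integral>\<^sup>+v. ennreal ((f (x + v) - f x)\<^sup>2) * indicator (ball 0 (2 * d)) v \<partial>lborel)" for x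
    define J where "J p = (LINT y|lborel. f y * indicator (ball p d) y)" for p
    have [measurable]: "I \<in> borel_measurable borel" unfolding I_def by (rule deviation_measurable)
    have Kb [measurable]: "K \<in> sets borel" using K(1) by (simp add: compact_imp_closed borel_closed)
    have bb [measurable]: "(indicator (ball p d) :: 'a \<Rightarrow> ennreal) \<in> borel_measurable borel" for p
      by (rule borel_measurable_indicator) simp
    have pw: "indicator K x * ennreal ((f x)\<^sup>2) \<le> ennreal (2 / \<beta>) * (indicator K x * I x)
        + (\<Sum>p\<in>P. ennreal (2 / \<beta>\<^sup>2) * ennreal ((J p)\<^sup>2) * indicator (ball p d) x)" for x
    proof (cases "x \<in> K")
      case True
      then obtain p where p: "p \<in> P" "x \<in> ball p d" using P by blast
      have "ennreal ((f x)\<^sup>2) = ennreal (((f x - J p / \<beta>) + J p / \<beta>)\<^sup>2)" by simp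
      also have "\<dots> \<le> 2 * ennreal ((f x - J p / \<beta>)\<^sup>2) + 2 * ennreal ((J p / \<beta>)\<^sup>2)" by (rule ennreal_square_add_le)
      also have "\<dots> \<le> 2 * (ennreal (1 / \<beta>) * I x) + 2 * ennreal ((J p / \<beta>)\<^sup>2)"
        using mean_deviation[OF p(2) d(1)] unfolding \<beta>_ball I_def J_def by (intro add_mono mult_left_mono) auto
      also have "2 * ennreal ((J p / \<beta>)\<^sup>2) = ennreal (2 / \<beta>\<^sup>2) * ennreal ((J p)\<^sup>2) * indicator (ball p d) x"
      proof -
        have "2 * ennreal ((J p / \<beta>)\<^sup>2) = ennreal (2 * (J p / \<beta>)\<^sup>2)" by (simp add: ennreal_mult)
        also have "2 * (J p / \<beta>)\<^sup>2 = 2 / \<beta>\<^sup>2 * (J p)\<^sup>2" by (simp add: power_divide)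
        also have "ennreal (2 / \<beta>\<^sup>2 * (J p)\<^sup>2) = ennreal (2 / \<beta>\<^sup>2) * ennreal ((J p)\<^sup>2)" by (rule ennreal_mult) auto
        finally show ?thesis using p(2) by simp
      qed
      also have "\<dots> \<le> (\<Sum>p\<in>P. ennreal (2 / \<beta>\<^sup>2) * ennreal ((J p)\<^sup>2) * indicator (ball p d) x)"
        using p(1) P(1) by (intro member_le_sum) auto
      also have "2 * (ennreal (1 / \<beta>) * I x) = ennreal (2 / \<beta>) * I x"
      proof -
        have "ennreal (2 / \<beta>) = ennreal (2 * (1 / \<beta>))" by simp
        also have "\<dots> = ennreal 2 * ennreal (1 / \<beta>)" using \<beta> by (intro ennreal_mult) auto
        finally show ?thesis by (simp add: mult.assoc)
      qed
      finally show ?thesis using True by (simp add: add_right_mono)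
    qed simp
    have "(\<integral>\<^sup>+x. indicator K x * ennreal ((f x)\<^sup>2) \<partial>lborel)
        \<le> (\<integral>\<^sup>+x. ennreal (2 / \<beta>) * (indicator K x * I x) + (\<Sum>p\<in>P. ennreal (2 / \<beta>\<^sup>2) * ennreal ((J p)\<^sup>2) * indicator (ball p d) x) \<partial>lborel)"
      by (rule nn_integral_mono) (rule pw)
    also have "\<dots> = ennreal (2 / \<beta>) * (\<integral>\<^sup>+x. indicator K x * I x \<partial>lborel)
        + (\<Sum>p\<in>P. ennreal (2 / \<beta>\<^sup>2) * ennreal ((J p)\<^sup>2) * emeasure lborel (ball p d))"
    proof -
      have "(\<integral>\<^sup>+x. ennreal (2 / \<beta>) * (indicator K x * I x) + (\<Sum>p\<in>P. ennreal (2 / \<beta>\<^sup>2) * ennreal ((J p)\<^sup>2) * indicator (ball p d) x) \<partial>lborel)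
        = (\<integral>\<^sup>+x. ennreal (2 / \<beta>) * (indicator K x * I x) \<partial>lborel)
          + (\<integral>\<^sup>+x. (\<Sum>p\<in>P. ennreal (2 / \<beta>\<^sup>2) * ennreal ((J p)\<^sup>2) * indicator (ball p d) x) \<partial>lborel)"
        by (rule nn_integral_add) measurable
      also have "(\<integral>\<^sup>+x. ennreal (2 / \<beta>) * (indicator K x * I x) \<partial>lborel) = ennreal (2 / \<beta>) * (\<integral>\<^sup>+x. indicator K x * I x \<partial>lborel)"
        by (rule nn_integral_cmult) measurable
      also have "(\<integral>\<^sup>+x. (\<Sum>p\<in>P. ennreal (2 / \<beta>\<^sup>2) * ennreal ((J p)\<^sup>2) * indicator (ball p d) x) \<partial>lborel)
          = (\<Sum>p\<in>P. \<integral>\<^sup>+x. ennreal (2 / \<beta>\<^sup>2) * ennreal ((J p)\<^sup>2) * indicator (ball p d) x \<partial>lborel)"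
        by (rule nn_integral_sum) measurable
      also have "\<dots> = (\<Sum>p\<in>P. ennreal (2 / \<beta>\<^sup>2) * ennreal ((J p)\<^sup>2) * emeasure lborel (ball p d))"
        by (intro sum.cong refl nn_integral_cmult_indicator) simp
      finally show ?thesis .
    qed
    also have "\<dots> \<le> ennreal e * ?G g + ennreal (2 / \<beta>) * (\<Sum>B\<in>(\<lambda>p. ball p d) ` P. ?F f B)"
    proof (rule add_mono)
      have sub: "ball x (2 * d) \<subseteq> \<Omega>" if "x \<in> K" for x
        using \<epsilon>(2) that subset_ball[OF d(2), of x] by blast
      have "ennreal (2 / \<beta>) * (\<integral>\<^sup>+x. indicator K x * I x \<partial>lborel) \<le> ennreal (2 / \<beta>) * (ennreal ((2 * d)\<^sup>2 * (?N * \<beta>)) * ?G g)"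
        unfolding I_def using mean_deviation_integral[of K "2 * d", OF Kb sub] d(1) by (intro mult_left_mono) (auto simp: \<beta>2)
      also have "\<dots> = ennreal (2 / \<beta> * ((2 * d)\<^sup>2 * (?N * \<beta>))) * ?G g"
        using \<beta> by (subst ennreal_mult) (auto simp: mult.assoc)
      also have "2 / \<beta> * ((2 * d)\<^sup>2 * (?N * \<beta>)) = 2 * ?N * (2 * d)\<^sup>2" using \<beta> by (simp add: field_simps)
      also have "ennreal (2 * ?N * (2 * d)\<^sup>2) * ?G g \<le> ennreal e * ?G g"
        using small by (intro mult_right_mono ennreal_leI) auto
      finally show "ennreal (2 / \<beta>) * (\<integral>\<^sup>+x. indicator K x * I x \<partial>lborel) \<le> ennreal e * ?G g" .
      \<comment> \<open>Distinct centres give distinct balls, so the sum over \<open>P\<close> is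
        the sum over the set of balls.\<close>
      have inj: "inj_on (\<lambda>p. ball p d) P" using d(1) by (auto intro!: inj_onI simp: ball_eq_ball_iff)
      have em: "emeasure lborel (ball p d) = ennreal \<beta>" for p :: 'a
        using emeasure_lborel_ball_finite[of p d] by (subst emeasure_eq_ennreal_measure) (auto simp: \<beta>_ball)
      have "ennreal (2 / \<beta>\<^sup>2) * ennreal ((J p)\<^sup>2) * emeasure lborel (ball p d) = ennreal (2 / \<beta>) * ?F f (ball p d)" for p
      proof -
        have "ennreal (2 / \<beta>\<^sup>2) * ennreal ((J p)\<^sup>2) * ennreal \<beta> = ennreal (2 / \<beta>\<^sup>2 * (J p)\<^sup>2) * ennreal \<beta>"
          by (subst ennreal_mult) auto
        also have "\<dots> = ennreal (2 / \<beta>\<^sup>2 * (J p)\<^sup>2 * \<beta>)"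
          using \<beta> by (intro ennreal_mult[symmetric]) auto
        also have "2 / \<beta>\<^sup>2 * (J p)\<^sup>2 * \<beta> = 2 / \<beta> * (J p)\<^sup>2" using \<beta> by (simp add: power2_eq_square field_simps)
        also have "ennreal (2 / \<beta> * (J p)\<^sup>2) = ennreal (2 / \<beta>) * ennreal ((J p)\<^sup>2)" using \<beta> by (intro ennreal_mult) auto
        finally show ?thesis unfolding em J_def .
      qed
      then show "(\<Sum>p\<in>P. ennreal (2 / \<beta>\<^sup>2) * ennreal ((J p)\<^sup>2) * emeasure lborel (ball p d)) \<le> ennreal (2 / \<beta>) * (\<Sum>B\<in>(\<lambda>p. ball p d) ` P. ?F f B)"
        by (simp add: sum.reindex[OF inj] sum_distrib_left del: sum_ennreal)
    qed
    finally show "(\<integral>\<^sup>+x. indicator K x * ennreal ((f x)\<^sup>2) \<partial>lborel) \<le> ennreal e * ?G g + ennreal (2 / \<beta>) * (\<Sum>B\<in>(\<lambda>p. ball p d) ` P. ?F f B)" .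
  qed
qed

text \<open>Near a boundary point the function is compared with its translate in the direction \<open>e\<close>,
  which only involves values on a compact subset of the domain.\<close>

lemma controlled_boundary:
  fixes \<Omega> :: "'a::euclidean_space set"
  assumes \<Omega>: "open \<Omega>" and r: "r > 0" and e: "norm e = 1" and \<gamma>: "continuous_on UNIV \<gamma>"
    and graph: "\<Omega> \<inter> ball z r = {x \<in> ball z r. \<gamma> (x - (x \<bullet> e) *\<^sub>R e) < x \<bullet> e}"
  shows "controlled \<Omega> (\<Omega> \<inter> ball z (r / 2))"
proof (rule controlledI)
  fix \<delta> :: real assume \<delta>: "\<delta> > 0"
  let ?F = "\<lambda>f B. ennreal ((LINT y|lborel. f y * indicator B y)\<^sup>2)"
  let ?G = "\<lambda>g. \<integral>\<^sup>+x. ennreal ((norm (g x))\<^sup>2) \<partial>lborel"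
  define S where "S = \<Omega> \<inter> ball z (r / 2)"
  \<comment> \<open>A quarter of \<open>r\<close> keeps shifted points of the half ball inside
    \<open>ball z r\<close>. The other bounds give \<open>2 * t\<^sup>2 \<le> \<delta> / 2\<close>;
    the remaining half of \<open>\<delta>\<close> is twice the \<open>\<delta> / 4\<close> spent on
    the compact translate.\<close>
  define t where "t = min (r / 4) (min 1 (\<delta> / 4))"
  have t: "t > 0" "t < r / 2" "t \<le> 1" "t \<le> \<delta> / 4" using r \<delta> by (auto simp: t_def)
  have "t * t \<le> t * 1" using t by (intro mult_left_mono) auto
  also have "t * 1 \<le> \<delta> / 4" using t by simp
  finally have small: "2 * t\<^sup>2 \<le> \<delta> / 2" by (simp add: power2_eq_square)
  have ee: "e \<bullet> e = 1" using e by (simp add: norm_eq_1)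
  have proj: "(x + s *\<^sub>R e) - ((x + s *\<^sub>R e) \<bullet> e) *\<^sub>R e = x - (x \<bullet> e) *\<^sub>R e" for x s
    by (simp add: inner_add_left ee algebra_simps)
  have near: "x + s *\<^sub>R e \<in> ball z r" if "dist z x \<le> r / 2" "0 \<le> s" "s \<le> t" for x s
  proof -
    have "dist z (x + s *\<^sub>R e) \<le> dist z x + dist x (x + s *\<^sub>R e)" by (rule dist_triangle)
    also have "dist x (x + s *\<^sub>R e) = s" using that(2) e by (simp add: dist_norm)
    finally show ?thesis using that t by simp
  qed
  \<comment> \<open>The weak inequality makes this region compact, and the upward shift by
    \<open>t\<close> makes the inequality strict again. So the translate of \<open>T\<close> is a
    compact subset of the domain that contains the translate of \<open>S\<close>.\<close>
  define T where "T = {x \<in> cball z (r / 2). \<gamma> (x - (x \<bullet> e) *\<^sub>R e) \<le> x \<bullet> e}"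
  have "closed T"
  proof -
    have "closed {x. \<gamma> (x - (x \<bullet> e) *\<^sub>R e) \<le> x \<bullet> e}"
      by (intro closed_Collect_le continuous_on_compose2[OF \<gamma>] continuous_intros) auto
    then have "closed (cball z (r / 2) \<inter> {x. \<gamma> (x - (x \<bullet> e) *\<^sub>R e) \<le> x \<bullet> e})" by (intro closed_Int closed_cball)
    moreover have "T = cball z (r / 2) \<inter> {x. \<gamma> (x - (x \<bullet> e) *\<^sub>R e) \<le> x \<bullet> e}" unfolding T_def by blast
    ultimately show ?thesis by (simp only:)
  qed
  moreover have "T \<subseteq> cball z (r / 2)" by (auto simp: T_def)
  ultimately have "compact T" by (meson bounded_cball bounded_subset compact_eq_bounded_closed)
  then have K: "compact ((\<lambda>x. x + t *\<^sub>R e) ` T)" by (intro compact_continuous_image continuous_intros)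
  have KO: "(\<lambda>x. x + t *\<^sub>R e) ` T \<subseteq> \<Omega>"
  proof safe
    fix x assume x: "x \<in> T"
    then have "x + t *\<^sub>R e \<in> ball z r" using t by (intro near) (auto simp: T_def)
    moreover have "\<gamma> ((x + t *\<^sub>R e) - ((x + t *\<^sub>R e) \<bullet> e) *\<^sub>R e) < (x + t *\<^sub>R e) \<bullet> e"
      unfolding proj using x t by (simp add: T_def inner_add_left ee)
    ultimately have "x + t *\<^sub>R e \<in> \<Omega> \<inter> ball z r" unfolding graph by blast
    then show "x + t *\<^sub>R e \<in> \<Omega>" by blast
  qed
  have S: "\<gamma> (x - (x \<bullet> e) *\<^sub>R e) < x \<bullet> e" "dist z x < r / 2" if "x \<in> S" for x
  proof -
    have "x \<in> \<Omega> \<inter> ball z r" using that r by (auto simp: S_def)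
    then show "\<gamma> (x - (x \<bullet> e) *\<^sub>R e) < x \<bullet> e" unfolding graph by blast
    show "dist z x < r / 2" using that by (simp add: S_def)
  qed
  have seg: "x + s *\<^sub>R (t *\<^sub>R e) \<in> \<Omega>" if x: "x \<in> S" and s: "s \<in> {0..1}" for x s
  proof -
    have st: "0 \<le> s * t" "s * t \<le> t" using s t by (auto simp: mult_left_le_one_le)
    have "x + (s * t) *\<^sub>R e \<in> ball z r" using S(2)[OF x] st by (intro near) auto
    moreover have "\<gamma> ((x + (s * t) *\<^sub>R e) - ((x + (s * t) *\<^sub>R e) \<bullet> e) *\<^sub>R e) < (x + (s * t) *\<^sub>R e) \<bullet> e"
      unfolding proj using S(1)[OF x] st by (simp add: inner_add_left ee)
    ultimately have "x + (s * t) *\<^sub>R e \<in> \<Omega> \<inter> ball z r" unfolding graph by blast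
    then show ?thesis by simp
  qed
  obtain Q C where "controlled_by \<Omega> ((\<lambda>x. x + t *\<^sub>R e) ` T) (\<delta> / 4) Q C"
    using controlledE[OF controlled_compact[OF \<Omega> K KO], of "\<delta> / 4"] \<delta> by auto
  note Q = controlled_byD[OF this]
  show "\<exists>Q C. controlled_by \<Omega> (\<Omega> \<inter> ball z (r / 2)) \<delta> Q C"
    unfolding controlled_by_def
  proof (intro exI[of _ Q] exI[of _ "2 * C"] conjI allI impI Q(1,2))
    show "0 \<le> 2 * C" using Q by simp
    fix f g assume H: "H1_borel \<Omega> f g"
    interpret H1_borel \<Omega> f g by (rule H)
    let ?h = "t *\<^sub>R e"
    have Sb: "S \<in> sets borel" unfolding S_def using \<Omega> by auto
    have [measurable]: "(indicator S :: 'a \<Rightarrow> ennreal) \<in> borel_measurable borel"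
      by (rule borel_measurable_indicator[OF Sb])
    have "(\<integral>\<^sup>+x. indicator S x * ennreal ((f x)\<^sup>2) \<partial>lborel)
       \<le> (\<integral>\<^sup>+x. 2 * (indicator S x * ennreal ((f (x + ?h) - f x)\<^sup>2)) + 2 * (indicator S x * ennreal ((f (x + ?h))\<^sup>2)) \<partial>lborel)"
    proof (rule nn_integral_mono)
      fix x
      have "ennreal ((f x)\<^sup>2) = ennreal ((- (f (x + ?h) - f x) + f (x + ?h))\<^sup>2)" by simp
      also have "\<dots> \<le> 2 * ennreal ((- (f (x + ?h) - f x))\<^sup>2) + 2 * ennreal ((f (x + ?h))\<^sup>2)" by (rule ennreal_square_add_le)
      also have "(- (f (x + ?h) - f x))\<^sup>2 = (f (x + ?h) - f x)\<^sup>2" by (rule power2_minus)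
      finally show "indicator S x * ennreal ((f x)\<^sup>2) \<le> 2 * (indicator S x * ennreal ((f (x + ?h) - f x)\<^sup>2)) + 2 * (indicator S x * ennreal ((f (x + ?h))\<^sup>2))"
        by (cases "x \<in> S") auto
    qed
    also have "\<dots> = 2 * (\<integral>\<^sup>+x. indicator S x * ennreal ((f (x + ?h) - f x)\<^sup>2) \<partial>lborel) + 2 * (\<integral>\<^sup>+x. indicator S x * ennreal ((f (x + ?h))\<^sup>2) \<partial>lborel)"
      by (subst nn_integral_add) (simp_all add: nn_integral_cmult)
    also have "\<dots> \<le> 2 * (ennreal ((norm ?h)\<^sup>2) * ?G g) + 2 * (ennreal (\<delta> / 4) * ?G g + ennreal C * (\<Sum>B\<in>Q. ?F f B))"
    proof (intro add_mono mult_left_mono)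
      show "(\<integral>\<^sup>+x. indicator S x * ennreal ((f (x + ?h) - f x)\<^sup>2) \<partial>lborel) \<le> ennreal ((norm ?h)\<^sup>2) * ?G g"
        by (rule translation_bound[OF seg])
      have ST: "x \<in> T" if "x \<in> S" for x using S[OF that] by (auto simp: T_def)
      have [measurable]: "(\<lambda>x. indicator ((\<lambda>x. x + ?h) ` T) x * ennreal ((f x)\<^sup>2)) \<in> borel_measurable borel"
        using K by (intro borel_measurable_times_ennreal borel_measurable_indicator) (auto simp: compact_imp_closed borel_closed)
      have "(\<integral>\<^sup>+x. indicator S x * ennreal ((f (x + ?h))\<^sup>2) \<partial>lborel)
          \<le> (\<integral>\<^sup>+x. indicator ((\<lambda>x. x + ?h) ` T) (x + ?h) * ennreal ((f (x + ?h))\<^sup>2) \<partial>lborel)"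
        using ST by (intro nn_integral_mono) (auto simp: indicator_def)
      also have "\<dots> = (\<integral>\<^sup>+x. indicator ((\<lambda>x. x + ?h) ` T) x * ennreal ((f x)\<^sup>2) \<partial>lborel)"
        by (rule nn_integral_lborel_shift) measurable
      finally show "(\<integral>\<^sup>+x. indicator S x * ennreal ((f (x + ?h))\<^sup>2) \<partial>lborel) \<le> ennreal (\<delta> / 4) * ?G g + ennreal C * (\<Sum>B\<in>Q. ?F f B)"
        using Q(4)[OF H] by (rule order_trans)
    qed auto
    also have "\<dots> = (2 * ennreal (t\<^sup>2) + 2 * ennreal (\<delta> / 4)) * ?G g + (2 * ennreal C) * (\<Sum>B\<in>Q. ?F f B)"
      using e t by (simp add: distrib_left distrib_right mult.assoc add.assoc)
    also have "2 * ennreal C = ennreal (2 * C)" using Q(3) by (simp add: ennreal_mult)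
    also have "2 * ennreal (t\<^sup>2) + 2 * ennreal (\<delta> / 4) = ennreal (2 * t\<^sup>2 + 2 * (\<delta> / 4))"
    proof -
      have two: "ennreal (2 * a) = 2 * ennreal a" if "a \<ge> 0" for a
        using that ennreal_mult[of 2 a] by simp
      show ?thesis using \<delta> by (subst ennreal_plus) (simp_all only: two zero_le_power2, simp_all)
    qed
    also have "ennreal (2 * t\<^sup>2 + 2 * (\<delta> / 4)) * ?G g \<le> ennreal \<delta> * ?G g"
      using small by (intro mult_right_mono ennreal_leI) auto
    finally show "(\<integral>\<^sup>+x. indicator (\<Omega> \<inter> ball z (r / 2)) x * ennreal ((f x)\<^sup>2) \<partial>lborel) \<le> ennreal \<delta> * ?G g + ennreal (2 * C) * (\<Sum>B\<in>Q. ?F f B)"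
      by (simp add: S_def add_right_mono)
  qed
qed

text \<open>The compact closure is covered by finitely many balls: interior points have balls with
  closure in the domain, boundary points have the local graphs.\<close>

lemma controlled_domain:
  fixes \<Omega> :: "'a::euclidean_space set"
  assumes "bounded \<Omega>" "regular_domain \<Omega>"
  shows "controlled \<Omega> \<Omega>"
proof -
  have \<Omega>: "open \<Omega>" "C1_boundary \<Omega>" using assms by (auto simp: regular_domain_def)
  have "\<exists>\<rho>>0. controlled \<Omega> (\<Omega> \<inter> ball z \<rho>)" if z: "z \<in> closure \<Omega>" for z
  proof (cases "z \<in> \<Omega>")
    case True
    then obtain \<rho> where \<rho>: "\<rho> > 0" "cball z \<rho> \<subseteq> \<Omega>" using \<Omega>(1) open_contains_cball by blast
    have "controlled \<Omega> (\<Omega> \<inter> ball z \<rho>)"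
      by (rule controlled_subset[OF controlled_compact[OF \<Omega>(1) compact_cball \<rho>(2)]]) (use ball_subset_cball in blast)
    then show ?thesis using \<rho>(1) by blast
  next
    case False
    then have "z \<in> frontier \<Omega>" using z \<Omega>(1) by (simp add: frontier_def interior_open)
    then obtain r e \<gamma> where b: "r > 0" "norm e = 1" "class_C 1 \<gamma>"
      "\<Omega> \<inter> ball z r = {x \<in> ball z r. \<gamma> (x - (x \<bullet> e) *\<^sub>R e) < x \<bullet> e}"
      using \<Omega>(2) unfolding C1_boundary_def by blast
    from controlled_boundary[OF \<Omega>(1) b(1,2) class_C_continuous[OF b(3)] b(4)] b(1)
    show ?thesis by (intro exI[of _ "r / 2"] conjI) simp_all
  qed
  then obtain \<rho> where \<rho>: "\<And>z. z \<in> closure \<Omega> \<Longrightarrow> \<rho> z > 0" "\<And>z. z \<in> closure \<Omega> \<Longrightarrow> controlled \<Omega> (\<Omega> \<inter> ball z (\<rho> z))" by metis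
  have "compact (closure \<Omega>)" using assms(1) by simp
  moreover have "closure \<Omega> \<subseteq> (\<Union>z\<in>closure \<Omega>. ball z (\<rho> z))" using \<rho>(1) by auto
  ultimately obtain P where P: "P \<subseteq> closure \<Omega>" "finite P" "closure \<Omega> \<subseteq> (\<Union>z\<in>P. ball z (\<rho> z))"
    by (meson compactE_image open_ball)
  have "controlled \<Omega> (\<Union>((\<lambda>z. \<Omega> \<inter> ball z (\<rho> z)) ` P))"
    using P \<rho>(2) \<Omega>(1) by (intro controlled_Union[THEN conjunct1]) auto
  then show ?thesis by (rule controlled_subset) (use P(3) closure_subset[of \<Omega>] in blast)
qed

section \<open>Rellich compactness\<close>

definition L2_inner :: "'a::euclidean_space set \<Rightarrow> ('a \<Rightarrow> 'b::euclidean_space) \<Rightarrow> ('a \<Rightarrow> 'b) \<Rightarrow> real" where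
  "L2_inner \<Omega> f g = (LINT x|lebesgue_on \<Omega>. f x \<bullet> g x)"

abbreviation L2_sq :: "'a::euclidean_space set \<Rightarrow> ('a \<Rightarrow> 'b::euclidean_space) \<Rightarrow> real" where
  "L2_sq \<Omega> f \<equiv> L2_inner \<Omega> f f"

lemma L2_sq_eq: "L2_sq \<Omega> f = (LINT x|lebesgue_on \<Omega>. (norm (f x))\<^sup>2)"
  by (simp add: L2_inner_def power2_norm_eq_inner)

lemma L2_sq_nonneg: "0 \<le> L2_sq \<Omega> f"
  unfolding L2_sq_eq by (intro integral_nonneg_AE) auto

lemma L2_inner_commute: "L2_inner \<Omega> f g = L2_inner \<Omega> g f"
  by (simp add: L2_inner_def inner_commute)

lemma L2_inner_add_left:
  "in_L2 \<Omega> f \<Longrightarrow> in_L2 \<Omega> g \<Longrightarrow> in_L2 \<Omega> h \<Longrightarrow> L2_inner \<Omega> (\<lambda>x. f x + g x) h = L2_inner \<Omega> f h + L2_inner \<Omega> g h"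
  unfolding L2_inner_def inner_add_left by (intro Bochner_Integration.integral_add in_L2_inner_integrable)

lemma L2_inner_add_right:
  "in_L2 \<Omega> f \<Longrightarrow> in_L2 \<Omega> g \<Longrightarrow> in_L2 \<Omega> h \<Longrightarrow> L2_inner \<Omega> h (\<lambda>x. f x + g x) = L2_inner \<Omega> h f + L2_inner \<Omega> h g"
  unfolding L2_inner_def inner_add_right by (intro Bochner_Integration.integral_add in_L2_inner_integrable)

lemma L2_inner_diff_left:
  "in_L2 \<Omega> f \<Longrightarrow> in_L2 \<Omega> g \<Longrightarrow> in_L2 \<Omega> h \<Longrightarrow> L2_inner \<Omega> (\<lambda>x. f x - g x) h = L2_inner \<Omega> f h - L2_inner \<Omega> g h"
  unfolding L2_inner_def inner_diff_left by (intro Bochner_Integration.integral_diff in_L2_inner_integrable)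

lemma L2_inner_diff_right:
  "in_L2 \<Omega> f \<Longrightarrow> in_L2 \<Omega> g \<Longrightarrow> in_L2 \<Omega> h \<Longrightarrow> L2_inner \<Omega> h (\<lambda>x. f x - g x) = L2_inner \<Omega> h f - L2_inner \<Omega> h g"
  unfolding L2_inner_def inner_diff_right by (intro Bochner_Integration.integral_diff in_L2_inner_integrable)

lemma L2_inner_scale_left: "L2_inner \<Omega> (\<lambda>x. c *\<^sub>R f x) g = c * L2_inner \<Omega> f g"
  by (simp add: L2_inner_def)

lemma L2_inner_scale_right: "L2_inner \<Omega> g (\<lambda>x. c *\<^sub>R f x) = c * L2_inner \<Omega> g f"
  by (simp add: L2_inner_def)

lemma L2_sq_add_scaled:
  assumes "in_L2 \<Omega> f" "in_L2 \<Omega> h"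
  shows "L2_sq \<Omega> (\<lambda>x. f x + t *\<^sub>R h x) = L2_sq \<Omega> f + 2 * t * L2_inner \<Omega> f h + t\<^sup>2 * L2_sq \<Omega> h"
proof -
  note s = in_L2_scaleR[OF assms(2), of t] in_L2_add[OF assms(1) in_L2_scaleR[OF assms(2), of t]]
  show ?thesis
    unfolding L2_inner_add_left[OF assms(1) s] L2_inner_add_right[OF assms(1) s(1) assms(1)]
      L2_inner_scale_left L2_inner_add_right[OF assms(1) s(1) assms(2)] L2_inner_scale_right
      L2_inner_commute[of \<Omega> h f] power2_eq_square
    by (simp add: algebra_simps)
qed

lemma L2_sq_diff:
  assumes "in_L2 \<Omega> f" "in_L2 \<Omega> h"
  shows "L2_sq \<Omega> (\<lambda>x. f x - h x) = L2_sq \<Omega> f - 2 * L2_inner \<Omega> f h + L2_sq \<Omega> h"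
  using L2_sq_add_scaled[OF assms, of "-1"] by simp

lemma L2_sq_add:
  assumes "in_L2 \<Omega> f" "in_L2 \<Omega> h"
  shows "L2_sq \<Omega> (\<lambda>x. f x + h x) = L2_sq \<Omega> f + 2 * L2_inner \<Omega> f h + L2_sq \<Omega> h"
  using L2_sq_add_scaled[OF assms, of 1] by simp

lemma L2_inner_sq_le: "in_L2 \<Omega> f \<Longrightarrow> in_L2 \<Omega> g \<Longrightarrow> (L2_inner \<Omega> f g)\<^sup>2 \<le> L2_sq \<Omega> f * L2_sq \<Omega> g"
  using L2_Cauchy_Schwarz[of \<Omega> f g] by (simp only: L2_sq_eq) (simp only: L2_inner_def)

lemma L2_inner_limit:
  assumes "\<And>n. in_L2 \<Omega> (X n)" "in_L2 \<Omega> f" "in_L2 \<Omega> g" "(\<lambda>n. L2_sq \<Omega> (\<lambda>x. X n x - f x)) \<longlonglongrightarrow> 0"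
  shows "(\<lambda>n. L2_inner \<Omega> (X n) g) \<longlonglongrightarrow> L2_inner \<Omega> f g"
  using L2_inner_tendsto[OF assms(1-3)] assms(4) unfolding L2_sq_eq unfolding L2_inner_def by simp

lemma L2_sq_limit:
  assumes X: "\<And>n. in_L2 \<Omega> (X n)" and f: "in_L2 \<Omega> f" and lim: "(\<lambda>n. L2_sq \<Omega> (\<lambda>x. X n x - f x)) \<longlonglongrightarrow> 0"
  shows "(\<lambda>n. L2_sq \<Omega> (X n)) \<longlonglongrightarrow> L2_sq \<Omega> f"
proof -
  have "(\<lambda>n. L2_sq \<Omega> (\<lambda>x. X n x - f x) + 2 * L2_inner \<Omega> (X n) f - L2_sq \<Omega> f) \<longlonglongrightarrow> 0 + 2 * L2_sq \<Omega> f - L2_sq \<Omega> f"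
    by (intro tendsto_intros lim L2_inner_limit[OF X f f lim])
  then show ?thesis by (simp add: L2_sq_diff[OF X f])
qed

definition L2_Cauchy :: "'a::euclidean_space set \<Rightarrow> (nat \<Rightarrow> 'a \<Rightarrow> 'b::euclidean_space) \<Rightarrow> bool" where
  "L2_Cauchy \<Omega> X \<longleftrightarrow> (\<forall>e>0. \<exists>M. \<forall>m\<ge>M. \<forall>n\<ge>M. L2_sq \<Omega> (\<lambda>x. X m x - X n x) < e)"

lemma L2_Cauchy_convergent:
  assumes "\<And>n. in_L2 \<Omega> (X n)" "L2_Cauchy \<Omega> X"
  obtains f where "in_L2 \<Omega> f" "(\<lambda>n. L2_sq \<Omega> (\<lambda>x. X n x - f x)) \<longlonglongrightarrow> 0"
proof -
  have "\<exists>f. in_L2 \<Omega> f \<and> (\<lambda>n. LINT x|lebesgue_on \<Omega>. (norm (X n x - f x))\<^sup>2) \<longlonglongrightarrow> 0"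
  proof (rule L2_complete[OF assms(1)])
    fix e :: real assume "e > 0"
    from assms(2)[unfolded L2_Cauchy_def L2_sq_eq, rule_format, OF this]
    show "\<exists>M. \<forall>m\<ge>M. \<forall>n\<ge>M. (LINT x|lebesgue_on \<Omega>. (norm (X m x - X n x))\<^sup>2) < e" .
  qed
  then obtain f where "in_L2 \<Omega> f" "(\<lambda>n. LINT x|lebesgue_on \<Omega>. (norm (X n x - f x))\<^sup>2) \<longlonglongrightarrow> 0" by blast
  then show ?thesis by (intro that[of f]) (simp_all only: L2_sq_eq)
qed

lemma H1_gradient_L2: "H1_gradient \<Omega> f g \<Longrightarrow> in_L2 \<Omega> f" "H1_gradient \<Omega> f g \<Longrightarrow> in_L2 \<Omega> g"
  by (auto simp: H1_gradient_def)

lemma H1_complete: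
  assumes \<Omega>: "\<Omega> \<in> lmeasurable" and X: "\<And>n. H1_gradient \<Omega> (f n) (g n)" and c: "L2_Cauchy \<Omega> f" "L2_Cauchy \<Omega> g"
  obtains f' g' where "H1_gradient \<Omega> f' g'" "(\<lambda>n. L2_sq \<Omega> (\<lambda>x. f n x - f' x)) \<longlonglongrightarrow> 0"
    "(\<lambda>n. L2_sq \<Omega> (\<lambda>x. g n x - g' x)) \<longlonglongrightarrow> 0"
proof -
  obtain f' where f': "in_L2 \<Omega> f'" "(\<lambda>n. L2_sq \<Omega> (\<lambda>x. f n x - f' x)) \<longlonglongrightarrow> 0"
    by (rule L2_Cauchy_convergent[OF H1_gradient_L2(1)[OF X] c(1)])
  obtain g' where g': "in_L2 \<Omega> g'" "(\<lambda>n. L2_sq \<Omega> (\<lambda>x. g n x - g' x)) \<longlonglongrightarrow> 0"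
    by (rule L2_Cauchy_convergent[OF H1_gradient_L2(2)[OF X] c(2)])
  have "H1_gradient \<Omega> f' g'"
    by (rule H1_gradient_limit[OF \<Omega> X f'(1) g'(1) f'(2)[unfolded L2_sq_eq] g'(2)[unfolded L2_sq_eq]])
  then show ?thesis using that f'(2) g'(2) by blast
qed

lemma H1_borel_transfer:
  assumes "open \<Omega>" "bounded \<Omega>" and H: "H1_gradient \<Omega> f g"
  obtains f0 g0 where "H1_borel \<Omega> f0 g0" "AE x in lebesgue_on \<Omega>. f0 x = f x" "AE x in lebesgue_on \<Omega>. g0 x = g x"
    "(\<integral>\<^sup>+x. indicator \<Omega> x * ennreal ((f0 x)\<^sup>2) \<partial>lborel) = ennreal (L2_sq \<Omega> f)"
    "(\<integral>\<^sup>+x. ennreal ((norm (g0 x))\<^sup>2) \<partial>lborel) = ennreal (L2_sq \<Omega> g)"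
    "\<forall>B\<in>sets borel. (LINT y|lborel. f0 y * indicator B y) = (LINT y|lebesgue_on \<Omega>. f y * indicator B y)"
proof -
  obtain f0 g0 where r: "f0 \<in> borel_measurable borel" "g0 \<in> borel_measurable borel"
    "\<And>x. x \<notin> \<Omega> \<Longrightarrow> f0 x = 0" "\<And>x. x \<notin> \<Omega> \<Longrightarrow> g0 x = 0"
    "AE x in lebesgue_on \<Omega>. f0 x = f x" "AE x in lebesgue_on \<Omega>. g0 x = g x" "H1_gradient \<Omega> f0 g0"
    using H1_borel_representative[OF H assms(1)] by blast
  have HB: "H1_borel \<Omega> f0 g0" using r assms by (simp add: H1_borel_def)
  interpret H1_borel \<Omega> f0 g0 by (rule HB)
  have [measurable]: "f \<in> borel_measurable (lebesgue_on \<Omega>)" "g \<in> borel_measurable (lebesgue_on \<Omega>)"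
    using H by (auto simp: H1_gradient_def in_L2_def)
  have [measurable]: "f0 \<in> borel_measurable (lebesgue_on \<Omega>)" "g0 \<in> borel_measurable (lebesgue_on \<Omega>)"
    by (rule borel_measurable_lebesgue_onI, rule r)+
  have sq: "(\<integral>\<^sup>+x. ennreal ((norm (h x))\<^sup>2) \<partial>lborel) = ennreal (L2_sq \<Omega> h)"
    if h: "h \<in> borel_measurable borel" "\<And>x. x \<notin> \<Omega> \<Longrightarrow> h x = 0" "in_L2 \<Omega> h" for h :: "'a \<Rightarrow> 'b::euclidean_space"
  proof -
    note [measurable] = h(1)
    have m: "(\<lambda>x. (norm (h x))\<^sup>2) \<in> borel_measurable borel" by measurable
    have z: "(norm (h x))\<^sup>2 = 0" if "x \<notin> \<Omega>" for x using h(2)[OF that] by simp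
    have "integrable (lebesgue_on \<Omega>) (\<lambda>x. (norm (h x))\<^sup>2) \<longleftrightarrow> integrable lborel (\<lambda>x. (norm (h x))\<^sup>2)"
      by (rule integral_lebesgue_on_borel(2)[OF dom_sets m]) (rule z)
    then have "integrable lborel (\<lambda>x. (norm (h x))\<^sup>2)"
      using h(3) unfolding in_L2_def by blast
    then have "(\<integral>\<^sup>+x. ennreal ((norm (h x))\<^sup>2) \<partial>lborel) = ennreal (LINT x|lborel. (norm (h x))\<^sup>2)"
      by (intro nn_integral_eq_integral) auto
    moreover have "(LINT x|lebesgue_on \<Omega>. (norm (h x))\<^sup>2) = (LINT x|lborel. (norm (h x))\<^sup>2)"
      by (rule integral_lebesgue_on_borel(1)[OF dom_sets m]) (rule z)
    ultimately show ?thesis unfolding L2_sq_eq by simp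
  qed
  have cong: "L2_sq \<Omega> f0 = L2_sq \<Omega> f" "L2_sq \<Omega> g0 = L2_sq \<Omega> g"
    unfolding L2_inner_def by (rule integral_cong_AE; use r(5,6) in \<open>auto elim: eventually_mono\<close>)+
  show ?thesis
  proof (rule that[OF HB r(5,6)])
    have "(\<integral>\<^sup>+x. indicator \<Omega> x * ennreal ((f0 x)\<^sup>2) \<partial>lborel) = (\<integral>\<^sup>+x. ennreal ((norm (f0 x))\<^sup>2) \<partial>lborel)"
      using r(3) by (intro nn_integral_cong) (simp add: indicator_def)
    then show "(\<integral>\<^sup>+x. indicator \<Omega> x * ennreal ((f0 x)\<^sup>2) \<partial>lborel) = ennreal (L2_sq \<Omega> f)"
      using sq[OF r(1,3) in_L2(1)] cong(1) by simp
    show "(\<integral>\<^sup>+x. ennreal ((norm (g0 x))\<^sup>2) \<partial>lborel) = ennreal (L2_sq \<Omega> g)"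
      using sq[OF r(2,4) in_L2(2)] cong(2) by simp
    show "\<forall>B\<in>sets borel. (LINT y|lborel. f0 y * indicator B y) = (LINT y|lebesgue_on \<Omega>. f y * indicator B y)"
    proof
    fix B :: "'a set" assume B: "B \<in> sets borel"
    then have [measurable]: "(indicator B :: 'a \<Rightarrow> real) \<in> borel_measurable (lebesgue_on \<Omega>)"
      by (intro borel_measurable_lebesgue_onI borel_measurable_indicator)
    have mB: "(\<lambda>y. f0 y * indicator B y) \<in> borel_measurable borel"
      by (intro borel_measurable_times borel_measurable_indicator r(1) B)
    have zB: "f0 y * indicator B y = 0" if "y \<notin> \<Omega>" for y using r(3)[OF that] by simp
    have "(LINT y|lborel. f0 y * indicator B y) = (LINT y|lebesgue_on \<Omega>. f0 y * indicator B y)"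
      by (rule integral_lebesgue_on_borel(1)[OF dom_sets mB zB, symmetric])
    also have "\<dots> = (LINT y|lebesgue_on \<Omega>. f y * indicator B y)"
      by (rule integral_cong_AE; use r(5) in \<open>auto elim: eventually_mono\<close>)
    finally show "(LINT y|lborel. f0 y * indicator B y) = (LINT y|lebesgue_on \<Omega>. f y * indicator B y)" .
    qed
  qed
qed

lemma rellich_estimate:
  assumes "bounded \<Omega>" "regular_domain \<Omega>" "e > 0"
  obtains Q C where "finite Q" "Q \<subseteq> sets borel" "0 \<le> C"
    "\<And>f g. H1_gradient \<Omega> f g \<Longrightarrow> L2_sq \<Omega> f \<le> e * L2_sq \<Omega> g + C * (\<Sum>B\<in>Q. (LINT y|lebesgue_on \<Omega>. f y * indicator B y)\<^sup>2)"
proof -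
  have \<Omega>: "open \<Omega>" using assms(2) by (simp add: regular_domain_def)
  obtain Q C where "controlled_by \<Omega> \<Omega> e Q C" by (rule controlledE[OF controlled_domain[OF assms(1,2)] assms(3)])
  note Q = controlled_byD[OF this]
  have "L2_sq \<Omega> f \<le> e * L2_sq \<Omega> g + C * (\<Sum>B\<in>Q. (LINT y|lebesgue_on \<Omega>. f y * indicator B y)\<^sup>2)" (is "_ \<le> _ + _ * ?S")
    if H: "H1_gradient \<Omega> f g" for f g
  proof -
    obtain f0 g0 where r: "H1_borel \<Omega> f0 g0"
      "AE x in lebesgue_on \<Omega>. f0 x = f x" "AE x in lebesgue_on \<Omega>. g0 x = g x"
      "(\<integral>\<^sup>+x. indicator \<Omega> x * ennreal ((f0 x)\<^sup>2) \<partial>lborel) = ennreal (L2_sq \<Omega> f)"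
      "(\<integral>\<^sup>+x. ennreal ((norm (g0 x))\<^sup>2) \<partial>lborel) = ennreal (L2_sq \<Omega> g)"
      "\<forall>B\<in>sets borel. (LINT y|lborel. f0 y * indicator B y) = (LINT y|lebesgue_on \<Omega>. f y * indicator B y)"
      by (rule H1_borel_transfer[OF \<Omega> assms(1) H])
    have "(\<Sum>B\<in>Q. ennreal ((LINT y|lborel. f0 y * indicator B y)\<^sup>2)) = (\<Sum>B\<in>Q. ennreal ((LINT y|lebesgue_on \<Omega>. f y * indicator B y)\<^sup>2))"
      using Q(2) by (intro sum.cong refl) (simp add: r(6) subsetD)
    also have "\<dots> = ennreal ?S" by (rule sum_ennreal) simp
    finally have "ennreal (L2_sq \<Omega> f) \<le> ennreal e * ennreal (L2_sq \<Omega> g) + ennreal C * ennreal ?S"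
      using Q(4)[OF r(1)] unfolding r(4,5) by simp
    also have "\<dots> = ennreal (e * L2_sq \<Omega> g + C * ?S)"
      using assms(3) Q(3) L2_sq_nonneg[of \<Omega> g] by (simp add: ennreal_mult ennreal_plus sum_nonneg)
    finally show ?thesis
      using assms(3) Q(3) L2_sq_nonneg[of \<Omega> g] by (subst (asm) ennreal_le_iff) (auto intro!: add_nonneg_nonneg mult_nonneg_nonneg sum_nonneg)
  qed
  then show ?thesis using that[OF Q(1-3)] by blast
qed

lemma H1_constant:
  assumes "bounded \<Omega>" "regular_domain \<Omega>" and H: "H1_gradient \<Omega> f (\<lambda>x. 0)"
  obtains c where "AE x in lebesgue_on \<Omega>. f x = c"
proof -
  have \<Omega>: "open \<Omega>" "connected \<Omega>" "\<Omega> \<noteq> {}" using assms(2) by (simp_all add: regular_domain_def)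
  obtain f0 g0 where r: "H1_borel \<Omega> f0 g0" "AE x in lebesgue_on \<Omega>. f0 x = f x"
      "AE x in lebesgue_on \<Omega>. g0 x = 0"
      "(\<integral>\<^sup>+x. indicator \<Omega> x * ennreal ((f0 x)\<^sup>2) \<partial>lborel) = ennreal (L2_sq \<Omega> f)"
      "(\<integral>\<^sup>+x. ennreal ((norm (g0 x))\<^sup>2) \<partial>lborel) = ennreal (L2_sq \<Omega> (\<lambda>x. 0 :: 'a))"
    by (rule H1_borel_transfer[OF \<Omega>(1) assms(1) H])
  have "\<exists>c. AE x in lborel. x \<in> \<Omega> \<longrightarrow> f0 x = c"
    by (rule H1_borel.constant_if_gradient_zero[OF r(1) _ \<Omega>(2,3)]) (simp add: r(5) L2_inner_def)
  then obtain c where c: "AE x in lborel. x \<in> \<Omega> \<longrightarrow> f0 x = c" ..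
  have "AE x in lebesgue_on \<Omega>. f0 x = c"
    using AE_completion[OF c] \<Omega>(1) by (subst AE_restrict_space_iff) auto
  with r(2) have "AE x in lebesgue_on \<Omega>. f x = c" by eventually_elim simp
  then show ?thesis by (rule that)
qed

lemma in_L2_indicator:
  assumes "\<Omega> \<in> lmeasurable" "B \<in> sets borel"
  shows "in_L2 \<Omega> (indicator B :: 'a::euclidean_space \<Rightarrow> real)"
  by (rule in_L2_bounded[OF assms(1) borel_measurable_lebesgue_onI[OF borel_measurable_indicator[OF assms(2)]], of 1])
    (simp add: indicator_def)

text \<open>The estimates for all factors \<open>1 / Suc j\<close> involve countably many sets.
  Along a bounded sequence the integrals over each of them are bounded, so a diagonal subsequence
  makes all of them converge; the estimates then bound the differences of its members.\<close>

lemma rellich: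
  fixes f :: "nat \<Rightarrow> 'a::euclidean_space \<Rightarrow> real"
  assumes \<Omega>: "bounded \<Omega>" "regular_domain \<Omega>"
    and X: "\<And>n. H1_gradient \<Omega> (f n) (g n)" and M: "\<And>n. L2_sq \<Omega> (f n) \<le> M" "\<And>n. L2_sq \<Omega> (g n) \<le> M"
  obtains r :: "nat \<Rightarrow> nat" where "strict_mono r" "L2_Cauchy \<Omega> (\<lambda>n. f (r n))"
proof -
  have op: "open \<Omega>" using \<Omega>(2) by (simp add: regular_domain_def)
  have meas: "\<Omega> \<in> lmeasurable" by (rule lmeasurable_open[OF \<Omega>(1) op])
  note L = H1_gradient_L2[OF X]
  define E where "E j Q C \<longleftrightarrow> finite Q \<and> Q \<subseteq> sets borel \<and> 0 \<le> C \<and> (\<forall>u v. H1_gradient \<Omega> u v \<longrightarrow>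
      L2_sq \<Omega> u \<le> (1 / Suc j) * L2_sq \<Omega> v + C * (\<Sum>B\<in>Q. (LINT y|lebesgue_on \<Omega>. u y * indicator B y)\<^sup>2))"
    for j :: nat and Q C
  have "\<exists>Q C. E j Q C" for j
    unfolding E_def
    by (rule rellich_estimate[OF \<Omega>, of "1 / Suc j"], simp) (intro exI conjI allI impI, assumption+)
  then obtain Q C where E: "\<And>j. E j (Q j) (C j)" by metis
  have Q: "finite (Q j)" "Q j \<subseteq> sets borel" "0 \<le> C j" for j
    using E[of j] by (simp_all add: E_def)
  have est: "L2_sq \<Omega> u \<le> (1 / Suc j) * L2_sq \<Omega> v + C j * (\<Sum>B\<in>Q j. (LINT y|lebesgue_on \<Omega>. u y * indicator B y)\<^sup>2)"
    if "H1_gradient \<Omega> u v" for j u v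
    using E[of j] that by (simp add: E_def)
  \<comment> \<open>The empty set is inserted because \<open>from_nat_into\<close> enumerates
    nonempty sets only.\<close>
  define S where "S = insert {} (\<Union>j. Q j)"
  have S: "countable S" "S \<noteq> {}" "S \<subseteq> sets borel" using Q(1,2) by (auto simp: S_def intro: countable_finite)
  define a where "a k n = L2_inner \<Omega> (f n) (indicator (from_nat_into S k))" for k n
  have ind: "in_L2 \<Omega> (indicator (from_nat_into S k) :: 'a \<Rightarrow> real)" for k
    using S from_nat_into[OF S(2), of k] by (intro in_L2_indicator[OF meas]) auto
  have bounded: "bounded (range (\<lambda>n. a k (s n)))" for k and s :: "nat \<Rightarrow> nat"
  proof -
    have "\<bar>a k n\<bar> \<le> sqrt (M * L2_sq \<Omega> (indicator (from_nat_into S k) :: 'a \<Rightarrow> real))" for n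
    proof -
      have "(a k n)\<^sup>2 \<le> M * L2_sq \<Omega> (indicator (from_nat_into S k) :: 'a \<Rightarrow> real)"
        unfolding a_def using L2_inner_sq_le[OF L(1) ind] mult_right_mono[OF M(1) L2_sq_nonneg] by (rule order_trans)
      then show ?thesis using real_sqrt_le_mono by fastforce
    qed
    then show ?thesis by (intro boundedI[where B = "sqrt (M * L2_sq \<Omega> (indicator (from_nat_into S k) :: 'a \<Rightarrow> real))"]) auto
  qed
  define P where "P k s \<longleftrightarrow> convergent (\<lambda>n. a k (s n))" for k :: nat and s :: "nat \<Rightarrow> nat"
  interpret subseqs P
  proof
    fix k and s :: "nat \<Rightarrow> nat"
    from bounded_imp_convergent_subsequence[OF bounded[of k s]]
    obtain l r where "strict_mono r" "((\<lambda>n. a k (s n)) \<circ> r) \<longlonglongrightarrow> l" by blast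
    then show "\<exists>r'. strict_mono r' \<and> P k (s \<circ> r')" by (auto simp: P_def convergent_def comp_def)
  qed
  let ?r = diagseq
  have conv: "convergent (\<lambda>n. a k (?r n))" for k
  proof -
    \<comment> \<open>The diagonal sequence is a subsequence of the one chosen for index
      \<open>k\<close> only after its first \<open>Suc k\<close> terms; dropping them leaves
      convergence unchanged.\<close>
    have "P k (?r \<circ> ((+) (Suc k)))"
    proof (rule diagseq_holds)
      fix s t :: "nat \<Rightarrow> nat" and n assume "strict_mono s" "P n t"
      from \<open>P n t\<close> obtain L where "(\<lambda>k. a n (t k)) \<longlonglongrightarrow> L" by (auto simp: P_def convergent_def)
      from LIMSEQ_subseq_LIMSEQ[OF this \<open>strict_mono s\<close>] show "P n (t \<circ> s)"
        by (auto simp: P_def convergent_def comp_def)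
    qed
    then have "convergent (\<lambda>n. a k ((?r \<circ> ((+) (Suc k))) n))" by (rule P_def[THEN iffD1])
    then show ?thesis
      using convergent_ignore_initial_segment[of "\<lambda>n. a k (?r n)" "Suc k"] by (simp add: add.commute)
  qed
  have convB: "Cauchy (\<lambda>n. LINT y|lebesgue_on \<Omega>. f (?r n) y * indicator B y)" if B: "B \<in> Q j" for B j
  proof -
    have "B \<in> S" using B by (auto simp: S_def)
    then obtain k where "B = from_nat_into S k" using S(1) by (metis from_nat_into_to_nat_on)
    then show ?thesis using conv[of k] by (simp add: a_def L2_inner_def convergent_Cauchy)
  qed
  have "L2_Cauchy \<Omega> (\<lambda>n. f (?r n))"
    unfolding L2_Cauchy_def
  proof (intro allI impI)
    fix e :: real assume e: "e > 0"
    have M0: "0 \<le> M" using M(1)[of 0] L2_sq_nonneg[of \<Omega> "f 0"] by linarith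
    obtain j where j: "1 / Suc j < e / (2 * (4 * M + 1))" using nat_approx_posE[of "e / (2 * (4 * M + 1))"] e M0 by auto
    \<comment> \<open>One half of \<open>e\<close> is reserved for the gradient term, at most
      \<open>4 * M / Suc j\<close> by the parallelogram identity, the other half for the integrals
      over the sets in \<open>Q j\<close>. Adding 1 in the denominators excludes division by
      0.\<close>
    define \<eta> where "\<eta> = e / (2 * ((C j + 1) * (card (Q j) + 1)))"
    have \<eta>: "\<eta> > 0" using e Q(3)[of j] by (simp add: \<eta>_def)
    have "\<exists>N. \<forall>m\<ge>N. \<forall>n\<ge>N. \<forall>B\<in>Q j. ((LINT y|lebesgue_on \<Omega>. f (?r m) y * indicator B y) - (LINT y|lebesgue_on \<Omega>. f (?r n) y * indicator B y))\<^sup>2 < \<eta>"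
    proof -
      have "\<exists>N. \<forall>m\<ge>N. \<forall>n\<ge>N. \<bar>(LINT y|lebesgue_on \<Omega>. f (?r m) y * indicator B y) - (LINT y|lebesgue_on \<Omega>. f (?r n) y * indicator B y)\<bar> < sqrt \<eta>" if "B \<in> Q j" for B
        using CauchyD[OF convB[OF that], of "sqrt \<eta>"] \<eta> by simp
      then obtain N where N: "\<And>B m n. B \<in> Q j \<Longrightarrow> m \<ge> N B \<Longrightarrow> n \<ge> N B \<Longrightarrow>
        \<bar>(LINT y|lebesgue_on \<Omega>. f (?r m) y * indicator B y) - (LINT y|lebesgue_on \<Omega>. f (?r n) y * indicator B y)\<bar> < sqrt \<eta>" by metis
      have "((LINT y|lebesgue_on \<Omega>. f (?r m) y * indicator B y) - (LINT y|lebesgue_on \<Omega>. f (?r n) y * indicator B y))\<^sup>2 < \<eta>"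
        if "m \<ge> (\<Sum>B\<in>Q j. N B)" "n \<ge> (\<Sum>B\<in>Q j. N B)" "B \<in> Q j" for m n B
      proof -
        have "N B \<le> (\<Sum>B\<in>Q j. N B)" using Q(1) that(3) by (intro member_le_sum) auto
        then have "\<bar>(LINT y|lebesgue_on \<Omega>. f (?r m) y * indicator B y) - (LINT y|lebesgue_on \<Omega>. f (?r n) y * indicator B y)\<bar> < sqrt \<eta>"
          using N[OF that(3)] that(1,2) order_trans by blast
        from power_strict_mono[OF this, of 2] \<eta> show ?thesis by simp
      qed
      then show ?thesis by blast
    qed
    then obtain N where N: "\<And>m n B. m \<ge> N \<Longrightarrow> n \<ge> N \<Longrightarrow> B \<in> Q j \<Longrightarrow>
      ((LINT y|lebesgue_on \<Omega>. f (?r m) y * indicator B y) - (LINT y|lebesgue_on \<Omega>. f (?r n) y * indicator B y))\<^sup>2 < \<eta>" by blast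
    have "L2_sq \<Omega> (\<lambda>x. f (?r m) x - f (?r n) x) < e" if mn: "m \<ge> N" "n \<ge> N" for m n
    proof -
      let ?m = "?r m" and ?n = "?r n"
      have H: "H1_gradient \<Omega> (\<lambda>x. f ?m x - f ?n x) (\<lambda>x. g ?m x - g ?n x)"
        using H1_gradient_add[OF meas X H1_gradient_scale[OF X, of "-1"], of ?m ?n] by simp
      have "L2_sq \<Omega> (\<lambda>x. g ?m x - g ?n x) \<le> 4 * M"
      proof -
        have "L2_sq \<Omega> (\<lambda>x. g ?m x - g ?n x) + L2_sq \<Omega> (\<lambda>x. g ?m x + g ?n x) = 2 * L2_sq \<Omega> (g ?m) + 2 * L2_sq \<Omega> (g ?n)"
          using L2_sq_diff[OF L(2) L(2), of ?m ?n] L2_sq_add[OF L(2) L(2), of ?m ?n] by linarith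
        then show ?thesis using M(2)[of ?m] M(2)[of ?n] L2_sq_nonneg[of \<Omega> "\<lambda>x. g ?m x + g ?n x"] by linarith
      qed
      then have 1: "(1 / Suc j) * L2_sq \<Omega> (\<lambda>x. g ?m x - g ?n x) \<le> (1 / Suc j) * (4 * M)" by (intro mult_left_mono) auto
      have "(1 / Suc j) * (4 * M) \<le> (1 / Suc j) * (4 * M + 1)" by (intro mult_left_mono) auto
      also have "\<dots> < e / (2 * (4 * M + 1)) * (4 * M + 1)" using M0 by (intro mult_strict_right_mono j) auto
      also have "\<dots> = e / 2" using M0 by (simp add: field_simps)
      finally have 2: "(1 / Suc j) * (4 * M) < e / 2" .
      have eqB: "(LINT y|lebesgue_on \<Omega>. (f ?m y - f ?n y) * indicator B y) = (LINT y|lebesgue_on \<Omega>. f ?m y * indicator B y) - (LINT y|lebesgue_on \<Omega>. f ?n y * indicator B y)"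
        if "B \<in> Q j" for B
      proof -
        have "in_L2 \<Omega> (indicator B :: 'a \<Rightarrow> real)" using Q(2) that by (intro in_L2_indicator[OF meas]) auto
        from L2_inner_diff_left[OF L(1) L(1) this, of ?m ?n] show ?thesis by (simp add: L2_inner_def)
      qed
      have "(\<Sum>B\<in>Q j. (LINT y|lebesgue_on \<Omega>. (f ?m y - f ?n y) * indicator B y)\<^sup>2) \<le> (\<Sum>B\<in>Q j. \<eta>)"
        using N[OF mn] by (intro sum_mono) (simp add: eqB less_imp_le)
      then have "C j * (\<Sum>B\<in>Q j. (LINT y|lebesgue_on \<Omega>. (f ?m y - f ?n y) * indicator B y)\<^sup>2) \<le> C j * (card (Q j) * \<eta>)"
        using Q(3) by (intro mult_left_mono) auto
      also have "\<dots> \<le> (C j + 1) * ((card (Q j) + 1) * \<eta>)"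
        using Q(3)[of j] \<eta> by (intro mult_mono) auto
      also have "\<dots> = e / 2"
      proof -
        have "(C j + 1) * (card (Q j) + 1) \<noteq> 0" using Q(3)[of j] by simp
        then show ?thesis by (simp add: \<eta>_def field_simps)
      qed
      finally show ?thesis using est[OF H, of j] 1 2 by linarith
    qed
    then show "\<exists>M. \<forall>m\<ge>M. \<forall>n\<ge>M. L2_sq \<Omega> (\<lambda>x. f (?r m) x - f (?r n) x) < e" by blast
  qed
  then show ?thesis by (rule that[OF subseq_diagseq])
qed

section \<open>Poincare inequality and spectral gap\<close>

locale regular_bounded =
  fixes \<Omega> :: "'a::euclidean_space set"
  assumes bounded_dom: "bounded \<Omega>" and regular_dom: "regular_domain \<Omega>"
begin

lemma open_dom: "open \<Omega>"
  using regular_dom by (simp add: regular_domain_def)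

lemma lmeasurable_dom: "\<Omega> \<in> lmeasurable"
  by (rule lmeasurable_open[OF bounded_dom open_dom])

lemma in_L2_const: "in_L2 \<Omega> (\<lambda>x. c)"
  by (rule in_L2_bounded[OF lmeasurable_dom, of _ "norm c"]) auto

lemma H1_diff: "H1_gradient \<Omega> f g \<Longrightarrow> H1_gradient \<Omega> f' g' \<Longrightarrow> H1_gradient \<Omega> (\<lambda>x. f x - f' x) (\<lambda>x. g x - g' x)"
  using H1_gradient_add[OF lmeasurable_dom _ H1_gradient_scale[of \<Omega> f' g' "-1"], of f g] by simp

lemma L2_sq_diff_le:
  assumes "in_L2 \<Omega> f" "in_L2 \<Omega> g"
  shows "L2_sq \<Omega> (\<lambda>x. f x - g x) \<le> 2 * L2_sq \<Omega> f + 2 * L2_sq \<Omega> g"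
  using L2_sq_diff[OF assms] L2_sq_add[OF assms] L2_sq_nonneg[of \<Omega> "\<lambda>x. f x + g x"] by linarith

text \<open>Normalised counterexamples would have a subsequence whose limit has zero gradient, hence
  is a constant. Orthogonality to \<open>q\<close> passes to the limit and forces the constant to be
  0, while the norm stays 1. The weight is general because the splitting into constants and their
  complement will be made with the coefficient \<open>b\<close>.\<close>

lemma poincare:
  fixes q :: "'a \<Rightarrow> real"
  assumes q: "in_L2 \<Omega> q" and q1: "L2_inner \<Omega> (\<lambda>x. 1) q \<noteq> 0"
  obtains C where "C > 0" "\<And>f g. H1_gradient \<Omega> f g \<Longrightarrow> L2_inner \<Omega> f q = 0 \<Longrightarrow> L2_sq \<Omega> f \<le> C * L2_sq \<Omega> g"
proof (rule ccontr)
  assume no: "\<not> thesis"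
  define W where "W f g \<longleftrightarrow> H1_gradient \<Omega> f g \<and> L2_inner \<Omega> f q = 0" for f g
  have "\<exists>f g. W f g \<and> real (Suc n) * L2_sq \<Omega> g < L2_sq \<Omega> f" for n
  proof (rule ccontr)
    assume n: "\<not> (\<exists>f g. W f g \<and> real (Suc n) * L2_sq \<Omega> g < L2_sq \<Omega> f)"
    have "L2_sq \<Omega> f \<le> real (Suc n) * L2_sq \<Omega> g" if "H1_gradient \<Omega> f g" "L2_inner \<Omega> f q = 0" for f g
      using n that unfolding W_def by (meson not_le)
    then have thesis by (intro that[of "real (Suc n)"]) auto
    with no show False ..
  qed
  then obtain F G where FG: "\<And>n. W (F n) (G n)" "\<And>n. real (Suc n) * L2_sq \<Omega> (G n) < L2_sq \<Omega> (F n)" by metis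
  define a where "a n = 1 / sqrt (L2_sq \<Omega> (F n))" for n
  have pos: "L2_sq \<Omega> (F n) > 0" for n
  proof -
    have "0 \<le> real (Suc n) * L2_sq \<Omega> (G n)" using L2_sq_nonneg by (intro mult_nonneg_nonneg) auto
    then show ?thesis using FG(2)[of n] by linarith
  qed
  have a2: "(a n)\<^sup>2 * L2_sq \<Omega> (F n) = 1" for n using pos[of n] by (simp add: a_def power_divide)
  define f where "f n x = a n * F n x" for n x
  define g where "g n x = a n *\<^sub>R G n x" for n x
  have H: "H1_gradient \<Omega> (f n) (g n)" for n
    unfolding f_def g_def using FG(1) by (intro H1_gradient_scale) (simp add: W_def)
  note L = H1_gradient_L2[OF H]
  have ortho: "L2_inner \<Omega> (f n) q = 0" for n
    using FG(1)[of n] L2_inner_scale_left[of \<Omega> "a n" "F n" q] by (simp add: f_def[abs_def] W_def)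
  have sqf: "L2_sq \<Omega> (f n) = 1" for n
    using L2_inner_scale_left[of \<Omega> "a n" "F n" "f n"] L2_inner_scale_right[of \<Omega> "F n" "a n" "F n"] a2[of n]
    by (simp add: f_def[abs_def] power2_eq_square)
  have sqg: "L2_sq \<Omega> (g n) \<le> 1 / Suc n" for n
  proof -
    have "L2_sq \<Omega> (g n) = (a n)\<^sup>2 * L2_sq \<Omega> (G n)"
      using L2_inner_scale_left[of \<Omega> "a n" "G n" "g n"] L2_inner_scale_right[of \<Omega> "G n" "a n" "G n"]
      by (simp add: g_def[abs_def] power2_eq_square)
    also have "real (Suc n) * \<dots> = (a n)\<^sup>2 * (real (Suc n) * L2_sq \<Omega> (G n))" by (simp only: mult.left_commute)
    also have "\<dots> \<le> (a n)\<^sup>2 * L2_sq \<Omega> (F n)" using FG(2)[of n] by (intro mult_left_mono) auto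
    finally show ?thesis unfolding a2 by (simp add: field_simps)
  qed
  have "L2_sq \<Omega> (g n) \<le> 1" for n
  proof -
    have "1 / real (Suc n) \<le> 1" by simp
    then show ?thesis using sqg[of n] by linarith
  qed
  note g_le_1 = this
  obtain r :: "nat \<Rightarrow> nat" where r: "strict_mono r" "L2_Cauchy \<Omega> (\<lambda>n. f (r n))"
  proof (rule rellich[OF bounded_dom regular_dom H])
    show "L2_sq \<Omega> (f n) \<le> 1" for n by (simp add: sqf)
    show "L2_sq \<Omega> (g n) \<le> 1" for n by (rule g_le_1)
  qed
  obtain f' where f': "in_L2 \<Omega> f'" "(\<lambda>n. L2_sq \<Omega> (\<lambda>x. f (r n) x - f' x)) \<longlonglongrightarrow> 0"
    by (rule L2_Cauchy_convergent[OF L(1) r(2)])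
  have lim_g: "(\<lambda>n. L2_sq \<Omega> (\<lambda>x. g (r n) x - 0)) \<longlonglongrightarrow> 0"
  proof (rule real_tendsto_sandwich[OF _ _ tendsto_const LIMSEQ_Suc[OF lim_1_over_n]])
    show "\<forall>\<^sub>F n in sequentially. 0 \<le> L2_sq \<Omega> (\<lambda>x. g (r n) x - 0)" by (simp add: L2_sq_nonneg)
    have "L2_sq \<Omega> (\<lambda>x. g (r n) x - 0) \<le> 1 / real (Suc n)" for n
    proof -
      have "1 / real (Suc (r n)) \<le> 1 / real (Suc n)" using seq_suble[OF r(1), of n] by (intro divide_left_mono) auto
      then show ?thesis using sqg[of "r n"] by simp
    qed
    then show "\<forall>\<^sub>F n in sequentially. L2_sq \<Omega> (\<lambda>x. g (r n) x - 0) \<le> 1 / real (Suc n)" by (simp only: eventually_sequentiallyI)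
  qed
  have H': "H1_gradient \<Omega> f' (\<lambda>x. 0)"
    by (rule H1_gradient_limit[OF lmeasurable_dom H f'(1) in_L2_const f'(2)[unfolded L2_sq_eq] lim_g[unfolded L2_sq_eq]])
  obtain c where c: "AE x in lebesgue_on \<Omega>. f' x = c" by (rule H1_constant[OF bounded_dom regular_dom H'])
  have [measurable]: "f' \<in> borel_measurable (lebesgue_on \<Omega>)" "q \<in> borel_measurable (lebesgue_on \<Omega>)"
    using f'(1) q by (simp_all add: in_L2_def)
  have "(\<lambda>n. L2_inner \<Omega> (f (r n)) q) \<longlonglongrightarrow> L2_inner \<Omega> f' q" by (rule L2_inner_limit[OF L(1) f'(1) q f'(2)])
  then have "L2_inner \<Omega> f' q = 0" by (simp add: ortho LIMSEQ_const_iff)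
  moreover have "L2_inner \<Omega> f' q = L2_inner \<Omega> (\<lambda>x. c) q"
    unfolding L2_inner_def by (rule integral_cong_AE; use c in \<open>auto elim: eventually_mono\<close>)
  moreover have "L2_inner \<Omega> (\<lambda>x. c) q = c * L2_inner \<Omega> (\<lambda>x. 1) q" by (simp add: L2_inner_def)
  ultimately have "c = 0" using q1 by simp
  have "L2_sq \<Omega> f' = L2_sq \<Omega> (\<lambda>x. 0 :: real)"
    unfolding L2_inner_def using \<open>c = 0\<close> by (intro integral_cong_AE; use c in \<open>auto elim: eventually_mono\<close>)
  then have "L2_sq \<Omega> f' = 0" by (simp add: L2_inner_def)
  moreover have "(\<lambda>n. L2_sq \<Omega> (f (r n))) \<longlonglongrightarrow> L2_sq \<Omega> f'" by (rule L2_sq_limit[OF L(1) f'])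
  then have "L2_sq \<Omega> f' = 1" by (simp add: sqf LIMSEQ_const_iff)
  ultimately show False by simp
qed

text \<open>The best constant \<open>\<mu>\<close> in \<open>\<mu> \<integral> b f\<^sup>2 \<le> \<integral> |Df|\<^sup>2\<close> (for \<open>\<integral> b f = 0\<close>) is attained, and then
  \<open>\<mu> b\<close> belongs to \<open>\<Sigma>\<close>. So if no \<open>\<mu> b\<close> with \<open>\<mu> \<le> 1\<close> belongs to \<open>\<Sigma>\<close>, then \<open>\<mu> > 1\<close>.\<close>

lemma spectral_gap:
  fixes b :: "'a \<Rightarrow> real"
  assumes bm [measurable]: "b \<in> borel_measurable (lebesgue_on \<Omega>)"
    and b: "\<And>x. x \<in> \<Omega> \<Longrightarrow> 0 \<le> b x" "\<And>x. x \<in> \<Omega> \<Longrightarrow> b x \<le> M"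
    and bpos: "(LINT x|lebesgue_on \<Omega>. b x) > 0"
    and no: "\<And>\<mu>. 0 < \<mu> \<Longrightarrow> \<mu> \<le> 1 \<Longrightarrow> (\<lambda>x. \<mu> * b x) \<notin> Sigma_set \<Omega>"
  obtains c where "c > 0" "\<And>f g. H1_gradient \<Omega> f g \<Longrightarrow> L2_inner \<Omega> f b = 0 \<Longrightarrow>
    c * (L2_sq \<Omega> f + L2_sq \<Omega> g) \<le> L2_sq \<Omega> g - (LINT x|lebesgue_on \<Omega>. b x * (f x)\<^sup>2)"
proof -
  note conclude = that
  let ?I = "\<lambda>F. LINT x|lebesgue_on \<Omega>. F x"
  have bL2: "in_L2 \<Omega> b" by (rule in_L2_bounded[OF lmeasurable_dom bm, of M]) (use b in auto)
  have M: "M \<ge> 0" using b regular_dom by (force simp: regular_domain_def)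
  \<comment> \<open>Multiplication by the square root turns the weighted form into an ordinary inner
    product, so that expansions, Cauchy-Schwarz and limits can be taken from the unweighted
    case.\<close>
  define s where "s f x = sqrt (b x) * f x" for f :: "'a \<Rightarrow> real" and x
  have sL2: "in_L2 \<Omega> (s f)" if "in_L2 \<Omega> f" for f
    using in_L2_mult_bounded[OF that, of "\<lambda>x. sqrt (b x)" "sqrt M"] b by (simp add: s_def[abs_def])
  have s_inner: "L2_inner \<Omega> (s f) (s h) = ?I (\<lambda>x. b x * f x * h x)" for f h
    unfolding L2_inner_def s_def using b(1)
    by (intro Bochner_Integration.integral_cong) (auto simp: real_sqrt_mult_self algebra_simps)
  have s_diff: "s (\<lambda>x. f x - h x) = (\<lambda>x. s f x - s h x)" for f h by (simp add: s_def fun_eq_iff algebra_simps)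
  have s_add: "s (\<lambda>x. f x + h x) = (\<lambda>x. s f x + s h x)" for f h by (simp add: s_def fun_eq_iff algebra_simps)
  have s_scale: "s (\<lambda>x. c * f x) = (\<lambda>x. c *\<^sub>R s f x)" for f c by (simp add: s_def fun_eq_iff)
  have s_le: "L2_sq \<Omega> (s f) \<le> M * L2_sq \<Omega> f" if f: "in_L2 \<Omega> f" for f
  proof -
    have "L2_sq \<Omega> (s f) = ?I (\<lambda>x. (norm (s f x))\<^sup>2)" by (rule L2_sq_eq)
    also have "\<dots> \<le> ?I (\<lambda>x. M * (norm (f x))\<^sup>2)"
    proof (rule integral_mono)
      show "integrable (lebesgue_on \<Omega>) (\<lambda>x. (norm (s f x))\<^sup>2)" using sL2[OF f] by (simp add: in_L2_def)
      show "integrable (lebesgue_on \<Omega>) (\<lambda>x. M * (norm (f x))\<^sup>2)" using f by (simp add: in_L2_def)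
      fix x assume "x \<in> space (lebesgue_on \<Omega>)"
      then show "(norm (s f x))\<^sup>2 \<le> M * (norm (f x))\<^sup>2"
        using b[of x] by (simp add: s_def power_mult_distrib mult_right_mono)
    qed
    finally show ?thesis by (simp add: L2_sq_eq)
  qed
  have B: "L2_inner \<Omega> (\<lambda>x. 1) b > 0" using bpos by (simp add: L2_inner_def)
  then have "L2_inner \<Omega> (\<lambda>x. 1) b \<noteq> 0" by simp
  from poincare[OF bL2 this] obtain C where C: "C > 0"
    "\<And>f g. H1_gradient \<Omega> f g \<Longrightarrow> L2_inner \<Omega> f b = 0 \<Longrightarrow> L2_sq \<Omega> f \<le> C * L2_sq \<Omega> g" by blast
  have Ef: "?I (\<lambda>x. b x * (f x)\<^sup>2) = L2_sq \<Omega> (s f)" for f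
    using s_inner[of f f] by (simp add: power2_eq_square mult.assoc)
  define W where "W f g \<longleftrightarrow> H1_gradient \<Omega> f g \<and> L2_inner \<Omega> f b = 0" for f g
  \<comment> \<open>It suffices to have a gap measured by the gradient alone: the Poincare
    inequality absorbs the norm of \<open>f\<close> at the price of the factor
    \<open>C + 1\<close>.\<close>
  have finish: thesis if \<kappa>: "\<kappa> > 0" and gap: "\<And>f g. W f g \<Longrightarrow> \<kappa> * L2_sq \<Omega> g \<le> L2_sq \<Omega> g - L2_sq \<Omega> (s f)" for \<kappa>
  proof (rule conclude)
    show "\<kappa> / (C + 1) > 0" using \<kappa> C by simp
    fix f g assume H: "H1_gradient \<Omega> f g" "L2_inner \<Omega> f b = 0"
    have "\<kappa> / (C + 1) * (L2_sq \<Omega> f + L2_sq \<Omega> g) \<le> \<kappa> / (C + 1) * (C * L2_sq \<Omega> g + L2_sq \<Omega> g)"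
      using C(2)[OF H] \<kappa> C(1) by (intro mult_left_mono) auto
    also have "\<dots> = \<kappa> * L2_sq \<Omega> g" using C(1) by (simp add: field_simps)
    also have "\<dots> \<le> L2_sq \<Omega> g - ?I (\<lambda>x. b x * (f x)\<^sup>2)" unfolding Ef using gap H by (simp add: W_def)
    finally show "\<kappa> / (C + 1) * (L2_sq \<Omega> f + L2_sq \<Omega> g) \<le> L2_sq \<Omega> g - ?I (\<lambda>x. b x * (f x)\<^sup>2)" .
  qed
  show thesis
  \<comment> \<open>If the weighted form vanishes on all admissible functions, nothing can be
    normalised and the gap is 1. Otherwise the set \<open>S\<close> of normalised Dirichlet energies
    below is nonempty and its infimum is meaningful.\<close>
  proof (cases "\<forall>f g. W f g \<longrightarrow> L2_sq \<Omega> (s f) = 0")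
    case True
    show thesis
    proof (rule finish[of 1])
      show "1 * L2_sq \<Omega> g \<le> L2_sq \<Omega> g - L2_sq \<Omega> (s f)" if "W f g" for f g
      proof -
        have "L2_sq \<Omega> (s f) = 0" using True that by blast
        then show ?thesis by simp
      qed
    qed simp
  next
    case False
    define S where "S = {L2_sq \<Omega> g | f g. W f g \<and> L2_sq \<Omega> (s f) = 1}"
    have normalize: "\<exists>f' g'. W f' g' \<and> L2_sq \<Omega> (s f') = 1 \<and> L2_sq \<Omega> g' = L2_sq \<Omega> g / L2_sq \<Omega> (s f)"
      if W: "W f g" and ne: "L2_sq \<Omega> (s f) \<noteq> 0" for f g
    proof -
      define a where "a = 1 / sqrt (L2_sq \<Omega> (s f))"
      have pos: "L2_sq \<Omega> (s f) > 0" using ne L2_sq_nonneg[of \<Omega> "s f"] by linarith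
      have a2: "a * a = 1 / L2_sq \<Omega> (s f)" using pos by (simp add: a_def)
      have "W (\<lambda>x. a * f x) (\<lambda>x. a *\<^sub>R g x)"
        using W H1_gradient_scale[of \<Omega> f g a] L2_inner_scale_left[of \<Omega> a f b] by (simp add: W_def)
      moreover have "L2_sq \<Omega> (s (\<lambda>x. a * f x)) = a * a * L2_sq \<Omega> (s f)"
        unfolding s_scale L2_inner_scale_left L2_inner_scale_right by (simp only: mult.assoc)
      moreover have "L2_sq \<Omega> (\<lambda>x. a *\<^sub>R g x) = a * a * L2_sq \<Omega> g"
        unfolding L2_inner_scale_left L2_inner_scale_right by (simp only: mult.assoc)
      ultimately show ?thesis using ne unfolding a2
        by (intro exI[of _ "\<lambda>x. a * f x"] exI[of _ "\<lambda>x. a *\<^sub>R g x"]) simp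
    qed
    obtain f1 g1 where fg1: "W f1 g1" "L2_sq \<Omega> (s f1) \<noteq> 0" using False by blast
    have Sne: "S \<noteq> {}" using normalize[OF fg1] unfolding S_def by blast
    define \<mu> where "\<mu> = Inf S"
    have Sbdd: "bdd_below S" by (rule bdd_belowI[of _ 0]) (auto simp: S_def L2_sq_nonneg)
    have \<mu>_le: "\<mu> * L2_sq \<Omega> (s f) \<le> L2_sq \<Omega> g" if W: "W f g" for f g
    proof (cases "L2_sq \<Omega> (s f) = 0")
      case True
      then show ?thesis using L2_sq_nonneg[of \<Omega> g] by simp
    next
      case False
      have "L2_sq \<Omega> g / L2_sq \<Omega> (s f) \<in> S" using normalize[OF W False] unfolding S_def by (metis (mono_tags, lifting) mem_Collect_eq)
      then have "\<mu> \<le> L2_sq \<Omega> g / L2_sq \<Omega> (s f)" unfolding \<mu>_def using Sbdd by (intro cInf_lower)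
      then show ?thesis using False L2_sq_nonneg[of \<Omega> "s f"] by (simp add: pos_le_divide_eq)
    qed
    have \<mu>0: "\<mu> \<ge> 0" unfolding \<mu>_def using Sne by (intro cInf_greatest) (auto simp: S_def L2_sq_nonneg)
    have "\<exists>f g. W f g \<and> L2_sq \<Omega> (s f) = 1 \<and> L2_sq \<Omega> g < \<mu> + 1 / Suc n" for n
    proof -
      have "Inf S < \<mu> + 1 / Suc n" by (simp add: \<mu>_def)
      then obtain y where "y \<in> S" "y < \<mu> + 1 / Suc n" using cInf_lessD[OF Sne] by blast
      then show ?thesis unfolding S_def by blast
    qed
    then obtain f g where fg: "\<And>n. W (f n) (g n)" "\<And>n. L2_sq \<Omega> (s (f n)) = 1" "\<And>n. L2_sq \<Omega> (g n) < \<mu> + 1 / Suc n" by metis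
    have H: "H1_gradient \<Omega> (f n) (g n)" and ortho: "L2_inner \<Omega> (f n) b = 0" for n using fg(1)[of n] by (simp_all add: W_def)
    note L = H1_gradient_L2[OF H]
    have g_bd: "L2_sq \<Omega> (g n) \<le> \<mu> + 1" for n
    proof -
      have "1 / real (Suc n) \<le> 1" by simp
      then show ?thesis using fg(3)[of n] by linarith
    qed
    have f_bd: "L2_sq \<Omega> (f n) \<le> C * (\<mu> + 1)" for n
      using C(2)[OF H ortho, of n] mult_left_mono[OF g_bd[of n], of C] C(1) by linarith
    obtain r :: "nat \<Rightarrow> nat" where r: "strict_mono r" "L2_Cauchy \<Omega> (\<lambda>n. f (r n))"
    proof (rule rellich[OF bounded_dom regular_dom H])
      show "L2_sq \<Omega> (f n) \<le> max (C * (\<mu> + 1)) (\<mu> + 1)" for n using f_bd[of n] by simp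
      show "L2_sq \<Omega> (g n) \<le> max (C * (\<mu> + 1)) (\<mu> + 1)" for n using g_bd[of n] by simp
    qed
    have r_le: "1 / real (Suc (r n)) \<le> 1 / real (Suc n)" for n
      using seq_suble[OF r(1), of n] by (intro divide_left_mono) auto
    \<comment> \<open>Compactness gives convergence of the functions but not of their gradients. For
      these, the sum of two members has energy at least \<open>\<mu>\<close> times its weighted
      norm, which is close to 4, and the parallelogram identity bounds the energy of the
      difference.\<close>
    have par: "L2_sq \<Omega> (\<lambda>x. g (r m) x - g (r n) x) \<le> 2 / Suc m + 2 / Suc n + \<mu> * M * L2_sq \<Omega> (\<lambda>x. f (r m) x - f (r n) x)" for m n
    proof -
      let ?m = "r m" and ?n = "r n"
      have Wp: "W (\<lambda>x. f ?m x + f ?n x) (\<lambda>x. g ?m x + g ?n x)"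
        unfolding W_def using H1_gradient_add[OF lmeasurable_dom H H] L2_inner_add_left[OF L(1) L(1) bL2, of ?m ?n] ortho by simp
      have "L2_sq \<Omega> (s (\<lambda>x. f ?m x + f ?n x)) = 4 - L2_sq \<Omega> (s (\<lambda>x. f ?m x - f ?n x))"
        unfolding s_add s_diff L2_sq_add[OF sL2[OF L(1)] sL2[OF L(1)]] L2_sq_diff[OF sL2[OF L(1)] sL2[OF L(1)]] fg(2) by simp
      then have "\<mu> * (4 - L2_sq \<Omega> (s (\<lambda>x. f ?m x - f ?n x))) \<le> L2_sq \<Omega> (\<lambda>x. g ?m x + g ?n x)"
        using \<mu>_le[OF Wp] by simp
      moreover have "\<mu> * L2_sq \<Omega> (s (\<lambda>x. f ?m x - f ?n x)) \<le> \<mu> * (M * L2_sq \<Omega> (\<lambda>x. f ?m x - f ?n x))"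
        using \<mu>0 by (intro mult_left_mono s_le in_L2_diff L)
      moreover have "L2_sq \<Omega> (\<lambda>x. g ?m x - g ?n x) = 2 * L2_sq \<Omega> (g ?m) + 2 * L2_sq \<Omega> (g ?n) - L2_sq \<Omega> (\<lambda>x. g ?m x + g ?n x)"
        using L2_sq_diff[OF L(2) L(2), of ?m ?n] L2_sq_add[OF L(2) L(2), of ?m ?n] by linarith
      moreover have "L2_sq \<Omega> (g ?m) < \<mu> + 1 / Suc m" "L2_sq \<Omega> (g ?n) < \<mu> + 1 / Suc n"
        using fg(3)[of ?m] fg(3)[of ?n] r_le[of m] r_le[of n] by linarith+
      moreover have "2 / real (Suc m) = 2 * (1 / real (Suc m))" "2 / real (Suc n) = 2 * (1 / real (Suc n))" by simp_all
      ultimately show ?thesis unfolding right_diff_distrib mult.assoc by linarith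
    qed
    have cg: "L2_Cauchy \<Omega> (\<lambda>n. g (r n))"
      unfolding L2_Cauchy_def
    proof (intro allI impI)
      fix e :: real assume e: "e > 0"
      obtain K where K: "1 / real (Suc K) < e / 8" using nat_approx_posE[of "e / 8"] e by auto
      define \<eta> where "\<eta> = e / (2 * (\<mu> * M + 1))"
      have MM: "0 \<le> \<mu> * M" using \<mu>0 M by simp
      have \<eta>: "\<eta> > 0" using e MM by (simp add: \<eta>_def)
      obtain K' where K': "\<forall>m\<ge>K'. \<forall>n\<ge>K'. L2_sq \<Omega> (\<lambda>x. f (r m) x - f (r n) x) < \<eta>"
        using r(2) \<eta> unfolding L2_Cauchy_def by blast
      have "L2_sq \<Omega> (\<lambda>x. g (r m) x - g (r n) x) < e" if mn: "m \<ge> max K K'" "n \<ge> max K K'" for m n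
      proof -
        have "1 / real (Suc m) \<le> 1 / real (Suc K)" "1 / real (Suc n) \<le> 1 / real (Suc K)" using mn by (auto intro: divide_left_mono)
        then have "2 / real (Suc m) < e / 4" "2 / real (Suc n) < e / 4" using K by simp_all
        moreover have "\<mu> * M * L2_sq \<Omega> (\<lambda>x. f (r m) x - f (r n) x) \<le> \<mu> * M * \<eta>"
          using K' mn MM by (intro mult_left_mono) (auto simp: less_imp_le)
        moreover have "\<mu> * M * \<eta> \<le> (\<mu> * M + 1) * \<eta>" using \<eta> by simp
        moreover have "(\<mu> * M + 1) * \<eta> = e / 2" using MM by (simp add: \<eta>_def field_simps)
        ultimately show ?thesis using par[of m n] by linarith
      qed
      then show "\<exists>M. \<forall>m\<ge>M. \<forall>n\<ge>M. L2_sq \<Omega> (\<lambda>x. g (r m) x - g (r n) x) < e" by blast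
    qed
    obtain f' g' where lim: "H1_gradient \<Omega> f' g'" "(\<lambda>n. L2_sq \<Omega> (\<lambda>x. f (r n) x - f' x)) \<longlonglongrightarrow> 0"
      "(\<lambda>n. L2_sq \<Omega> (\<lambda>x. g (r n) x - g' x)) \<longlonglongrightarrow> 0"
      by (rule H1_complete[OF lmeasurable_dom H r(2) cg])
    note L' = H1_gradient_L2[OF lim(1)]
    have "(\<lambda>n. L2_inner \<Omega> (f (r n)) b) \<longlonglongrightarrow> L2_inner \<Omega> f' b" by (rule L2_inner_limit[OF L(1) L'(1) bL2 lim(2)])
    then have ortho': "L2_inner \<Omega> f' b = 0" by (simp add: ortho LIMSEQ_const_iff)
    have W': "W f' g'" using lim(1) ortho' by (simp add: W_def)
    have lim_s: "(\<lambda>n. L2_sq \<Omega> (\<lambda>x. s (f (r n)) x - s f' x)) \<longlonglongrightarrow> 0"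
    proof (rule real_tendsto_sandwich[OF _ _ tendsto_const])
      show "(\<lambda>n. M * L2_sq \<Omega> (\<lambda>x. f (r n) x - f' x)) \<longlonglongrightarrow> 0" using tendsto_mult_left[OF lim(2), of M] by simp
      show "\<forall>\<^sub>F n in sequentially. 0 \<le> L2_sq \<Omega> (\<lambda>x. s (f (r n)) x - s f' x)" by (simp add: L2_sq_nonneg)
      show "\<forall>\<^sub>F n in sequentially. L2_sq \<Omega> (\<lambda>x. s (f (r n)) x - s f' x) \<le> M * L2_sq \<Omega> (\<lambda>x. f (r n) x - f' x)"
        unfolding s_diff[symmetric] using s_le[OF in_L2_diff[OF L(1) L'(1)]] by simp
    qed
    have "(\<lambda>n. L2_sq \<Omega> (s (f (r n)))) \<longlonglongrightarrow> L2_sq \<Omega> (s f')" by (rule L2_sq_limit[OF sL2[OF L(1)] sL2[OF L'(1)] lim_s])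
    then have E1: "L2_sq \<Omega> (s f') = 1" by (simp add: fg(2) LIMSEQ_const_iff)
    have "(\<lambda>n. L2_sq \<Omega> (g (r n))) \<longlonglongrightarrow> L2_sq \<Omega> g'" by (rule L2_sq_limit[OF L(2) L'(2) lim(3)])
    moreover have "(\<lambda>n. \<mu> + 1 / real (Suc n)) \<longlonglongrightarrow> \<mu> + 0" by (intro tendsto_intros LIMSEQ_Suc[OF lim_1_over_n])
    moreover have "L2_sq \<Omega> (g (r n)) \<le> \<mu> + 1 / real (Suc n)" for n using fg(3)[of "r n"] r_le[of n] by linarith
    ultimately have "L2_sq \<Omega> g' \<le> \<mu>" using LIMSEQ_le by fastforce
    then have g'\<mu>: "L2_sq \<Omega> g' = \<mu>" using \<mu>_le[OF W'] E1 by simp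
    \<comment> \<open>Energy 0 would give norm 0 by the Poincare inequality, against the
      normalisation \<open>E1\<close>.\<close>
    have \<mu>pos: "\<mu> > 0"
    proof (rule ccontr)
      assume "\<not> \<mu> > 0"
      then have "L2_sq \<Omega> g' = 0" using g'\<mu> \<mu>0 by simp
      then have "L2_sq \<Omega> f' \<le> 0" using C(2)[OF lim(1) ortho'] by simp
      then have "L2_sq \<Omega> (s f') \<le> 0" using s_le[OF L'(1)] M mult_nonneg_nonpos[of M "L2_sq \<Omega> f'"] by linarith
      then show False using E1 by simp
    qed
    have EL_W: "L2_inner \<Omega> g' h = \<mu> * L2_inner \<Omega> (s f') (s v)" if W: "W v h" for v h
    proof -
      have Hv: "H1_gradient \<Omega> v h" "L2_inner \<Omega> v b = 0" using W by (simp_all add: W_def)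
      note Lv = H1_gradient_L2[OF Hv(1)]
      \<comment> \<open>\<open>L2_sq \<Omega> g - \<mu> * L2_sq \<Omega> (s f)\<close> is
        nonnegative on admissible pairs and equals 0 at the minimiser, hence the leading 0; its
        first variation therefore vanishes.\<close>
      have "0 \<le> 0 + 2 * t * (L2_inner \<Omega> g' h - \<mu> * L2_inner \<Omega> (s f') (s v)) + t\<^sup>2 * (L2_sq \<Omega> h - \<mu> * L2_sq \<Omega> (s v))" for t
      proof -
        have "W (\<lambda>x. f' x + t * v x) (\<lambda>x. g' x + t *\<^sub>R h x)"
          unfolding W_def using H1_gradient_add[OF lmeasurable_dom lim(1) H1_gradient_scale[OF Hv(1)], of t]
            L2_inner_add_left[OF L'(1) in_L2_scaleR[OF Lv(1)] bL2, of t] L2_inner_scale_left[of \<Omega> t v b] ortho' Hv(2) by simp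
        from \<mu>_le[OF this] have "\<mu> * L2_sq \<Omega> (\<lambda>x. s f' x + t *\<^sub>R s v x) \<le> L2_sq \<Omega> (\<lambda>x. g' x + t *\<^sub>R h x)"
          unfolding s_add s_scale .
        then show ?thesis
          unfolding L2_sq_add_scaled[OF sL2[OF L'(1)] sL2[OF Lv(1)]] L2_sq_add_scaled[OF L'(2) Lv(2)] E1 g'\<mu>
          by (simp add: algebra_simps)
      qed
      from quadratic_nonneg_imp[OF this] show ?thesis by simp
    qed
    \<comment> \<open>A suitable constant \<open>k\<close> makes \<open>v - k\<close> admissible.
      The left side does not see \<open>k\<close>, since the gradient is unchanged, and the right
      side does not either, since \<open>f'\<close> is orthogonal to \<open>b\<close>.\<close>
    have EL: "L2_inner \<Omega> g' h = \<mu> * L2_inner \<Omega> (s f') (s v)" if Hv: "H1_gradient \<Omega> v h" for v h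
    proof -
      note Lv = H1_gradient_L2[OF Hv]
      define k where "k = L2_inner \<Omega> v b / L2_inner \<Omega> (\<lambda>x. 1) b"
      have kb: "L2_inner \<Omega> (\<lambda>x. k) b = L2_inner \<Omega> v b"
        using B L2_inner_scale_left[of \<Omega> k "\<lambda>x. 1" b] by (simp add: k_def)
      have "W (\<lambda>x. v x - k) h"
        unfolding W_def using H1_diff[OF Hv H1_gradient_const[OF lmeasurable_dom, of k]]
          L2_inner_diff_left[OF Lv(1) in_L2_const bL2, of k] kb by simp
      from EL_W[OF this] have "L2_inner \<Omega> g' h = \<mu> * (L2_inner \<Omega> (s f') (s v) - L2_inner \<Omega> (s f') (s (\<lambda>x. k)))"
        unfolding s_diff L2_inner_diff_right[OF sL2[OF Lv(1)] sL2[OF in_L2_const] sL2[OF L'(1)]] .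
      moreover have "L2_inner \<Omega> (s f') (s (\<lambda>x. k)) = 0"
        unfolding s_inner using ortho' by (simp add: L2_inner_def mult.commute)
      ultimately show ?thesis by simp
    qed
    have int3: "integrable (lebesgue_on \<Omega>) (\<lambda>x. \<mu> * b x * f' x * v x)" and int3_eq: "?I (\<lambda>x. \<mu> * b x * f' x * v x) = \<mu> * L2_inner \<Omega> (s f') (s v)"
      if v: "in_L2 \<Omega> v" for v
    proof -
      have "in_L2 \<Omega> (\<lambda>x. b x *\<^sub>R f' x)" by (rule in_L2_mult_bounded[OF L'(1) bm, of M]) (use b in auto)
      from in_L2_mult_integrable[OF this[simplified] v] show "integrable (lebesgue_on \<Omega>) (\<lambda>x. \<mu> * b x * f' x * v x)"
        by (simp add: mult.assoc)
      show "?I (\<lambda>x. \<mu> * b x * f' x * v x) = \<mu> * L2_inner \<Omega> (s f') (s v)"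
        unfolding s_inner by (simp add: mult.assoc)
    qed
    have "(\<lambda>x. \<mu> * b x) \<in> Sigma_set \<Omega>"
      unfolding Sigma_set_def
    proof (intro CollectI conjI exI[of _ f'])
      show "in_Linf \<Omega> (\<lambda>x. \<mu> * b x)"
        unfolding in_Linf_def
      proof
        show m: "(\<lambda>x. \<mu> * b x) \<in> borel_measurable (lebesgue_on \<Omega>)" by measurable
        have "esssup (lebesgue_on \<Omega>) (\<lambda>x. ennreal \<bar>\<mu> * b x\<bar>) \<le> ennreal (\<mu> * M)"
        proof (rule esssup_I)
          show "(\<lambda>x. ennreal \<bar>\<mu> * b x\<bar>) \<in> borel_measurable (lebesgue_on \<Omega>)" by measurable
          show "AE x in lebesgue_on \<Omega>. ennreal \<bar>\<mu> * b x\<bar> \<le> ennreal (\<mu> * M)"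
            using b \<mu>pos by (intro AE_I2 ennreal_leI) (simp add: abs_mult mult_left_mono)
        qed
        also have "\<dots> < \<infinity>" by simp
        finally show "Lp_norm \<Omega> \<infinity> (\<lambda>x. \<mu> * b x) < \<infinity>" by (simp add: Lp_norm_def)
      qed
      show "\<not> (AE x in lebesgue_on \<Omega>. \<mu> * b x = 0)"
      proof
        assume "AE x in lebesgue_on \<Omega>. \<mu> * b x = 0"
        then have "AE x in lebesgue_on \<Omega>. b x = 0" using \<mu>pos by (auto elim: eventually_mono)
        then have "?I b = ?I (\<lambda>x. 0)" by (intro integral_cong_AE) auto
        then show False using bpos by simp
      qed
      show "0 \<le> ?I (\<lambda>x. \<mu> * b x)" using bpos \<mu>pos by simp
      show "f' \<in> H1 \<Omega>" using lim(1) by (auto simp: H1_def)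
      show "\<not> (AE x in lebesgue_on \<Omega>. f' x = 0)"
      proof
        assume ae: "AE x in lebesgue_on \<Omega>. f' x = 0"
        have [measurable]: "f' \<in> borel_measurable (lebesgue_on \<Omega>)" using L'(1) by (simp add: in_L2_def)
        have "L2_sq \<Omega> (s f') = ?I (\<lambda>x. b x * f' x * f' x)" by (rule s_inner)
        also have "\<dots> = ?I (\<lambda>x. 0)" by (rule integral_cong_AE; use ae in \<open>auto elim: eventually_mono\<close>)
        finally show False using E1 by simp
      qed
      show "weak_neumann \<Omega> f' (\<lambda>x. \<mu> * b x * f' x)"
        unfolding weak_neumann_def
      proof (intro exI[of _ g'] conjI allI impI)
        show "H1_gradient \<Omega> f' g'" by (rule lim(1))
        fix v Dv assume Hv: "H1_gradient \<Omega> v Dv"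
        note Lv = H1_gradient_L2[OF Hv]
        show "integrable (lebesgue_on \<Omega>) (\<lambda>x. \<mu> * b x * f' x * v x)" by (rule int3[OF Lv(1)])
        show "?I (\<lambda>x. g' x \<bullet> Dv x) = ?I (\<lambda>x. \<mu> * b x * f' x * v x)"
          unfolding int3_eq[OF Lv(1)] using EL[OF Hv] by (simp add: L2_inner_def[of \<Omega> g' Dv])
      qed
    qed
    then have \<mu>1: "\<mu> > 1" using no[OF \<mu>pos] by (cases "\<mu> \<le> 1") auto
    show thesis
    proof (rule finish)
      show "1 - 1 / \<mu> > 0" using \<mu>1 by simp
      fix f g assume "W f g"
      from \<mu>_le[OF this] have "L2_sq \<Omega> (s f) \<le> L2_sq \<Omega> g / \<mu>" using \<mu>pos by (simp add: pos_le_divide_eq mult.commute)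
      then show "(1 - 1 / \<mu>) * L2_sq \<Omega> g \<le> L2_sq \<Omega> g - L2_sq \<Omega> (s f)" by (simp add: left_diff_distrib)
    qed
  qed
qed

end

section \<open>The saddle-point operator\<close>

text \<open>A weak gradient is determined only almost everywhere. Carrying one along with each
  component lets it depend linearly on the vector without a choice.\<close>

type_synonym ('a, 'n) H1_vec = "'n \<Rightarrow> ('a \<Rightarrow> real) \<times> ('a \<Rightarrow> 'a)"

definition H1_space :: "'a::euclidean_space set \<Rightarrow> ('a, 'n) H1_vec set" where
  "H1_space \<Omega> = {u. \<forall>i. H1_gradient \<Omega> (fst (u i)) (snd (u i))}"

definition H1_inner :: "'a::euclidean_space set \<Rightarrow> ('a, 'n::finite) H1_vec \<Rightarrow> ('a, 'n) H1_vec \<Rightarrow> real" where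
  "H1_inner \<Omega> u v = (\<Sum>i\<in>UNIV. L2_inner \<Omega> (fst (u i)) (fst (v i)) + L2_inner \<Omega> (snd (u i)) (snd (v i)))"

lemma H1_spaceD:
  assumes "u \<in> H1_space \<Omega>"
  shows "H1_gradient \<Omega> (fst (u i)) (snd (u i))" "in_L2 \<Omega> (fst (u i))" "in_L2 \<Omega> (snd (u i))"
  using assms by (auto simp: H1_space_def intro: H1_gradient_L2)

lemma H1_vec_simps:
  "fst ((u + v) i) = (\<lambda>x. fst (u i) x + fst (v i) x)" "snd ((u + v) i) = (\<lambda>x. snd (u i) x + snd (v i) x)"
  "fst ((u - v) i) = (\<lambda>x. fst (u i) x - fst (v i) x)" "snd ((u - v) i) = (\<lambda>x. snd (u i) x - snd (v i) x)"
  "fst ((c *\<^sub>R u) i) = (\<lambda>x. c *\<^sub>R fst (u i) x)" "snd ((c *\<^sub>R u) i) = (\<lambda>x. c *\<^sub>R snd (u i) x)"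
  for u v :: "('a::euclidean_space, 'n) H1_vec"
  by (simp_all add: plus_fun_def fun_diff_def scaleR_fun_def)

lemma abs_L2_inner_le: "in_L2 \<Omega> f \<Longrightarrow> in_L2 \<Omega> g \<Longrightarrow> \<bar>L2_inner \<Omega> f g\<bar> \<le> sqrt (L2_sq \<Omega> f) * sqrt (L2_sq \<Omega> g)"
  using real_sqrt_le_mono[OF L2_inner_sq_le, of \<Omega> f g] by (simp add: real_sqrt_mult)

context regular_bounded
begin

lemma subspace_H1: "subspace (H1_space \<Omega>)"
proof (rule subspaceI)
  show "0 \<in> H1_space \<Omega>" using H1_gradient_const[OF lmeasurable_dom, of 0] by (simp add: H1_space_def zero_fun_def)
  show "u + v \<in> H1_space \<Omega>" if "u \<in> H1_space \<Omega>" "v \<in> H1_space \<Omega>" for u v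
    using that H1_gradient_add[OF lmeasurable_dom] by (simp add: H1_space_def H1_vec_simps del: fst_add snd_add plus_fun_apply)
  show "c *\<^sub>R u \<in> H1_space \<Omega>" if "u \<in> H1_space \<Omega>" for c u
    using that H1_gradient_scale[of \<Omega>] by (simp add: H1_space_def H1_vec_simps del: fst_scaleR snd_scaleR)
qed

lemma semi_hilbert_H1: "semi_hilbert (H1_space \<Omega> :: ('a, 'n::finite) H1_vec set) (H1_inner \<Omega>)"
proof
  show "subspace (H1_space \<Omega> :: ('a, 'n) H1_vec set)" by (rule subspace_H1)
  fix u v w :: "('a, 'n) H1_vec" and c :: real
  show "H1_inner \<Omega> u v = H1_inner \<Omega> v u"
    by (simp add: H1_inner_def L2_inner_commute[of \<Omega> "fst (u _)"] L2_inner_commute[of \<Omega> "snd (u _)"])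
  show "0 \<le> H1_inner \<Omega> u u" by (simp add: H1_inner_def sum_nonneg L2_sq_nonneg)
  show "H1_inner \<Omega> (c *\<^sub>R u) v = c * H1_inner \<Omega> u v"
    unfolding H1_inner_def H1_vec_simps L2_inner_scale_left by (simp add: sum_distrib_left distrib_left)
  assume V: "u \<in> H1_space \<Omega>" "v \<in> H1_space \<Omega>" "w \<in> H1_space \<Omega>"
  show "H1_inner \<Omega> (u + v) w = H1_inner \<Omega> u w + H1_inner \<Omega> v w"
    unfolding H1_inner_def H1_vec_simps L2_inner_add_left[OF H1_spaceD(2)[OF V(1)] H1_spaceD(2)[OF V(2)] H1_spaceD(2)[OF V(3)]]
      L2_inner_add_left[OF H1_spaceD(3)[OF V(1)] H1_spaceD(3)[OF V(2)] H1_spaceD(3)[OF V(3)]]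
    by (simp add: sum.distrib)
next
  fix X :: "nat \<Rightarrow> ('a, 'n) H1_vec"
  assume X: "\<And>n. X n \<in> H1_space \<Omega>"
    and cauchy: "\<And>e. e > 0 \<Longrightarrow> \<exists>M. \<forall>m\<ge>M. \<forall>n\<ge>M. H1_inner \<Omega> (X m - X n) (X m - X n) < e"
  have le: "L2_sq \<Omega> (fst (u i)) \<le> H1_inner \<Omega> u u" "L2_sq \<Omega> (snd (u i)) \<le> H1_inner \<Omega> u u" for u :: "('a, 'n) H1_vec" and i
  proof -
    have "L2_sq \<Omega> (fst (u i)) + L2_sq \<Omega> (snd (u i)) \<le> H1_inner \<Omega> u u"
      unfolding H1_inner_def by (rule member_le_sum) (auto simp: L2_sq_nonneg)
    then show "L2_sq \<Omega> (fst (u i)) \<le> H1_inner \<Omega> u u" "L2_sq \<Omega> (snd (u i)) \<le> H1_inner \<Omega> u u"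
      using L2_sq_nonneg[of \<Omega> "fst (u i)"] L2_sq_nonneg[of \<Omega> "snd (u i)"] by linarith+
  qed
  have c1: "L2_Cauchy \<Omega> (\<lambda>n. fst (X n i))" and c2: "L2_Cauchy \<Omega> (\<lambda>n. snd (X n i))" for i
    unfolding L2_Cauchy_def
    using cauchy le(1)[of "X _ - X _" i, unfolded H1_vec_simps] le(2)[of "X _ - X _" i, unfolded H1_vec_simps]
    by (meson le_less_trans)+
  define R where "R i f g \<longleftrightarrow> H1_gradient \<Omega> f g \<and> (\<lambda>n. L2_sq \<Omega> (\<lambda>x. fst (X n i) x - f x)) \<longlonglongrightarrow> 0
      \<and> (\<lambda>n. L2_sq \<Omega> (\<lambda>x. snd (X n i) x - g x)) \<longlonglongrightarrow> 0" for i f g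
  have "\<exists>f g. R i f g" for i
    unfolding R_def
    by (rule H1_complete[OF lmeasurable_dom H1_spaceD(1)[OF X] c1 c2]) (intro exI conjI, assumption+)
  then obtain f g where R: "\<And>i. R i (f i) (g i)" by metis
  have fg: "H1_gradient \<Omega> (f i) (g i)" "(\<lambda>n. L2_sq \<Omega> (\<lambda>x. fst (X n i) x - f i x)) \<longlonglongrightarrow> 0"
    "(\<lambda>n. L2_sq \<Omega> (\<lambda>x. snd (X n i) x - g i x)) \<longlonglongrightarrow> 0" for i
    using R[of i] by (simp_all add: R_def)
  show "\<exists>x\<in>H1_space \<Omega>. (\<lambda>n. H1_inner \<Omega> (X n - x) (X n - x)) \<longlonglongrightarrow> 0"
  proof (intro bexI[of _ "\<lambda>i. (f i, g i)"])
    show "(\<lambda>i. (f i, g i)) \<in> H1_space \<Omega>" using fg(1) by (simp add: H1_space_def)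
    have "(\<lambda>n. \<Sum>i\<in>UNIV. L2_sq \<Omega> (\<lambda>x. fst (X n i) x - f i x) + L2_sq \<Omega> (\<lambda>x. snd (X n i) x - g i x)) \<longlonglongrightarrow> (\<Sum>i\<in>(UNIV :: 'n set). 0 + 0)"
      by (intro tendsto_sum tendsto_add fg)
    then show "(\<lambda>n. H1_inner \<Omega> (X n - (\<lambda>i. (f i, g i))) (X n - (\<lambda>i. (f i, g i)))) \<longlonglongrightarrow> 0"
      unfolding H1_inner_def H1_vec_simps by simp
  qed
qed

end

section \<open>Vector-valued functions and their components\<close>

definition vec_of :: "('a, 'n::finite) H1_vec \<Rightarrow> 'a \<Rightarrow> real ^ 'n" where
  "vec_of u x = (\<chi> i. fst (u i) x)"

lemma in_L2_vec:
  fixes f :: "'n::finite \<Rightarrow> 'a::euclidean_space \<Rightarrow> real"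
  assumes "\<And>i. in_L2 \<Omega> (f i)"
  shows "in_L2 \<Omega> (\<lambda>x. \<chi> i. f i x)"
proof -
  have m [measurable]: "f i \<in> borel_measurable (lebesgue_on \<Omega>)" for i using assms by (simp add: in_L2_def)
  have "(\<lambda>x. \<chi> i. f i x) = (\<lambda>x. \<Sum>i\<in>UNIV. f i x *\<^sub>R axis i 1)"
    by (simp add: fun_eq_iff vec_eq_iff axis_def if_distrib[of "\<lambda>t. _ * t"] cong: if_cong)
  then have "(\<lambda>x. \<chi> i. f i x) \<in> borel_measurable (lebesgue_on \<Omega>)"
    by (simp only:) measurable
  moreover have "(\<lambda>x. (norm (\<chi> i. f i x))\<^sup>2) = (\<lambda>x. \<Sum>i\<in>UNIV. (norm (f i x))\<^sup>2)"
    unfolding power2_norm_eq_inner inner_vec_def by simp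
  moreover have "integrable (lebesgue_on \<Omega>) (\<lambda>x. \<Sum>i\<in>UNIV. (norm (f i x))\<^sup>2)"
    using assms by (intro Bochner_Integration.integrable_sum) (simp add: in_L2_def)
  ultimately show ?thesis by (simp only: in_L2_def)
qed

lemma in_L2_nth: "in_L2 \<Omega> f \<Longrightarrow> in_L2 \<Omega> (\<lambda>x. f x $ i)" for f :: "'a::euclidean_space \<Rightarrow> real ^ 'n"
  using in_L2_component[of \<Omega> f "axis i 1"] by (simp add: inner_axis)

lemma L2_inner_vec:
  fixes f g :: "'a::euclidean_space \<Rightarrow> real ^ 'n"
  assumes "in_L2 \<Omega> f" "in_L2 \<Omega> g"
  shows "L2_inner \<Omega> f g = (\<Sum>i\<in>UNIV. L2_inner \<Omega> (\<lambda>x. f x $ i) (\<lambda>x. g x $ i))"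
  unfolding L2_inner_def inner_vec_def
  by (intro Bochner_Integration.integral_sum in_L2_inner_integrable in_L2_nth assms)

text \<open>The data as the saddle-point operator uses them. In \<open>F_split\<close> the increment
  of \<open>F\<close> is tested against \<open>d - 2 *\<^sub>R k\<close>, where
  \<open>d = a - a'\<close>; for \<open>k\<close> the mean of \<open>d\<close> this is the reflected
  difference, and the bound separates \<open>d - k\<close> from \<open>k\<close>. The convexity on
  the complement of \<open>q\<close> is \<open>gap\<close>, the concavity on constants is
  \<open>A_pos\<close>.\<close>

locale monotone_system = regular_bounded \<Omega> for \<Omega> :: "'a::euclidean_space set" +
  fixes F :: "'a \<Rightarrow> real ^ 'n \<Rightarrow> real ^ 'n" and b q :: "'n \<Rightarrow> 'a \<Rightarrow> real" and A :: "'a \<Rightarrow> real ^ 'n ^ 'n"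
    and L M c m :: real
  assumes F_meas: "\<And>u. u \<in> borel_measurable (lebesgue_on \<Omega>) \<Longrightarrow> (\<lambda>x. F x (u x)) \<in> borel_measurable (lebesgue_on \<Omega>)"
    and F_0: "in_L2 \<Omega> (\<lambda>x. F x 0)"
    and L: "L \<ge> 0" and F_lip: "\<And>x a a'. x \<in> \<Omega> \<Longrightarrow> norm (F x a - F x a') \<le> L * norm (a - a')"
    and F_split: "\<And>x a a' k. x \<in> \<Omega> \<Longrightarrow>
       (F x a - F x a') \<bullet> ((a - a') - 2 *\<^sub>R k) \<le> (\<Sum>i\<in>UNIV. b i x * ((a - a') $ i - k $ i)\<^sup>2) - (A x *v k) \<bullet> k"
    and b_meas: "\<And>i. b i \<in> borel_measurable (lebesgue_on \<Omega>)" and b_bound: "\<And>i x. x \<in> \<Omega> \<Longrightarrow> \<bar>b i x\<bar> \<le> M"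
    and A_int: "\<And>k. integrable (lebesgue_on \<Omega>) (\<lambda>x. (A x *v k) \<bullet> k)"
    and m: "m > 0" and A_pos: "\<And>k. m * (norm k)\<^sup>2 \<le> (LINT x|lebesgue_on \<Omega>. (A x *v k) \<bullet> k)"
    and q: "\<And>i. in_L2 \<Omega> (q i)" and q1: "\<And>i. L2_inner \<Omega> (\<lambda>x. 1) (q i) \<noteq> 0"
    and c: "c > 0" and gap: "\<And>i f g. H1_gradient \<Omega> f g \<Longrightarrow> L2_inner \<Omega> f (q i) = 0 \<Longrightarrow>
       c * (L2_sq \<Omega> f + L2_sq \<Omega> g) \<le> L2_sq \<Omega> g - (LINT x|lebesgue_on \<Omega>. b i x * (f x)\<^sup>2)"
begin

sublocale semi_hilbert "H1_space \<Omega> :: ('a, 'n) H1_vec set" "H1_inner \<Omega>"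
  by (rule semi_hilbert_H1)

abbreviation V :: "('a, 'n) H1_vec set" where "V \<equiv> H1_space \<Omega>"

lemma vec_of_L2: "u \<in> V \<Longrightarrow> in_L2 \<Omega> (vec_of u)"
  unfolding vec_of_def[abs_def] by (rule in_L2_vec) (rule H1_spaceD)

lemma vec_of_simps: "vec_of (u + v) = (\<lambda>x. vec_of u x + vec_of v x)" "vec_of (u - v) = (\<lambda>x. vec_of u x - vec_of v x)"
  "vec_of (r *\<^sub>R u) = (\<lambda>x. r *\<^sub>R vec_of u x)" for u v :: "('a, 'n) H1_vec"
  unfolding vec_of_def[abs_def] H1_vec_simps by (simp_all add: fun_eq_iff vec_eq_iff)

lemma L2_sq_vec_of: "u \<in> V \<Longrightarrow> L2_sq \<Omega> (vec_of u) = (\<Sum>i\<in>UNIV. L2_sq \<Omega> (fst (u i)))"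
  by (subst L2_inner_vec) (auto intro: vec_of_L2 simp: vec_of_def)

lemma nrm_ge: "u \<in> V \<Longrightarrow> sqrt (L2_sq \<Omega> (snd (u i))) \<le> nrm u" "u \<in> V \<Longrightarrow> sqrt (L2_sq \<Omega> (vec_of u)) \<le> nrm u"
proof -
  assume u: "u \<in> V"
  have "L2_sq \<Omega> (fst (u i)) + L2_sq \<Omega> (snd (u i)) \<le> H1_inner \<Omega> u u"
    unfolding H1_inner_def by (rule member_le_sum) (auto simp: L2_sq_nonneg)
  then show "sqrt (L2_sq \<Omega> (snd (u i))) \<le> nrm u"
    unfolding nrm_def using L2_sq_nonneg[of \<Omega> "fst (u i)"] by (intro real_sqrt_le_mono) linarith
  show "sqrt (L2_sq \<Omega> (vec_of u)) \<le> nrm u"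
    unfolding nrm_def L2_sq_vec_of[OF u] H1_inner_def by (intro real_sqrt_le_mono sum_mono) (simp add: L2_sq_nonneg)
qed

lemma F_L2:
  assumes "in_L2 \<Omega> u"
  shows "in_L2 \<Omega> (\<lambda>x. F x (u x))"
proof -
  have [measurable]: "(\<lambda>x. F x (u x)) \<in> borel_measurable (lebesgue_on \<Omega>)" "(\<lambda>x. F x 0) \<in> borel_measurable (lebesgue_on \<Omega>)"
    using assms F_0 by (simp_all add: in_L2_def F_meas)
  have "integrable (lebesgue_on \<Omega>) (\<lambda>x. (norm (F x (u x) - F x 0))\<^sup>2)"
  proof (rule integrable_dominated)
    show "integrable (lebesgue_on \<Omega>) (\<lambda>x. L\<^sup>2 * (norm (u x))\<^sup>2)" using assms by (simp add: in_L2_def)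
    show "norm ((norm (F x (u x) - F x 0))\<^sup>2) \<le> L\<^sup>2 * (norm (u x))\<^sup>2" if "x \<in> space (lebesgue_on \<Omega>)" for x
      using power_mono[OF F_lip[of x "u x" 0], of 2] that by (simp add: power_mult_distrib)
  qed measurable
  then have "in_L2 \<Omega> (\<lambda>x. F x (u x) - F x 0)" by (simp add: in_L2_def)
  from in_L2_add[OF this F_0] show ?thesis by simp
qed

lemma F_diff_L2:
  assumes "in_L2 \<Omega> u" "in_L2 \<Omega> v"
  shows "sqrt (L2_sq \<Omega> (\<lambda>x. F x (u x) - F x (v x))) \<le> L * sqrt (L2_sq \<Omega> (\<lambda>x. u x - v x))"
proof -
  have "L2_sq \<Omega> (\<lambda>x. F x (u x) - F x (v x)) \<le> (LINT x|lebesgue_on \<Omega>. L\<^sup>2 * (norm (u x - v x))\<^sup>2)"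
    unfolding L2_sq_eq
  proof (rule integral_mono)
    show "integrable (lebesgue_on \<Omega>) (\<lambda>x. (norm (F x (u x) - F x (v x)))\<^sup>2)"
      using in_L2_diff[OF F_L2[OF assms(1)] F_L2[OF assms(2)]] by (simp add: in_L2_def)
    show "integrable (lebesgue_on \<Omega>) (\<lambda>x. L\<^sup>2 * (norm (u x - v x))\<^sup>2)"
      using in_L2_diff[OF assms] by (simp add: in_L2_def)
    show "(norm (F x (u x) - F x (v x)))\<^sup>2 \<le> L\<^sup>2 * (norm (u x - v x))\<^sup>2" if "x \<in> space (lebesgue_on \<Omega>)" for x
      using power_mono[OF F_lip[of x "u x" "v x"], of 2] that by (simp add: power_mult_distrib)
  qed
  also have "\<dots> = L\<^sup>2 * L2_sq \<Omega> (\<lambda>x. u x - v x)" by (simp add: L2_sq_eq)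
  finally have "sqrt (L2_sq \<Omega> (\<lambda>x. F x (u x) - F x (v x))) \<le> sqrt (L\<^sup>2 * L2_sq \<Omega> (\<lambda>x. u x - v x))" by (rule real_sqrt_le_mono)
  then show ?thesis using L by (simp add: real_sqrt_mult)
qed

text \<open>When \<open>F x\<close> is the gradient of \<open>G x\<close>, this is the derivative at
  \<open>u\<close> in direction \<open>v\<close> of the energy, half the Dirichlet integral minus
  the integral of \<open>G x (u x)\<close>.\<close>

definition residual :: "('a, 'n) H1_vec \<Rightarrow> ('a, 'n) H1_vec \<Rightarrow> real" where
  "residual u v = (\<Sum>i\<in>UNIV. L2_inner \<Omega> (snd (u i)) (snd (v i))) - L2_inner \<Omega> (\<lambda>x. F x (vec_of u x)) (vec_of v)"

lemma residual_add:
  assumes "u \<in> V" "v \<in> V" "w \<in> V"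
  shows "residual u (v + w) = residual u v + residual u w"
  unfolding residual_def H1_vec_simps vec_of_simps
    L2_inner_add_right[OF H1_spaceD(3)[OF assms(2)] H1_spaceD(3)[OF assms(3)] H1_spaceD(3)[OF assms(1)]]
    L2_inner_add_right[OF vec_of_L2[OF assms(2)] vec_of_L2[OF assms(3)] F_L2[OF vec_of_L2[OF assms(1)]]]
  by (simp add: sum.distrib)

lemma residual_scale: "residual u (r *\<^sub>R v) = r * residual u v"
  unfolding residual_def H1_vec_simps vec_of_simps L2_inner_scale_right
  by (simp add: sum_distrib_left right_diff_distrib)

lemma residual_bound:
  assumes u: "u \<in> V" and v: "v \<in> V"
  shows "\<bar>residual u v\<bar> \<le> ((\<Sum>i\<in>UNIV. sqrt (L2_sq \<Omega> (snd (u i)))) + sqrt (L2_sq \<Omega> (\<lambda>x. F x (vec_of u x)))) * nrm v"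
proof -
  have "\<bar>L2_inner \<Omega> (snd (u i)) (snd (v i))\<bar> \<le> sqrt (L2_sq \<Omega> (snd (u i))) * nrm v" for i
    using abs_L2_inner_le[OF H1_spaceD(3)[OF u] H1_spaceD(3)[OF v]] mult_left_mono[OF nrm_ge(1)[OF v]] L2_sq_nonneg
    by (meson order_trans real_sqrt_ge_zero)
  then have "\<bar>\<Sum>i\<in>UNIV. L2_inner \<Omega> (snd (u i)) (snd (v i))\<bar> \<le> (\<Sum>i\<in>UNIV. sqrt (L2_sq \<Omega> (snd (u i))) * nrm v)"
    by (intro order_trans[OF sum_abs] sum_mono)
  moreover have "\<bar>L2_inner \<Omega> (\<lambda>x. F x (vec_of u x)) (vec_of v)\<bar> \<le> sqrt (L2_sq \<Omega> (\<lambda>x. F x (vec_of u x))) * nrm v"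
    using abs_L2_inner_le[OF F_L2[OF vec_of_L2[OF u]] vec_of_L2[OF v]] mult_left_mono[OF nrm_ge(2)[OF v]] L2_sq_nonneg
    by (meson order_trans real_sqrt_ge_zero)
  ultimately show ?thesis unfolding residual_def by (simp add: distrib_right sum_distrib_right)
qed

lemma residual_diff:
  assumes u: "u \<in> V" and u': "u' \<in> V" and v: "v \<in> V"
  shows "residual u v - residual u' v = (\<Sum>i\<in>UNIV. L2_inner \<Omega> (snd ((u - u') i)) (snd (v i)))
    - L2_inner \<Omega> (\<lambda>x. F x (vec_of u x) - F x (vec_of u' x)) (vec_of v)"
  unfolding residual_def H1_vec_simps
    L2_inner_diff_left[OF H1_spaceD(3)[OF u] H1_spaceD(3)[OF u'] H1_spaceD(3)[OF v]]
    L2_inner_diff_left[OF F_L2[OF vec_of_L2[OF u]] F_L2[OF vec_of_L2[OF u']] vec_of_L2[OF v]]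
  by (simp add: sum_subtractf)

lemma residual_lipschitz:
  assumes u: "u \<in> V" and u': "u' \<in> V" and v: "v \<in> V"
  shows "\<bar>residual u v - residual u' v\<bar> \<le> (real CARD('n) + L) * nrm (u - u') * nrm v"
proof -
  have d: "u - u' \<in> V" using u u' by (rule closed_diff)
  have "\<bar>L2_inner \<Omega> (snd ((u - u') i)) (snd (v i))\<bar> \<le> nrm (u - u') * nrm v" for i
    by (rule order_trans[OF abs_L2_inner_le[OF H1_spaceD(3)[OF d] H1_spaceD(3)[OF v]]])
      (intro mult_mono nrm_ge d v nrm_nonneg real_sqrt_ge_zero L2_sq_nonneg)
  then have "\<bar>\<Sum>i\<in>UNIV. L2_inner \<Omega> (snd ((u - u') i)) (snd (v i))\<bar> \<le> (\<Sum>i\<in>(UNIV :: 'n set). nrm (u - u') * nrm v)"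
    by (intro order_trans[OF sum_abs] sum_mono)
  moreover have "\<bar>L2_inner \<Omega> (\<lambda>x. F x (vec_of u x) - F x (vec_of u' x)) (vec_of v)\<bar> \<le> (L * nrm (u - u')) * nrm v"
  proof -
    have "sqrt (L2_sq \<Omega> (\<lambda>x. F x (vec_of u x) - F x (vec_of u' x))) \<le> L * nrm (u - u')"
      using F_diff_L2[OF vec_of_L2[OF u] vec_of_L2[OF u']] mult_left_mono[OF nrm_ge(2)[OF d] L]
      unfolding vec_of_simps by (rule order_trans)
    then show ?thesis
      by (intro order_trans[OF abs_L2_inner_le[OF in_L2_diff[OF F_L2[OF vec_of_L2[OF u]] F_L2[OF vec_of_L2[OF u']]] vec_of_L2[OF v]]]
          mult_mono nrm_ge v mult_nonneg_nonneg L nrm_nonneg d real_sqrt_ge_zero L2_sq_nonneg)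
  qed
  ultimately show ?thesis unfolding residual_diff[OF assms] by (simp add: distrib_right)
qed

text \<open>The constant whose subtraction makes the component orthogonal to \<open>q i\<close>: the
  projection onto constants along the complement of \<open>q i\<close>.\<close>

definition mean :: "('a, 'n) H1_vec \<Rightarrow> 'n \<Rightarrow> real" where
  "mean u i = L2_inner \<Omega> (fst (u i)) (q i) / L2_inner \<Omega> (\<lambda>x. 1) (q i)"

text \<open>\<open>reflect\<close> changes the sign of the constant part of the splitting of \<open>H\<^sup>1\<close> into constants and
  functions orthogonal to \<open>q\<close>. The functional is concave on the former and convex on the latter.\<close>
definition reflect :: "('a, 'n) H1_vec \<Rightarrow> ('a, 'n) H1_vec" where
  "reflect u i = ((\<lambda>x. fst (u i) x - 2 * mean u i), snd (u i))"

lemma reflect_V: "u \<in> V \<Longrightarrow> reflect u \<in> V"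
  unfolding H1_space_def mem_Collect_eq reflect_def fst_conv snd_conv
  using H1_diff[OF _ H1_gradient_const[OF lmeasurable_dom]] by fastforce

lemma mean_add: "u \<in> V \<Longrightarrow> v \<in> V \<Longrightarrow> mean (u + v) i = mean u i + mean v i"
  unfolding mean_def H1_vec_simps by (subst L2_inner_add_left) (auto intro: H1_spaceD q simp: add_divide_distrib)

lemma mean_scale: "mean (r *\<^sub>R u) i = r * mean u i"
  unfolding mean_def H1_vec_simps L2_inner_scale_left by simp

lemma reflect_add: "u \<in> V \<Longrightarrow> v \<in> V \<Longrightarrow> reflect (u + v) = reflect u + reflect v"
  by (rule ext, rule prod_eqI) (simp_all add: reflect_def mean_add fun_eq_iff)

lemma reflect_scale: "reflect (r *\<^sub>R u) = r *\<^sub>R reflect u"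
  by (rule ext, rule prod_eqI)
    (simp_all only: reflect_def mean_scale H1_vec_simps fst_conv snd_conv, simp add: algebra_simps)

lemma L2_inner_const_q: "L2_inner \<Omega> (\<lambda>x. t) (q i) = t * L2_inner \<Omega> (\<lambda>x. 1) (q i)"
  using L2_inner_scale_left[of \<Omega> t "\<lambda>x. 1" "q i"] by simp

lemma mean_reflect:
  assumes u: "u \<in> V"
  shows "mean (reflect u) i = - mean u i"
proof -
  have "L2_inner \<Omega> (fst (reflect u i)) (q i) = L2_inner \<Omega> (fst (u i)) (q i) - 2 * mean u i * L2_inner \<Omega> (\<lambda>x. 1) (q i)"
    unfolding reflect_def fst_conv
      L2_inner_diff_left[OF H1_spaceD(2)[OF u] in_L2_const q] L2_inner_const_q[of "2 * mean u i"] ..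
  then show ?thesis unfolding mean_def[of "reflect u"] using q1[of i] by (simp add: mean_def diff_divide_distrib)
qed

lemma reflect_reflect: "u \<in> V \<Longrightarrow> reflect (reflect u) = u"
  by (rule ext, rule prod_eqI) (simp_all add: reflect_def[of "reflect u"] mean_reflect, simp_all add: reflect_def)

lemma vec_of_reflect: "vec_of (reflect u) = (\<lambda>x. vec_of u x - 2 *\<^sub>R (\<chi> i. mean u i))"
  by (simp add: vec_of_def[abs_def] reflect_def fun_eq_iff vec_eq_iff)

definition vol :: real where "vol = L2_sq \<Omega> (\<lambda>x. 1 :: real)"

lemma vol_nonneg: "0 \<le> vol"
  by (simp add: vol_def L2_sq_nonneg)

lemma L2_sq_const: "L2_sq \<Omega> (\<lambda>x. t :: real) = t\<^sup>2 * vol"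
  using L2_inner_scale_left[of \<Omega> t "\<lambda>x. 1 :: real" "\<lambda>x. t"] L2_inner_scale_right[of \<Omega> "\<lambda>x. 1 :: real" t "\<lambda>x. 1"]
  by (simp add: vol_def power2_eq_square)

lemma nrm_reflect: "\<exists>K\<ge>0. \<forall>u\<in>V. nrm (reflect u) \<le> K * nrm u"
proof -
  \<comment> \<open>Subtracting twice the mean adds at most
    \<open>2 * L2_sq \<Omega> (\<lambda>x. 2 * mean u i)\<close>, that is 8 times \<open>vol\<close>
    times the squared mean, and Cauchy-Schwarz against \<open>q i\<close> bounds the squared
    mean.\<close>
  define k where "k i = 8 * (vol * (L2_sq \<Omega> (q i) / (L2_inner \<Omega> (\<lambda>x. 1) (q i))\<^sup>2))" for i
  have k: "k i \<ge> 0" for i unfolding k_def using vol_nonneg L2_sq_nonneg by (intro mult_nonneg_nonneg divide_nonneg_nonneg) auto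
  define K where "K = 2 + (\<Sum>i\<in>UNIV. k i)"
  have ki: "k i \<le> (\<Sum>i\<in>UNIV. k i)" for i using k by (intro member_le_sum) auto
  have K: "K \<ge> 2" using k by (simp add: K_def sum_nonneg)
  have "nrm (reflect u) \<le> sqrt K * nrm u" if u: "u \<in> V" for u
  proof -
    have "L2_sq \<Omega> (fst (reflect u i)) + L2_sq \<Omega> (snd (reflect u i)) \<le> K * (L2_sq \<Omega> (fst (u i)) + L2_sq \<Omega> (snd (u i)))" for i
    proof -
      have "(mean u i)\<^sup>2 \<le> L2_sq \<Omega> (fst (u i)) * (L2_sq \<Omega> (q i) / (L2_inner \<Omega> (\<lambda>x. 1) (q i))\<^sup>2)"
        unfolding mean_def power_divide using L2_inner_sq_le[OF H1_spaceD(2)[OF u] q, of i i] by (simp add: divide_right_mono)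
      then have "8 * (vol * (mean u i)\<^sup>2) \<le> 8 * (vol * (L2_sq \<Omega> (fst (u i)) * (L2_sq \<Omega> (q i) / (L2_inner \<Omega> (\<lambda>x. 1) (q i))\<^sup>2)))"
        by (intro mult_left_mono vol_nonneg) auto
      also have "\<dots> = k i * L2_sq \<Omega> (fst (u i))" by (simp add: k_def)
      finally have 1: "8 * (vol * (mean u i)\<^sup>2) \<le> k i * L2_sq \<Omega> (fst (u i))" .
      have "L2_sq \<Omega> (fst (reflect u i)) \<le> 2 * L2_sq \<Omega> (fst (u i)) + 2 * L2_sq \<Omega> (\<lambda>x. 2 * mean u i)"
        unfolding reflect_def fst_conv by (rule L2_sq_diff_le[OF H1_spaceD(2)[OF u] in_L2_const])
      also have "2 * L2_sq \<Omega> (\<lambda>x. 2 * mean u i) = 8 * (vol * (mean u i)\<^sup>2)"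
        unfolding L2_sq_const by (simp add: power_mult_distrib)
      finally have "L2_sq \<Omega> (fst (reflect u i)) \<le> (2 + k i) * L2_sq \<Omega> (fst (u i))" using 1 by (simp add: distrib_right)
      also have "\<dots> \<le> K * L2_sq \<Omega> (fst (u i))" using ki[of i] by (intro mult_right_mono L2_sq_nonneg) (simp add: K_def)
      finally have 2: "L2_sq \<Omega> (fst (reflect u i)) \<le> K * L2_sq \<Omega> (fst (u i))" .
      have "1 * L2_sq \<Omega> (snd (u i)) \<le> K * L2_sq \<Omega> (snd (u i))" using K by (intro mult_right_mono L2_sq_nonneg) auto
      then show ?thesis using 2 by (simp add: reflect_def distrib_left)
    qed
    then have "H1_inner \<Omega> (reflect u) (reflect u) \<le> K * H1_inner \<Omega> u u"
      unfolding H1_inner_def sum_distrib_left by (intro sum_mono)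
    then have "sqrt (H1_inner \<Omega> (reflect u) (reflect u)) \<le> sqrt (K * H1_inner \<Omega> u u)" by (rule real_sqrt_le_mono)
    then show ?thesis by (simp add: nrm_def real_sqrt_mult)
  qed
  then show ?thesis using K by (intro exI[of _ "sqrt K"]) auto
qed

text \<open>Let \<open>k\<close> be the mean of \<open>d = u - u'\<close> and
  \<open>w = d - k\<close>. Reflection turns \<open>d\<close> into \<open>d - 2 *\<^sub>R k\<close>,
  to which \<open>F_split\<close> applies pointwise. The terms in \<open>w\<close> are combined with
  the gradients of \<open>d\<close>, which are those of \<open>w\<close>, through
  \<open>gap\<close>; the term in \<open>k\<close> enters with the favourable sign through
  \<open>A_pos\<close>.\<close>

lemma residual_monotone:
  assumes u: "u \<in> V" and u': "u' \<in> V"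
  shows "min (c / 2) (m / (2 * (vol + 1))) * (nrm (u - u'))\<^sup>2 \<le> residual u (reflect (u - u')) - residual u' (reflect (u - u'))"
proof -
  let ?I = "\<lambda>F. LINT x|lebesgue_on \<Omega>. F x"
  define d where "d = u - u'"
  have d: "d \<in> V" unfolding d_def using u u' by (rule closed_diff)
  define k :: "real ^ 'n" where "k = (\<chi> i. mean d i)"
  define w where "w i x = fst (d i) x - mean d i" for i x
  have w: "H1_gradient \<Omega> (w i) (snd (d i))" for i
    unfolding w_def using H1_diff[OF H1_spaceD(1)[OF d] H1_gradient_const[OF lmeasurable_dom]] by simp
  note wL2 = H1_gradient_L2(1)[OF w]
  have wq: "L2_inner \<Omega> (w i) (q i) = 0" for i
    unfolding w_def L2_inner_diff_left[OF H1_spaceD(2)[OF d] in_L2_const q] L2_inner_const_q[of "mean d i"]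
    using q1[of i] by (simp add: mean_def)
  have bw: "integrable (lebesgue_on \<Omega>) (\<lambda>x. b i x * (w i x)\<^sup>2)" for i
  proof -
    have "in_L2 \<Omega> (\<lambda>x. b i x *\<^sub>R w i x)" by (rule in_L2_mult_bounded[OF wL2 b_meas b_bound])
    from in_L2_mult_integrable[OF this[simplified] wL2] show ?thesis by (simp add: power2_eq_square mult.assoc)
  qed
  have dL2: "in_L2 \<Omega> (\<lambda>x. F x (vec_of u x) - F x (vec_of u' x))"
    by (intro in_L2_diff F_L2 vec_of_L2 u u')
  have "L2_inner \<Omega> (\<lambda>x. F x (vec_of u x) - F x (vec_of u' x)) (vec_of (reflect d))
      \<le> ?I (\<lambda>x. (\<Sum>i\<in>UNIV. b i x * (w i x)\<^sup>2) - (A x *v k) \<bullet> k)"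
    unfolding L2_inner_def
  proof (rule integral_mono)
    show "integrable (lebesgue_on \<Omega>) (\<lambda>x. (F x (vec_of u x) - F x (vec_of u' x)) \<bullet> vec_of (reflect d) x)"
      by (rule in_L2_inner_integrable[OF dL2 vec_of_L2[OF reflect_V[OF d]]])
    show "integrable (lebesgue_on \<Omega>) (\<lambda>x. (\<Sum>i\<in>UNIV. b i x * (w i x)\<^sup>2) - (A x *v k) \<bullet> k)"
      by (intro Bochner_Integration.integrable_diff Bochner_Integration.integrable_sum bw A_int)
    fix x assume "x \<in> space (lebesgue_on \<Omega>)"
    then have x: "x \<in> \<Omega>" by simp
    have "vec_of (reflect d) x = (vec_of u x - vec_of u' x) - 2 *\<^sub>R k"
      unfolding vec_of_reflect k_def by (simp add: d_def vec_of_simps)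
    moreover have "(vec_of u x - vec_of u' x) $ i - k $ i = w i x" for i
      unfolding w_def k_def d_def H1_vec_simps by (simp add: vec_of_def)
    ultimately show "(F x (vec_of u x) - F x (vec_of u' x)) \<bullet> vec_of (reflect d) x \<le> (\<Sum>i\<in>UNIV. b i x * (w i x)\<^sup>2) - (A x *v k) \<bullet> k"
      using F_split[OF x, of "vec_of u x" "vec_of u' x" k] by simp
  qed
  also have "\<dots> = (\<Sum>i\<in>UNIV. ?I (\<lambda>x. b i x * (w i x)\<^sup>2)) - ?I (\<lambda>x. (A x *v k) \<bullet> k)"
    using bw A_int by (simp add: Bochner_Integration.integral_diff Bochner_Integration.integrable_sum)
  finally have 1: "L2_inner \<Omega> (\<lambda>x. F x (vec_of u x) - F x (vec_of u' x)) (vec_of (reflect d))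
      \<le> (\<Sum>i\<in>UNIV. ?I (\<lambda>x. b i x * (w i x)\<^sup>2)) - m * (norm k)\<^sup>2" using A_pos[of k] by linarith
  have "residual u (reflect d) - residual u' (reflect d) = (\<Sum>i\<in>UNIV. L2_sq \<Omega> (snd (d i)))
      - L2_inner \<Omega> (\<lambda>x. F x (vec_of u x) - F x (vec_of u' x)) (vec_of (reflect d))"
    unfolding residual_diff[OF u u' reflect_V[OF d]] d_def[symmetric] by (simp add: reflect_def)
  then have "(\<Sum>i\<in>UNIV. L2_sq \<Omega> (snd (d i)) - ?I (\<lambda>x. b i x * (w i x)\<^sup>2)) + m * (norm k)\<^sup>2
      \<le> residual u (reflect d) - residual u' (reflect d)" using 1 by (simp add: sum_subtractf)
  moreover have "(\<Sum>i\<in>UNIV. c * (L2_sq \<Omega> (w i) + L2_sq \<Omega> (snd (d i)))) \<le> (\<Sum>i\<in>UNIV. L2_sq \<Omega> (snd (d i)) - ?I (\<lambda>x. b i x * (w i x)\<^sup>2))"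
    by (intro sum_mono gap w wq)
  moreover have "min (c / 2) (m / (2 * (vol + 1))) * (nrm d)\<^sup>2 \<le> (\<Sum>i\<in>UNIV. c * (L2_sq \<Omega> (w i) + L2_sq \<Omega> (snd (d i)))) + m * (norm k)\<^sup>2"
  proof -
    \<comment> \<open>Since \<open>d = w + k\<close>, its squared norm is at most twice that of
      \<open>w\<close> plus twice \<open>vol\<close> times the squared \<open>k\<close>. So
      \<open>2 * ?\<kappa> \<le> c\<close> and \<open>2 * ?\<kappa> * vol \<le> m\<close> are what
      is asked of the constant; \<open>vol + 1\<close> keeps the denominator positive.\<close>
    let ?\<kappa> = "min (c / 2) (m / (2 * (vol + 1)))"
    have \<kappa>: "?\<kappa> \<ge> 0" "2 * ?\<kappa> \<le> c" using c m vol_nonneg by auto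
    have \<kappa>m: "2 * ?\<kappa> * vol \<le> m"
    proof -
      have "?\<kappa> * (vol + 1) \<le> m / (2 * (vol + 1)) * (vol + 1)" using vol_nonneg by (intro mult_right_mono) auto
      also have "\<dots> = m / 2" using vol_nonneg by (simp add: field_simps)
      finally have "?\<kappa> * vol + ?\<kappa> \<le> m / 2" by (simp only: distrib_left mult_1_right)
      then show ?thesis using \<kappa>(1) unfolding mult.assoc by linarith
    qed
    have "?\<kappa> * (L2_sq \<Omega> (fst (d i)) + L2_sq \<Omega> (snd (d i))) \<le> c * (L2_sq \<Omega> (w i) + L2_sq \<Omega> (snd (d i))) + m * (k $ i)\<^sup>2" for i
    proof -
      have "(\<lambda>x. w i x - (- mean d i)) = fst (d i)" by (simp add: w_def fun_eq_iff)
      then have "L2_sq \<Omega> (fst (d i)) \<le> 2 * L2_sq \<Omega> (w i) + 2 * L2_sq \<Omega> (\<lambda>x. - mean d i)"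
        using L2_sq_diff_le[OF wL2[of i] in_L2_const[of "- mean d i"]] by simp
      also have "L2_sq \<Omega> (\<lambda>x. - mean d i) = (k $ i)\<^sup>2 * vol" unfolding L2_sq_const k_def by simp
      finally have "?\<kappa> * L2_sq \<Omega> (fst (d i)) \<le> ?\<kappa> * (2 * L2_sq \<Omega> (w i) + 2 * ((k $ i)\<^sup>2 * vol))" using \<kappa>(1) by (rule mult_left_mono)
      also have "\<dots> = (2 * ?\<kappa>) * L2_sq \<Omega> (w i) + (2 * ?\<kappa> * vol) * (k $ i)\<^sup>2" by (simp only: distrib_left ac_simps)
      also have "\<dots> \<le> c * L2_sq \<Omega> (w i) + m * (k $ i)\<^sup>2"
        using \<kappa> \<kappa>m by (intro add_mono mult_right_mono L2_sq_nonneg) auto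
      finally have "?\<kappa> * L2_sq \<Omega> (fst (d i)) \<le> c * L2_sq \<Omega> (w i) + m * (k $ i)\<^sup>2" .
      moreover have "?\<kappa> * L2_sq \<Omega> (snd (d i)) \<le> c * L2_sq \<Omega> (snd (d i))"
        using \<kappa> by (intro mult_right_mono L2_sq_nonneg) linarith
      ultimately show ?thesis unfolding distrib_left by linarith
    qed
    then have "(\<Sum>i\<in>UNIV. ?\<kappa> * (L2_sq \<Omega> (fst (d i)) + L2_sq \<Omega> (snd (d i))))
        \<le> (\<Sum>i\<in>UNIV. c * (L2_sq \<Omega> (w i) + L2_sq \<Omega> (snd (d i))) + m * (k $ i)\<^sup>2)" by (intro sum_mono)
    moreover have "(\<Sum>i\<in>UNIV. (k $ i)\<^sup>2) = (norm k)\<^sup>2"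
      unfolding power2_norm_eq_inner inner_vec_def by (simp add: power2_eq_square)
    ultimately show ?thesis
      unfolding nrm_sq[OF d] H1_inner_def by (simp add: sum.distrib sum_distrib_left[symmetric])
  qed
  ultimately show ?thesis unfolding d_def by linarith
qed

lemma monotonicity_constant_pos: "min (c / 2) (m / (2 * (vol + 1))) > 0"
  using c m vol_nonneg by simp

text \<open>The strongly monotone operator is \<open>residual u (reflect v)\<close>. As
  \<open>reflect\<close> is a linear involution of \<open>V\<close>, vanishing on all reflected
  vectors is vanishing on all vectors.\<close>

lemma residual_zero_exists: "\<exists>u\<in>V. \<forall>v\<in>V. residual u v = 0"
proof -
  obtain K where K: "K \<ge> 0" "\<And>u. u \<in> V \<Longrightarrow> nrm (reflect u) \<le> K * nrm u" using nrm_reflect by blast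
  have "\<exists>u\<in>V. \<forall>v\<in>V. residual u (reflect v) = 0"
  proof (rule strongly_monotone_zero[where \<Phi> = "\<lambda>u v. residual u (reflect v)"])
    show "residual u (reflect (x + y)) = residual u (reflect x) + residual u (reflect y)" if "u \<in> V" "x \<in> V" "y \<in> V" for u x y
      using that by (simp add: reflect_add residual_add reflect_V)
    show "residual u (reflect (r *\<^sub>R x)) = r * residual u (reflect x)" for u x r by (simp add: reflect_scale residual_scale)
    show "\<exists>M. \<forall>x\<in>V. \<bar>residual u (reflect x)\<bar> \<le> M * nrm x" if u: "u \<in> V" for u
    proof -
      define S where "S = (\<Sum>i\<in>UNIV. sqrt (L2_sq \<Omega> (snd (u i)))) + sqrt (L2_sq \<Omega> (\<lambda>x. F x (vec_of u x)))"
      have S: "S \<ge> 0" unfolding S_def by (intro add_nonneg_nonneg sum_nonneg real_sqrt_ge_zero L2_sq_nonneg)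
      have "\<bar>residual u (reflect x)\<bar> \<le> (S * K) * nrm x" if x: "x \<in> V" for x
        using residual_bound[OF u reflect_V[OF x]] mult_left_mono[OF K(2)[OF x] S] unfolding S_def[symmetric] by (simp add: mult.assoc)
      then show ?thesis by blast
    qed
    show "\<bar>residual u (reflect x) - residual v (reflect x)\<bar> \<le> ((real CARD('n) + L) * K) * nrm (u - v) * nrm x"
      if "u \<in> V" "v \<in> V" "x \<in> V" for u v x
    proof -
      have "\<bar>residual u (reflect x) - residual v (reflect x)\<bar> \<le> (real CARD('n) + L) * nrm (u - v) * nrm (reflect x)"
        using that by (intro residual_lipschitz reflect_V)
      also have "\<dots> \<le> (real CARD('n) + L) * nrm (u - v) * (K * nrm x)"
        using that L by (intro mult_left_mono K mult_nonneg_nonneg nrm_nonneg closed_diff) auto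
      finally show ?thesis by (simp only: ac_simps)
    qed
  qed (rule residual_monotone monotonicity_constant_pos | assumption)+
  then obtain u where u: "u \<in> V" "\<And>v. v \<in> V \<Longrightarrow> residual u (reflect v) = 0" by blast
  have "residual u v = 0" if "v \<in> V" for v using u(2)[OF reflect_V[OF that]] reflect_reflect[OF that] by simp
  then show ?thesis using u(1) by blast
qed

text \<open>By strong monotonicity the seminorm of the difference is 0, and it dominates the square
  norm of the functions.\<close>

lemma residual_zero_unique:
  assumes "u \<in> V" "u' \<in> V" "\<And>v. v \<in> V \<Longrightarrow> residual u v = 0" "\<And>v. v \<in> V \<Longrightarrow> residual u' v = 0"
  shows "AE x in lebesgue_on \<Omega>. vec_of u x = vec_of u' x"
proof -
  have d: "u - u' \<in> V" using assms by (intro closed_diff)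
  have "min (c / 2) (m / (2 * (vol + 1))) * (nrm (u - u'))\<^sup>2 \<le> 0"
    using residual_monotone[OF assms(1,2)] assms(3,4)[OF reflect_V[OF d]] by simp
  then have "(nrm (u - u'))\<^sup>2 \<le> 0"
    using mult_pos_pos[OF monotonicity_constant_pos, of "(nrm (u - u'))\<^sup>2"] by (meson not_le)
  then have "nrm (u - u') = 0" by simp
  then have "sqrt (L2_sq \<Omega> (vec_of (u - u'))) \<le> 0" using nrm_ge(2)[OF d] by simp
  then have "L2_sq \<Omega> (vec_of (u - u')) = 0" using L2_sq_nonneg[of \<Omega> "vec_of (u - u')"] by simp
  then have z: "(LINT x|lebesgue_on \<Omega>. (norm (vec_of (u - u') x))\<^sup>2) = 0" by (simp add: L2_sq_eq)
  have "integrable (lebesgue_on \<Omega>) (\<lambda>x. (norm (vec_of (u - u') x))\<^sup>2)" using vec_of_L2[OF d] by (simp add: in_L2_def)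
  from integral_nonneg_eq_0_iff_AE[OF this] z
  have "AE x in lebesgue_on \<Omega>. (norm (vec_of (u - u') x))\<^sup>2 = 0" by simp
  then show ?thesis by eventually_elim (simp add: vec_of_simps)
qed

lemma weak_solution_iff_residual:
  assumes u: "u \<in> V"
  shows "(\<forall>v\<in>V. residual u v = 0) \<longleftrightarrow> (\<forall>i v Dv. H1_gradient \<Omega> v Dv \<longrightarrow>
     L2_inner \<Omega> (snd (u i)) Dv = L2_inner \<Omega> (\<lambda>x. F x (vec_of u x) $ i) v)"
proof -
  have res: "residual u v = (\<Sum>i\<in>UNIV. L2_inner \<Omega> (snd (u i)) (snd (v i)) - L2_inner \<Omega> (\<lambda>x. F x (vec_of u x) $ i) (fst (v i)))"
    if "v \<in> V" for v
    unfolding residual_def L2_inner_vec[OF F_L2[OF vec_of_L2[OF u]] vec_of_L2[OF that]]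
    by (simp add: sum_subtractf vec_of_def)
  show ?thesis
  proof (intro iffI allI impI ballI)
    fix v assume R: "\<forall>i v Dv. H1_gradient \<Omega> v Dv \<longrightarrow> L2_inner \<Omega> (snd (u i)) Dv = L2_inner \<Omega> (\<lambda>x. F x (vec_of u x) $ i) v"
      and v: "v \<in> V"
    show "residual u v = 0" unfolding res[OF v]
      by (intro sum.neutral ballI) (simp add: R[rule_format, OF H1_spaceD(1)[OF v]])
  next
    fix i v Dv assume z: "\<forall>v\<in>V. residual u v = 0" and H: "H1_gradient \<Omega> v Dv"
    \<comment> \<open>A test vector with one nonzero component isolates the \<open>i\<close>-th
      equation.\<close>
    define e :: "('a, 'n) H1_vec" where "e j = (if j = i then (v, Dv) else ((\<lambda>x. 0), (\<lambda>x. 0)))" for j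
    have e: "e \<in> V" using H H1_gradient_const[OF lmeasurable_dom, of 0] by (simp add: H1_space_def e_def)
    have "L2_inner \<Omega> (snd (u j)) (snd (e j)) - L2_inner \<Omega> (\<lambda>x. F x (vec_of u x) $ j) (fst (e j))
        = (if j = i then L2_inner \<Omega> (snd (u i)) Dv - L2_inner \<Omega> (\<lambda>x. F x (vec_of u x) $ i) v else 0)" for j
      by (simp add: e_def L2_inner_def)
    then have "residual u e = L2_inner \<Omega> (snd (u i)) Dv - L2_inner \<Omega> (\<lambda>x. F x (vec_of u x) $ i) v"
      unfolding res[OF e] by simp
    then show "L2_inner \<Omega> (snd (u i)) Dv = L2_inner \<Omega> (\<lambda>x. F x (vec_of u x) $ i) v" using z e by simp
  qed
qed

end

section \<open>Gradients with bounded Hessian\<close>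

lemma frechet_derivative_eq_grad:
  assumes "class_C (Suc k) \<phi>"
  shows "frechet_derivative \<phi> (at x) h = grad \<phi> x \<bullet> h"
  unfolding grad_def inner_sum_left
  by (subst frechet_derivative_eq_sum[OF class_C_has_derivative[OF assms]]) (simp add: inner_commute mult.commute)

lemma grad_has_derivative:
  assumes "class_C 2 \<phi>"
  shows "(grad \<phi> has_derivative (\<lambda>h. hessian \<phi> x *v h)) (at x)"
proof -
  have "(\<lambda>y. frechet_derivative \<phi> (at y) b) differentiable (at x)" if "b \<in> Basis" for b
    using assms that by (simp add: numeral_2_eq_2 differentiable_on_def)
  then have "(\<lambda>y. \<Sum>b\<in>Basis. frechet_derivative \<phi> (at y) b *\<^sub>R b) differentiable (at x)"
    by (intro differentiable_sum ballI differentiable_scaleR differentiable_const) auto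
  then have "grad \<phi> differentiable (at x)" by (simp add: grad_def[abs_def])
  then show ?thesis unfolding hessian_def jacobian_works .
qed

text \<open>The scalar mean value theorem along the segment. The direction \<open>e\<close> is fixed
  first because in general no single \<open>z\<close> serves all directions.\<close>

lemma grad_increment:
  assumes "class_C 2 \<phi>"
  shows "\<exists>z. (grad \<phi> a - grad \<phi> a') \<bullet> e = (hessian \<phi> z *v (a - a')) \<bullet> e"
proof -
  define p where "p t = a' + t *\<^sub>R (a - a')" for t :: real
  have "((\<lambda>t. grad \<phi> (p t) \<bullet> e) has_real_derivative (hessian \<phi> (p t) *v (a - a')) \<bullet> e) (at t)" for t
  proof -
    have "(p has_derivative (\<lambda>s. s *\<^sub>R (a - a'))) (at t)" unfolding p_def by (auto intro!: derivative_eq_intros)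
    from has_derivative_compose[OF this grad_has_derivative[OF assms]]
    have "((\<lambda>t. grad \<phi> (p t) \<bullet> e) has_derivative (\<lambda>s. (hessian \<phi> (p t) *v (s *\<^sub>R (a - a'))) \<bullet> e)) (at t)"
      by (rule has_derivative_inner_left)
    moreover have "(\<lambda>s. (hessian \<phi> (p t) *v (s *\<^sub>R (a - a'))) \<bullet> e) = (*) ((hessian \<phi> (p t) *v (a - a')) \<bullet> e)"
      by (simp add: fun_eq_iff matrix_vector_mult_scaleR)
    ultimately show ?thesis by (simp add: has_field_derivative_def)
  qed
  from MVT2[of 0 1 "\<lambda>t. grad \<phi> (p t) \<bullet> e" "\<lambda>t. (hessian \<phi> (p t) *v (a - a')) \<bullet> e", OF _ this]
  obtain t where "grad \<phi> (p 1) \<bullet> e - grad \<phi> (p 0) \<bullet> e = (hessian \<phi> (p t) *v (a - a')) \<bullet> e" by auto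
  then show ?thesis by (intro exI[of _ "p t"]) (simp add: p_def inner_diff_left)
qed

section \<open>Quadratic forms of symmetric matrices\<close>

lemma loewner_leD:
  assumes "loewner_le C D"
  shows "transpose C = C" "transpose D = D" "(C *v k) \<bullet> k \<le> (D *v k) \<bullet> k"
  using assms by (auto simp: loewner_le_def matrix_vector_mult_diff_rdistrib inner_diff_left)

lemma symmetric_matrix_inner:
  fixes H :: "real ^ 'n ^ 'n"
  assumes "transpose H = H"
  shows "(H *v a) \<bullet> b = (H *v b) \<bullet> a"
proof -
  have "(H *v a) \<bullet> b = (a v* H) \<bullet> b" using transpose_matrix_vector[of H a] assms by simp
  also have "\<dots> = a \<bullet> (H *v b)" by (rule dot_lmul_matrix)
  finally show ?thesis by (simp add: inner_commute)
qed

text \<open>\<open>K\<close> times the identity minus \<open>H\<close> is positive semidefinite,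
  with quadratic form at most \<open>2 * K * (norm v)\<^sup>2\<close>. Cauchy-Schwarz for this form
  contributes \<open>2 * K\<close>, and restoring \<open>K\<close> times the inner product makes it
  \<open>3 * K\<close>.\<close>

lemma symmetric_matrix_bound:
  fixes H :: "real ^ 'n ^ 'n"
  assumes sym: "transpose H = H" and K: "\<And>v. \<bar>(H *v v) \<bullet> v\<bar> \<le> K * (norm v)\<^sup>2"
  shows "\<bar>(H *v a) \<bullet> b\<bar> \<le> 3 * K * norm a * norm b"
proof -
  have K0: "K \<ge> 0"
  proof -
    \<comment> \<open>\<open>axis undefined 1\<close> is just some unit vector, on which the
      hypothesis bounds \<open>K\<close> from below.\<close>
    have "0 \<le> \<bar>(H *v axis undefined 1) \<bullet> axis undefined 1\<bar>" by (rule abs_ge_zero)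
    also have "\<dots> \<le> K * (norm (axis undefined 1 :: real ^ 'n))\<^sup>2" by (rule K)
    finally show ?thesis by simp
  qed
  define P where "P v w = K * (v \<bullet> w) - (H *v v) \<bullet> w" for v w
  have P_le: "0 \<le> P v v" "P v v \<le> 2 * K * (norm v)\<^sup>2" for v
    using K[of v] by (auto simp: P_def power2_norm_eq_inner abs_le_iff)
  have "(P a b)\<^sup>2 \<le> P a a * P b b"
  proof (rule quadratic_nonneg_imp)
    fix t
    have "P (a + t *\<^sub>R b) (a + t *\<^sub>R b) = P a a + 2 * t * P a b + t\<^sup>2 * P b b"
      unfolding P_def matrix_vector_right_distrib matrix_vector_mult_scaleR inner_add_left inner_add_right
        inner_scaleR_left inner_scaleR_right symmetric_matrix_inner[OF sym, of b a] inner_commute[of b a]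
      by (simp add: algebra_simps power2_eq_square)
    then show "0 \<le> P a a + 2 * t * P a b + t\<^sup>2 * P b b" using P_le(1) by metis
  qed
  also have "\<dots> \<le> (2 * K * (norm a)\<^sup>2) * (2 * K * (norm b)\<^sup>2)"
    using P_le K0 by (intro mult_mono) auto
  also have "\<dots> = (2 * K * norm a * norm b)\<^sup>2" by (simp add: power2_eq_square algebra_simps)
  finally have "\<bar>P a b\<bar> \<le> \<bar>2 * K * norm a * norm b\<bar>" by (rule abs_le_square_iff[THEN iffD2])
  also have "\<dots> = 2 * K * norm a * norm b" using K0 by (intro abs_of_nonneg mult_nonneg_nonneg) auto
  finally have "\<bar>P a b\<bar> \<le> 2 * K * norm a * norm b" .
  moreover have "\<bar>K * (a \<bullet> b)\<bar> \<le> K * (norm a * norm b)"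
    unfolding abs_mult abs_of_nonneg[OF K0] by (rule mult_left_mono[OF Cauchy_Schwarz_ineq2 K0])
  moreover have "(H *v a) \<bullet> b = K * (a \<bullet> b) - P a b" by (simp add: P_def)
  moreover have "3 * K * norm a * norm b = 2 * K * norm a * norm b + K * (norm a * norm b)" by (simp add: algebra_simps)
  ultimately show ?thesis using abs_triangle_ineq4[of "K * (a \<bullet> b)" "P a b"] by linarith
qed

lemma matrix_form_bound:
  fixes C :: "real ^ 'n ^ 'n"
  assumes "norm C \<le> K"
  shows "\<bar>(C *v v) \<bullet> v\<bar> \<le> (real CARD('n) * real CARD('n) * K) * (norm v)\<^sup>2"
proof -
  have "\<bar>C $ i $ j\<bar> \<le> K" for i j
    using component_le_norm_cart[of "C $ i" j] Finite_Cartesian_Product.norm_nth_le[of C i] assms by linarith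
  then have "onorm ((*v) C) \<le> real CARD('n) * real CARD('n) * K" by (rule onorm_le_matrix_component)
  have "\<bar>(C *v v) \<bullet> v\<bar> \<le> norm (C *v v) * norm v" by (rule Cauchy_Schwarz_ineq2)
  also have "\<dots> \<le> (onorm ((*v) C) * norm v) * norm v"
    by (intro mult_right_mono onorm matrix_vector_mul_bounded_linear) auto
  also have "\<dots> \<le> (real CARD('n) * real CARD('n) * K * norm v) * norm v"
    using \<open>onorm _ \<le> _\<close> by (intro mult_right_mono) auto
  finally show ?thesis by (simp add: power2_eq_square mult.assoc)
qed

lemma matrix_form_expand: "(C *v k) \<bullet> k = (\<Sum>i\<in>UNIV. \<Sum>j\<in>UNIV. C $ i $ j * k $ j * k $ i)" for C :: "real ^ 'n ^ 'n"
  by (simp add: inner_vec_def matrix_vector_mult_def sum_distrib_right)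

lemma Lp_norm_mono:
  assumes [measurable]: "f \<in> borel_measurable (lebesgue_on \<Omega>)" and le: "\<And>x. \<bar>f x\<bar> \<le> \<bar>h x\<bar>"
  shows "Lp_norm \<Omega> p f \<le> Lp_norm \<Omega> p h"
proof (cases "p = \<infinity>")
  case True
  then show ?thesis unfolding Lp_norm_def by (simp add: esssup_mono ennreal_leI le)
next
  case False
  let ?I = "\<lambda>f. \<integral>\<^sup>+ x. ennreal (\<bar>f x\<bar> powr enn2real p) \<partial>lebesgue_on \<Omega>"
  have I: "?I f \<le> ?I h" by (intro nn_integral_mono ennreal_leI powr_mono2 le) auto
  show ?thesis
  proof (cases "?I h = \<infinity>")
    case True
    then show ?thesis using False by (simp add: Lp_norm_def Let_def)
  next
    case hfin: False
    then have "?I f \<noteq> \<infinity>" using I by (auto simp: top_unique)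
    moreover have "enn2real (?I f) \<le> enn2real (?I h)" using I hfin by (intro enn2real_mono) (auto simp: less_top)
    then have "enn2real (?I f) powr (1 / enn2real p) \<le> enn2real (?I h) powr (1 / enn2real p)"
      by (intro powr_mono2) auto
    ultimately show ?thesis using False hfin by (simp add: Lp_norm_def Let_def ennreal_leI)
  qed
qed

context regular_bounded
begin

text \<open>If \<open>b\<close> vanishes almost everywhere, the weight 1 replaces it.\<close>

lemma weight_with_gap:
  fixes b :: "'a \<Rightarrow> real"
  assumes bm [measurable]: "b \<in> borel_measurable (lebesgue_on \<Omega>)"
    and b: "\<And>x. 0 \<le> b x" "\<And>x. x \<in> \<Omega> \<Longrightarrow> b x \<le> M"
    and norm: "Lp_norm \<Omega> p b < beta \<Omega> p"
  shows "\<exists>q c. in_L2 \<Omega> q \<and> L2_inner \<Omega> (\<lambda>x. 1) q \<noteq> 0 \<and> c > 0 \<and> (\<forall>f g. H1_gradient \<Omega> f g \<longrightarrow> L2_inner \<Omega> f q = 0 \<longrightarrow>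
    c * (L2_sq \<Omega> f + L2_sq \<Omega> g) \<le> L2_sq \<Omega> g - (LINT x|lebesgue_on \<Omega>. b x * (f x)\<^sup>2))"
proof -
  have bL2: "in_L2 \<Omega> b" by (rule in_L2_bounded[OF lmeasurable_dom bm, of M]) (use b in auto)
  have "integrable (lebesgue_on \<Omega>) b"
    using in_L2_mult_integrable[OF bL2 in_L2_const[of 1]] by simp
  have b0: "0 \<le> (LINT x|lebesgue_on \<Omega>. b x)" using b(1) by (intro integral_nonneg_AE) auto
  show ?thesis
  proof (cases "(LINT x|lebesgue_on \<Omega>. b x) = 0")
    case True
    have "AE x in lebesgue_on \<Omega>. b x = 0"
      using integral_nonneg_eq_0_iff_AE[OF \<open>integrable (lebesgue_on \<Omega>) b\<close>] b(1) True by simp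
    have zero: "(LINT x|lebesgue_on \<Omega>. b x * (f x)\<^sup>2) = 0" if "in_L2 \<Omega> f" for f
    proof -
      have [measurable]: "f \<in> borel_measurable (lebesgue_on \<Omega>)" using that by (simp add: in_L2_def)
      have "AE x in lebesgue_on \<Omega>. b x * (f x)\<^sup>2 = 0" using \<open>AE x in lebesgue_on \<Omega>. b x = 0\<close> by eventually_elim simp
      then have "(LINT x|lebesgue_on \<Omega>. b x * (f x)\<^sup>2) = (LINT x|lebesgue_on \<Omega>. 0)" by (intro integral_cong_AE) auto
      then show ?thesis by simp
    qed
    have "measure lebesgue \<Omega> > 0"
    proof -
      obtain x where "x \<in> \<Omega>" using regular_dom by (auto simp: regular_domain_def)
      then obtain r where r: "r > 0" "ball x r \<subseteq> \<Omega>" using open_dom open_contains_ball by blast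
      have "0 < measure lebesgue (ball x r)" using content_ball_pos[OF r(1), of x] by simp
      also have "\<dots> \<le> measure lebesgue \<Omega>" using r(2) lmeasurable_dom by (intro measure_mono_fmeasurable) auto
      finally show ?thesis .
    qed
    then have one: "L2_inner \<Omega> (\<lambda>x. 1) (\<lambda>x. 1 :: real) \<noteq> 0"
      using lmeasurable_dom by (simp add: L2_inner_def measure_restrict_space fmeasurableD)
    obtain C where C: "C > 0" "\<And>f g. H1_gradient \<Omega> f g \<Longrightarrow> L2_inner \<Omega> f (\<lambda>x. 1) = 0 \<Longrightarrow> L2_sq \<Omega> f \<le> C * L2_sq \<Omega> g"
      using poincare[OF in_L2_const one] by blast
    have "1 / (C + 1) * (L2_sq \<Omega> f + L2_sq \<Omega> g) \<le> L2_sq \<Omega> g - (LINT x|lebesgue_on \<Omega>. b x * (f x)\<^sup>2)"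
      if H: "H1_gradient \<Omega> f g" "L2_inner \<Omega> f (\<lambda>x. 1) = 0" for f g
    proof -
      have "L2_sq \<Omega> f + L2_sq \<Omega> g \<le> (C + 1) * L2_sq \<Omega> g" using C(2)[OF H] by (simp add: distrib_right)
      then show ?thesis using C(1) zero[OF H1_gradient_L2(1)[OF H(1)]] by (simp add: pos_divide_le_eq mult.commute)
    qed
    then show ?thesis using in_L2_const[of "1 :: real"] one C(1) by (intro exI[of _ "\<lambda>x. 1"] exI[of _ "1 / (C + 1)"]) auto
  next
    case False
    then have pos: "(LINT x|lebesgue_on \<Omega>. b x) > 0" using b0 by simp
    \<comment> \<open>For \<open>\<mu> \<le> 1\<close> the function \<open>\<mu> * b\<close> is its
      own positive part and lies below \<open>b\<close>, so its norm is less than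
      \<open>beta \<Omega> p\<close>, the infimum over \<open>Sigma_set \<Omega>\<close>.\<close>
    have no: "(\<lambda>x. \<mu> * b x) \<notin> Sigma_set \<Omega>" if \<mu>: "0 < \<mu>" "\<mu> \<le> 1" for \<mu>
    proof
      assume "(\<lambda>x. \<mu> * b x) \<in> Sigma_set \<Omega>"
      then have "beta \<Omega> p \<le> Lp_norm \<Omega> p (\<lambda>x. max (\<mu> * b x) 0)" unfolding beta_def by (rule INF_lower)
      also have "\<dots> \<le> Lp_norm \<Omega> p b"
      proof (rule Lp_norm_mono)
        show "\<bar>max (\<mu> * b x) 0\<bar> \<le> \<bar>b x\<bar>" for x using b(1)[of x] \<mu> by (simp add: mult_left_le_one_le max_absorb1)
      qed measurable
      finally show False using norm by simp
    qed
    obtain c where "c > 0" "\<And>f g. H1_gradient \<Omega> f g \<Longrightarrow> L2_inner \<Omega> f b = 0 \<Longrightarrow>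
      c * (L2_sq \<Omega> f + L2_sq \<Omega> g) \<le> L2_sq \<Omega> g - (LINT x|lebesgue_on \<Omega>. b x * (f x)\<^sup>2)"
      using spectral_gap[OF bm b(1) b(2) pos no] by blast
    moreover have "L2_inner \<Omega> (\<lambda>x. 1) b \<noteq> 0" using pos by (simp add: L2_inner_def)
    ultimately show ?thesis using bL2 by (intro exI[of _ b] exI[of _ c]) auto
  qed
qed

end

text \<open>Continuity in \<open>x\<close> for each \<open>u\<close>, together with a Lipschitz
  bound in \<open>u\<close> uniform in \<open>x\<close>, gives joint continuity on
  \<open>S \<times> UNIV\<close>, hence measurability of the superposition.\<close>

lemma uniformly_lipschitz_measurable:
  fixes F :: "'a::euclidean_space \<Rightarrow> 'b::euclidean_space \<Rightarrow> 'c::euclidean_space"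
  assumes cont: "\<And>u. continuous_on S (\<lambda>x. F x u)"
    and lip: "\<And>x u v. x \<in> S \<Longrightarrow> norm (F x u - F x v) \<le> L * norm (u - v)"
    and \<Omega>: "\<Omega> \<subseteq> S" and S: "S \<in> sets borel" and u: "u \<in> borel_measurable (lebesgue_on \<Omega>)"
  shows "(\<lambda>x. F x (u x)) \<in> borel_measurable (lebesgue_on \<Omega>)"
proof -
  have "continuous_on (S \<times> UNIV) (\<lambda>p. F (fst p) (snd p))"
    unfolding continuous_on_sequentially
  proof (intro allI ballI impI, elim conjE)
    fix X and p :: "'a \<times> 'b" assume p: "p \<in> S \<times> UNIV" and X: "\<forall>n. X n \<in> S \<times> UNIV" "X \<longlonglongrightarrow> p"
    obtain x a where pa: "p = (x, a)" by (cases p)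
    have l: "(\<lambda>n. fst (X n)) \<longlonglongrightarrow> x" "(\<lambda>n. snd (X n)) \<longlonglongrightarrow> a"
      using tendsto_fst[OF X(2)] tendsto_snd[OF X(2)] by (simp_all add: pa)
    have "(\<lambda>n. F (fst (X n)) a) \<longlonglongrightarrow> F x a"
      using cont[of a, unfolded continuous_on_sequentially, rule_format, of x "\<lambda>n. fst (X n)"] l(1) X(1) p
      by (auto simp: comp_def pa mem_Times_iff)
    moreover have "(\<lambda>n. F (fst (X n)) (snd (X n)) - F (fst (X n)) a) \<longlonglongrightarrow> 0"
    proof (rule Lim_null_comparison)
      show "\<forall>\<^sub>F n in sequentially. norm (F (fst (X n)) (snd (X n)) - F (fst (X n)) a) \<le> L * norm (snd (X n) - a)"
        using X(1) by (intro always_eventually allI lip) (auto simp: mem_Times_iff)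
      show "(\<lambda>n. L * norm (snd (X n) - a)) \<longlonglongrightarrow> 0"
        using tendsto_mult_left[OF tendsto_norm_zero[OF LIM_zero[OF l(2)]], of L] by simp
    qed
    ultimately have "(\<lambda>n. (F (fst (X n)) (snd (X n)) - F (fst (X n)) a) + F (fst (X n)) a) \<longlonglongrightarrow> 0 + F x a"
      by (intro tendsto_add)
    then show "((\<lambda>p. F (fst p) (snd p)) \<circ> X) \<longlonglongrightarrow> F (fst p) (snd p)" by (simp add: comp_def pa)
  qed
  then have "(\<lambda>p. F (fst p) (snd p)) \<in> borel_measurable (restrict_space borel (S \<times> UNIV))"
    by (rule borel_measurable_continuous_on_restrict)
  moreover have "(\<lambda>x. (x, u x)) \<in> measurable (lebesgue_on \<Omega>) (restrict_space borel (S \<times> UNIV))"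
  proof (rule measurable_restrict_space2)
    show "(\<lambda>x. (x, u x)) \<in> space (lebesgue_on \<Omega>) \<rightarrow> S \<times> UNIV" using \<Omega> by auto
    have "(\<lambda>x. x) \<in> borel_measurable (lebesgue_on \<Omega>)" by (rule borel_measurable_lebesgue_onI) simp
    then show "(\<lambda>x. (x, u x)) \<in> borel_measurable (lebesgue_on \<Omega>)" using u by (rule borel_measurable_Pair)
  qed
  ultimately have "(\<lambda>p. F (fst p) (snd p)) \<circ> (\<lambda>x. (x, u x)) \<in> borel_measurable (lebesgue_on \<Omega>)"
    by (intro measurable_comp)
  then show ?thesis by (simp add: comp_def)
qed

text \<open>The form attains a positive minimum on the compact unit sphere, and it is homogeneous of
  degree 2.\<close>

lemma positive_form_bound:
  fixes C :: "real ^ 'n ^ 'n"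
  assumes "\<And>k. k \<noteq> 0 \<Longrightarrow> 0 < (C *v k) \<bullet> k"
  obtains m where "m > 0" "\<And>k. m * (norm k)\<^sup>2 \<le> (C *v k) \<bullet> k"
proof -
  have cont: "continuous_on (sphere 0 1) (\<lambda>k. (C *v k) \<bullet> k)"
    by (intro continuous_intros matrix_vector_mult_linear_continuous_on)
  obtain z where z: "z \<in> sphere 0 1" "\<And>k. k \<in> sphere 0 1 \<Longrightarrow> (C *v z) \<bullet> z \<le> (C *v k) \<bullet> k"
  proof -
    have "sphere (0 :: real ^ 'n) 1 \<noteq> {}" by simp
    from continuous_attains_inf[OF compact_sphere this cont] show ?thesis using that by blast
  qed
  show ?thesis
  proof (rule that)
    have "z \<noteq> 0" using z(1) by auto
    then show "(C *v z) \<bullet> z > 0" by (rule assms)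
    fix k :: "real ^ 'n"
    show "(C *v z) \<bullet> z * (norm k)\<^sup>2 \<le> (C *v k) \<bullet> k"
    proof (cases "k = 0")
      case False
      have "(C *v z) \<bullet> z \<le> (C *v ((1 / norm k) *\<^sub>R k)) \<bullet> ((1 / norm k) *\<^sub>R k)" using False by (intro z(2)) simp
      also have "\<dots> = (C *v k) \<bullet> k / (norm k)\<^sup>2" by (simp add: matrix_vector_mult_scaleR power2_eq_square)
      finally show ?thesis using False by (simp add: pos_le_divide_eq)
    qed simp
  qed
qed

text \<open>The mean value identity is tested with the increment of the gradient itself, whose norm
  then cancels once. The Hessian lies between \<open>C\<close> and \<open>D\<close>, so its
  quadratic form obeys the same bound \<open>K\<close>.\<close>

lemma grad_lipschitz:
  fixes \<phi> :: "real ^ 'n \<Rightarrow> real"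
  assumes \<phi>: "class_C 2 \<phi>" and le: "\<And>u. loewner_le C (hessian \<phi> u)" "\<And>u. loewner_le (hessian \<phi> u) D"
    and K: "\<And>v. \<bar>(C *v v) \<bullet> v\<bar> \<le> K * (norm v)\<^sup>2" "\<And>v. \<bar>(D *v v) \<bullet> v\<bar> \<le> K * (norm v)\<^sup>2"
  shows "norm (grad \<phi> a - grad \<phi> a') \<le> 3 * K * norm (a - a')"
proof (cases "grad \<phi> a - grad \<phi> a' = 0")
  case True
  have "0 \<le> \<bar>(C *v axis undefined 1) \<bullet> axis undefined 1\<bar>" by (rule abs_ge_zero)
  also have "\<dots> \<le> K * (norm (axis undefined 1 :: real ^ 'n))\<^sup>2" by (rule K)
  finally show ?thesis using True by simp
next
  case False
  let ?e = "grad \<phi> a - grad \<phi> a'"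
  obtain z where z: "?e \<bullet> ?e = (hessian \<phi> z *v (a - a')) \<bullet> ?e" using grad_increment[OF \<phi>, of a a' ?e] by blast
  have "\<bar>(hessian \<phi> z *v v) \<bullet> v\<bar> \<le> K * (norm v)\<^sup>2" for v
    using loewner_leD(3)[OF le(1)[of z], of v] loewner_leD(3)[OF le(2)[of z], of v] K[of v] by linarith
  then have "\<bar>(hessian \<phi> z *v (a - a')) \<bullet> ?e\<bar> \<le> 3 * K * norm (a - a') * norm ?e"
    by (rule symmetric_matrix_bound[OF loewner_leD(2)[OF le(1)]])
  then have "norm ?e * norm ?e \<le> 3 * K * norm (a - a') * norm ?e"
    unfolding z[symmetric] by (simp add: power2_norm_eq_inner[symmetric] power2_eq_square)
  then show ?thesis using False by (simp add: mult_le_cancel_right)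
qed

text \<open>With \<open>a - a' = w + k\<close> and a symmetric matrix \<open>H\<close>, the cross terms of \<open>\<langle>H (w + k), w - k\<rangle>\<close> cancel.\<close>

lemma grad_split:
  fixes \<phi> :: "real ^ 'n \<Rightarrow> real"
  assumes \<phi>: "class_C 2 \<phi>" and le: "\<And>u. loewner_le C (hessian \<phi> u)" "\<And>u. loewner_le (hessian \<phi> u) D"
    and D: "\<And>i j. i \<noteq> j \<Longrightarrow> D $ i $ j = 0"
  shows "(grad \<phi> a - grad \<phi> a') \<bullet> ((a - a') - 2 *\<^sub>R k)
    \<le> (\<Sum>i\<in>UNIV. max (D $ i $ i) 0 * ((a - a') $ i - k $ i)\<^sup>2) - (C *v k) \<bullet> k"
proof -
  define w where "w = a - a' - k"
  have d: "a - a' = w + k" "(a - a') - 2 *\<^sub>R k = w - k" by (simp_all add: w_def scaleR_2)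
  obtain z where z: "(grad \<phi> a - grad \<phi> a') \<bullet> (w - k) = (hessian \<phi> z *v (w + k)) \<bullet> (w - k)"
    using grad_increment[OF \<phi>, of a a' "w - k"] unfolding d(1) by blast
  let ?H = "hessian \<phi> z"
  have "(?H *v (w + k)) \<bullet> (w - k) = (?H *v w) \<bullet> w - (?H *v k) \<bullet> k"
    using symmetric_matrix_inner[OF loewner_leD(2)[OF le(1)[of z]], of w k]
    by (simp add: matrix_vector_right_distrib inner_add_left inner_diff_right)
  also have "\<dots> \<le> (D *v w) \<bullet> w - (C *v k) \<bullet> k"
    using loewner_leD(3)[OF le(2)[of z], of w] loewner_leD(3)[OF le(1)[of z], of k] by linarith
  also have "(D *v w) \<bullet> w = (\<Sum>i\<in>UNIV. D $ i $ i * (w $ i)\<^sup>2)"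
  proof -
    have "(\<Sum>j\<in>UNIV. D $ i $ j * w $ j * w $ i) = D $ i $ i * (w $ i)\<^sup>2" for i
    proof -
      have "(\<Sum>j\<in>UNIV. D $ i $ j * w $ j * w $ i) = (\<Sum>j\<in>UNIV. if j = i then D $ i $ i * (w $ i)\<^sup>2 else 0)"
        using D[of i] by (intro sum.cong refl) (auto simp: power2_eq_square)
      then show ?thesis by simp
    qed
    then show ?thesis unfolding matrix_form_expand by simp
  qed
  \<comment> \<open>Positive parts are taken because the spectral gap concerns a nonnegative weight
    and \<open>beta\<close> measures positive parts.\<close>
  also have "\<dots> \<le> (\<Sum>i\<in>UNIV. max (D $ i $ i) 0 * (w $ i)\<^sup>2)" by (intro sum_mono mult_right_mono) auto
  finally show ?thesis unfolding d(2) z by (simp add: w_def)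
qed

text \<open>\<open>G\<close> is continuous in \<open>x\<close> for each fixed \<open>u\<close> only.
  The difference quotients in \<open>u\<close> inherit this, and they converge to the directional
  derivative uniformly in \<open>x\<close>, because the Lipschitz constant of the gradient does not
  depend on \<open>x\<close>.\<close>

lemma grad_continuous_parameter:
  fixes G :: "'a::t2_space \<Rightarrow> real ^ 'n \<Rightarrow> real"
  assumes G: "\<And>x. x \<in> S \<Longrightarrow> class_C 2 (G x)" and cont: "\<And>u. continuous_on S (\<lambda>x. G x u)"
    and lip: "\<And>x u v. x \<in> S \<Longrightarrow> norm (grad (G x) u - grad (G x) v) \<le> L * norm (u - v)"
  shows "continuous_on S (\<lambda>x. grad (G x) u)"
proof -
  have "continuous_on S (\<lambda>x. grad (G x) u \<bullet> h)" for h
  proof (rule uniform_limit_theorem)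
    let ?D = "\<lambda>n x. real (Suc n) * (G x (u + (1 / real (Suc n)) *\<^sub>R h) - G x u)"
    show "\<forall>\<^sub>F n in sequentially. continuous_on S (?D n)"
      by (intro always_eventually allI continuous_intros cont)
    show "uniform_limit S ?D (\<lambda>x. grad (G x) u \<bullet> h) sequentially"
      unfolding uniform_limit_iff
    proof (intro allI impI)
      fix e :: real assume e: "e > 0"
      have "(\<lambda>n. \<bar>L\<bar> * (norm h)\<^sup>2 * (1 / real (Suc n))) \<longlonglongrightarrow> \<bar>L\<bar> * (norm h)\<^sup>2 * 0"
        by (intro tendsto_intros LIMSEQ_Suc[OF lim_1_over_n])
      then have "\<forall>\<^sub>F n in sequentially. \<bar>L\<bar> * (norm h)\<^sup>2 * (1 / real (Suc n)) < e"
        using e by (intro order_tendstoD) auto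
      then show "\<forall>\<^sub>F n in sequentially. \<forall>x\<in>S. dist (?D n x) (grad (G x) u \<bullet> h) < e"
      proof eventually_elim
        case (elim n)
        show ?case
        proof
          fix x assume x: "x \<in> S"
          define t where "t = 1 / real (Suc n)"
          have t: "t > 0" by (simp add: t_def)
          have der: "((\<lambda>s. G x (u + s *\<^sub>R h)) has_real_derivative grad (G x) (u + s *\<^sub>R h) \<bullet> h) (at s)" for s
          proof -
            have C: "class_C (Suc (Suc 0)) (G x)" using G[OF x] by (simp add: numeral_2_eq_2)
            have "((\<lambda>s. u + s *\<^sub>R h) has_derivative (\<lambda>r. r *\<^sub>R h)) (at s)" by (auto intro!: derivative_eq_intros)
            from has_derivative_compose[OF this class_C_has_derivative[OF C]]
            have "((\<lambda>s. G x (u + s *\<^sub>R h)) has_derivative (\<lambda>r. grad (G x) (u + s *\<^sub>R h) \<bullet> (r *\<^sub>R h))) (at s)"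
              unfolding frechet_derivative_eq_grad[OF C] .
            moreover have "(\<lambda>r. grad (G x) (u + s *\<^sub>R h) \<bullet> (r *\<^sub>R h)) = (*) (grad (G x) (u + s *\<^sub>R h) \<bullet> h)"
              by (simp add: fun_eq_iff mult.commute)
            ultimately show ?thesis by (simp add: has_field_derivative_def)
          qed
          from MVT2[of 0 t "\<lambda>s. G x (u + s *\<^sub>R h)" "\<lambda>s. grad (G x) (u + s *\<^sub>R h) \<bullet> h", OF t der]
          obtain s where s: "0 < s" "s < t" "G x (u + t *\<^sub>R h) - G x (u + 0 *\<^sub>R h) = (t - 0) * (grad (G x) (u + s *\<^sub>R h) \<bullet> h)" by blast
          have "?D n x = grad (G x) (u + s *\<^sub>R h) \<bullet> h"
            using s(3) t unfolding t_def[symmetric] by (simp add: t_def)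
          then have "dist (?D n x) (grad (G x) u \<bullet> h) = \<bar>(grad (G x) (u + s *\<^sub>R h) - grad (G x) u) \<bullet> h\<bar>"
            by (simp add: dist_real_def inner_diff_left)
          also have "\<dots> \<le> norm (grad (G x) (u + s *\<^sub>R h) - grad (G x) u) * norm h" by (rule Cauchy_Schwarz_ineq2)
          also have "\<dots> \<le> (L * norm ((u + s *\<^sub>R h) - u)) * norm h" by (intro mult_right_mono lip x norm_ge_zero)
          also have "\<dots> = L * (norm h)\<^sup>2 * s" using s(1) by (simp add: power2_eq_square)
          also have "\<dots> \<le> \<bar>L\<bar> * (norm h)\<^sup>2 * t" using s by (intro mult_mono) auto
          finally show "dist (?D n x) (grad (G x) u \<bullet> h) < e" using elim by (simp add: t_def)
        qed
      qed
    qed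
  qed simp
  then show ?thesis by (simp add: continuous_on_componentwise[of S "\<lambda>x. grad (G x) u"])
qed

theorem theorem5p3:
  fixes \<Omega> :: "(real^'N) set"
    and G :: "real^'N \<Rightarrow> real^'n \<Rightarrow> real"
    and A B :: "real^'N \<Rightarrow> real^'n^'n"
    and p :: "'n \<Rightarrow> ennreal"
  assumes dim: "CARD('N) \<ge> 2"
    and domain: "bounded \<Omega>" "regular_domain \<Omega>"
    and G_C2: "\<And>x. x \<in> closure \<Omega> \<Longrightarrow> class_C 2 (G x)"
    and G_cont: "\<And>u. continuous_on (closure \<Omega>) (\<lambda>x. G x u)"
    and A_cont: "continuous_on (closure \<Omega>) A"
    and B_cont: "continuous_on (closure \<Omega>) B"
    and A_sym: "\<And>x. x \<in> closure \<Omega> \<Longrightarrow> transpose (A x) = A x"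
    and B_diag: "\<And>x i j. x \<in> closure \<Omega> \<Longrightarrow> i \<noteq> j \<Longrightarrow> B x $ i $ j = 0"
    and p_range: "\<And>i. ennreal (real CARD('N) / 2) < p i"
    and bounds: "\<And>x u. x \<in> closure \<Omega> \<Longrightarrow>
                   loewner_le (A x) (hessian (G x) u) \<and> loewner_le (hessian (G x) u) (B x)"
    and B_norm: "\<And>i. Lp_norm \<Omega> (p i) (\<lambda>x. max (B x $ i $ i) 0) < beta \<Omega> (p i)"
    and A_pos: "\<And>k. k \<noteq> 0 \<Longrightarrow> 0 < (LINT x|lebesgue_on \<Omega>. (A x *v k) \<bullet> k)"
  shows "\<exists>u. neumann_system_solution \<Omega> G u \<and>
           (\<forall>v. neumann_system_solution \<Omega> G v \<longrightarrow> (AE x in lebesgue_on \<Omega>. v x = u x))"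
proof -
  interpret regular_bounded \<Omega> by unfold_locales (rule domain)+
  have cpt: "compact (closure \<Omega>)" using domain(1) by simp
  have sub: "\<Omega> \<subseteq> closure \<Omega>" by (rule closure_subset)
  define F where "F x u = grad (G x) u" for x u
  define b where "b i x = max (B x $ i $ i) 0" for i x
  have "bounded (A ` closure \<Omega>)" "bounded (B ` closure \<Omega>)"
    by (intro compact_imp_bounded compact_continuous_image A_cont B_cont cpt)+
  then obtain K1 K2 where K12: "\<And>x. x \<in> closure \<Omega> \<Longrightarrow> norm (A x) \<le> K1" "\<And>x. x \<in> closure \<Omega> \<Longrightarrow> norm (B x) \<le> K2"
    unfolding bounded_iff by auto
  define N where "N = max 0 (max K1 K2)"
  have N: "N \<ge> 0" "\<And>x. x \<in> closure \<Omega> \<Longrightarrow> norm (A x) \<le> N" "\<And>x. x \<in> closure \<Omega> \<Longrightarrow> norm (B x) \<le> N"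
    using K12 by (auto simp: N_def le_max_iff_disj)
  \<comment> \<open>The squared dimension comes from bounding the operator norm of a matrix by a
    bound \<open>N\<close> on its entries. It yields the Lipschitz constant \<open>3 * K\<close> of
    the gradients, common to all \<open>x\<close>.\<close>
  define K where "K = real CARD('n) * real CARD('n) * N"
  have K0: "K \<ge> 0" using N(1) by (simp add: K_def)
  have K: "\<bar>(A x *v v) \<bullet> v\<bar> \<le> K * (norm v)\<^sup>2" "\<bar>(B x *v v) \<bullet> v\<bar> \<le> K * (norm v)\<^sup>2" if "x \<in> closure \<Omega>" for x v
    unfolding K_def by (intro matrix_form_bound N that)+
  have lip: "norm (F x a - F x a') \<le> 3 * K * norm (a - a')" if x: "x \<in> closure \<Omega>" for x a a'
    unfolding F_def using bounds[OF x] K[OF x] by (intro grad_lipschitz[OF G_C2[OF x], where C = "A x" and D = "B x"]) auto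
  have F_cont: "continuous_on (closure \<Omega>) (\<lambda>x. F x u)" for u
    unfolding F_def by (rule grad_continuous_parameter[OF G_C2 G_cont lip[unfolded F_def]])
  have entry: "continuous_on (closure \<Omega>) (\<lambda>x. C x $ i $ j)" if "continuous_on (closure \<Omega>) C"
    for C :: "real^'N \<Rightarrow> real^'n^'n" and i j
    using that by (intro continuous_on_component)
  have meas: "f \<in> borel_measurable (lebesgue_on \<Omega>)" if "continuous_on (closure \<Omega>) f" for f :: "real^'N \<Rightarrow> 'd::euclidean_space"
    using lmeasurable_dom continuous_on_subset[OF that sub]
    by (intro continuous_imp_measurable_on_sets_lebesgue) (auto simp: fmeasurableD)
  have b_meas: "b i \<in> borel_measurable (lebesgue_on \<Omega>)" for i
    unfolding b_def by (intro meas continuous_on_max continuous_on_const entry B_cont)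
  have b_bound: "0 \<le> b i x" "x \<in> \<Omega> \<Longrightarrow> b i x \<le> N" for i x
  proof -
    show "0 \<le> b i x" by (simp add: b_def)
    assume "x \<in> \<Omega>"
    then have "norm (B x) \<le> N" using sub by (intro N) auto
    then show "b i x \<le> N"
      using component_le_norm_cart[of "B x $ i" i] Finite_Cartesian_Product.norm_nth_le[of "B x" i] N(1) by (auto simp: b_def)
  qed
  define P where "P i q c \<longleftrightarrow> in_L2 \<Omega> q \<and> L2_inner \<Omega> (\<lambda>x. 1) q \<noteq> 0 \<and> c > 0 \<and> (\<forall>f g. H1_gradient \<Omega> f g \<longrightarrow> L2_inner \<Omega> f q = 0 \<longrightarrow>
    c * (L2_sq \<Omega> f + L2_sq \<Omega> g) \<le> L2_sq \<Omega> g - (LINT x|lebesgue_on \<Omega>. b i x * (f x)\<^sup>2))" for i q c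
  have b_eq: "b i = (\<lambda>x. max (B x $ i $ i) 0)" for i by (simp add: b_def fun_eq_iff)
  have "\<exists>q c. P i q c" for i
    unfolding P_def by (rule weight_with_gap[where p = "p i", OF b_meas b_bound]) (simp_all only: b_eq B_norm)
  then obtain q c where Pqc: "\<And>i. P i (q i) (c i)" by metis
  \<comment> \<open>Each component has its own gap constant; the minimum over the finitely many
    components serves all of them.\<close>
  define c0 where "c0 = Min (range c)"
  have c0: "c0 > 0" "c0 \<le> c i" for i
  proof -
    have "c j > 0" for j using Pqc[of j] by (simp add: P_def)
    then show "c0 > 0" by (simp add: c0_def)
    show "c0 \<le> c i" by (simp add: c0_def)
  qed
  have gap: "c0 * (L2_sq \<Omega> f + L2_sq \<Omega> g) \<le> L2_sq \<Omega> g - (LINT x|lebesgue_on \<Omega>. b i x * (f x)\<^sup>2)"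
    if H: "H1_gradient \<Omega> f g" "L2_inner \<Omega> f (q i) = 0" for i f g
  proof -
    have "c0 * (L2_sq \<Omega> f + L2_sq \<Omega> g) \<le> c i * (L2_sq \<Omega> f + L2_sq \<Omega> g)"
      by (intro mult_right_mono c0 add_nonneg_nonneg L2_sq_nonneg)
    also have "\<dots> \<le> L2_sq \<Omega> g - (LINT x|lebesgue_on \<Omega>. b i x * (f x)\<^sup>2)" using Pqc[of i] H by (simp add: P_def)
    finally show ?thesis .
  qed
  interpret fin: finite_measure "lebesgue_on \<Omega>" by (rule finite_measure_lebesgue_on[OF lmeasurable_dom])
  have A_entry_int: "integrable (lebesgue_on \<Omega>) (\<lambda>x. A x $ i $ j)" for i j
  proof (rule fin.integrable_const_bound[where B = N])
    show "AE x in lebesgue_on \<Omega>. norm (A x $ i $ j) \<le> N"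
    proof (rule AE_I2)
      fix x assume "x \<in> space (lebesgue_on \<Omega>)"
      then have "norm (A x) \<le> N" using sub by (intro N) auto
      then show "norm (A x $ i $ j) \<le> N"
        using component_le_norm_cart[of "A x $ i" j] Finite_Cartesian_Product.norm_nth_le[of "A x" i] by simp
    qed
    show "(\<lambda>x. A x $ i $ j) \<in> borel_measurable (lebesgue_on \<Omega>)" by (rule meas[OF entry[OF A_cont]])
  qed
  \<comment> \<open>Integrating \<open>A\<close> entrywise turns the integral hypothesis into
    positive definiteness of one constant matrix, which supplies the uniform constant
    \<open>m\<close>.\<close>
  define A0 where "A0 = (\<chi> i j. LINT x|lebesgue_on \<Omega>. A x $ i $ j)"
  have A_int: "integrable (lebesgue_on \<Omega>) (\<lambda>x. (A x *v k) \<bullet> k)" for k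
    unfolding matrix_form_expand by (intro Bochner_Integration.integrable_sum integrable_mult_left A_entry_int)
  have A_eq: "(LINT x|lebesgue_on \<Omega>. (A x *v k) \<bullet> k) = (A0 *v k) \<bullet> k" for k
    unfolding matrix_form_expand
    by (subst Bochner_Integration.integral_sum, intro Bochner_Integration.integrable_sum integrable_mult_left A_entry_int,
        subst Bochner_Integration.integral_sum, intro integrable_mult_left A_entry_int) (simp add: A0_def)
  obtain m where m: "m > 0" "\<And>k. m * (norm k)\<^sup>2 \<le> (A0 *v k) \<bullet> k"
    using positive_form_bound[of A0] A_pos unfolding A_eq by blast
  interpret monotone_system \<Omega> F b q A "3 * K" N c0 m
  proof
    show "(\<lambda>x. F x (u x)) \<in> borel_measurable (lebesgue_on \<Omega>)" if "u \<in> borel_measurable (lebesgue_on \<Omega>)" for u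
      by (rule uniformly_lipschitz_measurable[OF F_cont lip sub borel_closed[OF closed_closure] that])
    show "in_L2 \<Omega> (\<lambda>x. F x 0)"
    proof -
      have "bounded ((\<lambda>x. F x 0) ` closure \<Omega>)" by (intro compact_imp_bounded compact_continuous_image F_cont cpt)
      then obtain R where "\<And>x. x \<in> closure \<Omega> \<Longrightarrow> norm (F x 0) \<le> R" unfolding bounded_iff by auto
      then show ?thesis using sub by (intro in_L2_bounded[where C = R, OF lmeasurable_dom meas[OF F_cont]]) auto
    qed
    show "0 \<le> 3 * K" using K0 by simp
    show "norm (F x a - F x a') \<le> 3 * K * norm (a - a')" if "x \<in> \<Omega>" for x a a' using that sub by (intro lip) auto
    show "(F x a - F x a') \<bullet> (a - a' - 2 *\<^sub>R k) \<le> (\<Sum>i\<in>UNIV. b i x * ((a - a') $ i - k $ i)\<^sup>2) - (A x *v k) \<bullet> k"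
      if "x \<in> \<Omega>" for x a a' k
    proof -
      have x: "x \<in> closure \<Omega>" using that sub by blast
      show ?thesis unfolding F_def b_def using bounds[OF x] B_diag[OF x] by (intro grad_split[OF G_C2[OF x]]) auto
    qed
    show "b i \<in> borel_measurable (lebesgue_on \<Omega>)" for i by (rule b_meas)
    show "\<bar>b i x\<bar> \<le> N" if "x \<in> \<Omega>" for i x using b_bound(1)[of i x] b_bound(2)[OF that, of i] by simp
    show "integrable (lebesgue_on \<Omega>) (\<lambda>x. (A x *v k) \<bullet> k)" for k by (rule A_int)
    show "0 < m" by (rule m)
    show "m * (norm k)\<^sup>2 \<le> (LINT x|lebesgue_on \<Omega>. (A x *v k) \<bullet> k)" for k unfolding A_eq by (rule m)
    show "in_L2 \<Omega> (q i)" "L2_inner \<Omega> (\<lambda>x. 1) (q i) \<noteq> 0" for i using Pqc[of i] by (simp_all add: P_def)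
    show "0 < c0" by (rule c0)
  qed (rule gap)
  obtain u where u: "u \<in> V" "\<And>v. v \<in> V \<Longrightarrow> residual u v = 0" using residual_zero_exists by blast
  let ?u = "vec_of u"
  show ?thesis
  proof (intro exI[of _ ?u] conjI allI impI)
    show "neumann_system_solution \<Omega> G ?u"
      unfolding neumann_system_solution_def
    proof (intro allI conjI)
      fix i
      have ui: "(\<lambda>x. ?u x $ i) = fst (u i)" by (simp add: vec_of_def fun_eq_iff)
      show "(\<lambda>x. ?u x $ i) \<in> H1 \<Omega>" unfolding ui H1_def using H1_spaceD(1)[OF u(1)] by blast
      show "weak_neumann \<Omega> (\<lambda>x. ?u x $ i) (\<lambda>x. grad (G x) (?u x) $ i)"
        unfolding weak_neumann_def ui
      proof (intro exI[of _ "snd (u i)"] conjI allI impI)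
        show "H1_gradient \<Omega> (fst (u i)) (snd (u i))" by (rule H1_spaceD(1)[OF u(1)])
        fix v Dv assume H: "H1_gradient \<Omega> v Dv"
        show "integrable (lebesgue_on \<Omega>) (\<lambda>x. grad (G x) (?u x) $ i * v x)"
          using in_L2_mult_integrable[OF in_L2_nth[OF F_L2[OF vec_of_L2[OF u(1)]]] H1_gradient_L2(1)[OF H], of i] by (simp add: F_def)
        have "L2_inner \<Omega> (snd (u i)) Dv = L2_inner \<Omega> (\<lambda>x. F x (?u x) $ i) v"
          using weak_solution_iff_residual[OF u(1)] u(2) H by blast
        then show "(LINT x|lebesgue_on \<Omega>. snd (u i) x \<bullet> Dv x) = (LINT x|lebesgue_on \<Omega>. grad (G x) (?u x) $ i * v x)"
          by (simp add: L2_inner_def F_def)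
      qed
    qed
    fix v assume v: "neumann_system_solution \<Omega> G v"
    define W where "W i Dw \<longleftrightarrow> H1_gradient \<Omega> (\<lambda>x. v x $ i) Dw \<and> (\<forall>w Dv. H1_gradient \<Omega> w Dv \<longrightarrow>
      integrable (lebesgue_on \<Omega>) (\<lambda>x. grad (G x) (v x) $ i * w x) \<and>
      (LINT x|lebesgue_on \<Omega>. Dw x \<bullet> Dv x) = (LINT x|lebesgue_on \<Omega>. grad (G x) (v x) $ i * w x))" for i Dw
    have "\<exists>Dw. W i Dw" for i
      using v unfolding neumann_system_solution_def weak_neumann_def W_def by blast
    then obtain Dw where Dw: "\<And>i. W i (Dw i)" by metis
    \<comment> \<open>An arbitrary solution, paired with the gradients that witness it, is an
      element of \<open>V\<close>, so that uniqueness of the zero of \<open>residual\<close> applies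
      to it.\<close>
    define u' :: "(real^'N, 'n) H1_vec" where "u' i = ((\<lambda>x. v x $ i), Dw i)" for i
    have u'V: "u' \<in> V" using Dw by (simp add: H1_space_def u'_def W_def)
    have vec: "vec_of u' = v" by (simp add: vec_of_def u'_def fun_eq_iff vec_eq_iff)
    have "\<forall>w\<in>V. residual u' w = 0"
      unfolding weak_solution_iff_residual[OF u'V]
    proof (intro allI impI)
      fix i w Dv assume "H1_gradient \<Omega> w Dv"
      then show "L2_inner \<Omega> (snd (u' i)) Dv = L2_inner \<Omega> (\<lambda>x. F x (vec_of u' x) $ i) w"
        using Dw[of i] unfolding W_def vec by (simp add: L2_inner_def F_def u'_def)
    qed
    then show "AE x in lebesgue_on \<Omega>. v x = ?u x"
      using residual_zero_unique[OF u'V u(1)] u(2) unfolding vec by blast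
  qed
qed

end
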